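(* Let $d\in\left(0,\frac{\pi}{2}\right)$ and $H\in\mathbb{C}$. Let $(q,h,\beta,\gamma)$ and $(\tilde q,\tilde h,\tilde\beta,\tilde\gamma)$ be two sets of coefficients and let $B,B^\infty$ and $\tilde B,\tilde B^\infty$ be the corresponding boundary value problems with this same $H$ and $d$ (see context). Let $m\in\mathbb{N}_0\cup\{-1\}$, and suppose that $q,\tilde q$ are $C^m$ near $\frac{\pi}{2}$ and that $q=\tilde q$ a.e. on $\left[\frac{\pi}{2},\pi\right]$. Suppose that at least one of the following holds: (i) $\sigma(B)$ and $\sigma(\tilde B)$ coincide except for $\left[\frac{m+2}{2}\right]$ eigenvalues, i.e. there are sets $\Lambda,\tilde\Lambda\subset\mathbb{N}_0$ with $\#\Lambda=\#\tilde\Lambda=\left[\frac{m+2}{2}\right]$ such that $\{\lambda_n\}_{n\in\mathbb{N}_0\setminus\Lambda}$ and $\{\tilde\lambda_n\}_{n\in\mathbb{N}_0\setminus\tilde\Lambda}$ coincide, counted with repetitions; (ii) $\sigma(B^\infty)$ and $\sigma(\tilde B^\infty)$ coincide except for $\left[\frac{m+1}{2}\right]$ eigenvalues, i.e. there are sets $\Lambda,\tilde\Lambda\subset\mathbb{N}_0$ with $\#\Lambda=\#\tilde\Lambda=\left[\frac{m+1}{2}\right]$ such that $\{\lambda_n^\infty\}_{n\in\mathbb{N}_0\setminus\Lambda}$ and $\{\tilde\lambda_n^\infty\}_{n\in\mathbb{N}_0\setminus\tilde\Lambda}$ coincide, counted with repetitions. Then $h=\tilde h$, $\beta=\tilde\beta$,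 $\gamma=\tilde\gamma$ and $q=\tilde q$ a.e. on $[0,\pi]$.
   Context: For coefficients $q\in L^1([0,\pi];\mathbb{C})$, $h,H,\gamma\in\mathbb{C}$, $\beta\in\mathbb{R}$ with $\beta>0$, and $d\in(0,\pi)$, consider the equation $-y''+q(x)y=\lambda y$ on $(0,\pi)$ with the boundary condition $y'(0)-hy(0)=0$ and the jump conditions $y(d+0)=\beta y(d-0)$, $y'(d+0)=\beta^{-1}y'(d-0)+\gamma y(d-0)$. Problem $B$ has in addition the condition $y'(\pi)+Hy(\pi)=0$; problem $B^\infty$ has instead the condition $y(\pi)=0$. Let $\varphi(x,\lambda)$ be the solution of the equation satisfying the jump conditions and $\varphi(0,\lambda)=1,\varphi'(0,\lambda)=h$. The eigenvalues of $B$ and $B^\infty$ are the zeros of the entire functions $\Delta(\lambda)=\varphi'(\pi,\lambda)+H\varphi(\pi,\lambda)$ and $\Delta^\infty(\lambda)=-\varphi(\pi,\lambda)$, respectively; the algebraic multiplicity of an eigenvalue is its order as a zero. $\sigma(B)=\{\lambda_n\}_{n\in\mathbb{N}_0}$ and $\sigma(B^\infty)=\{\lambda_n^\infty\}_{n\in\mathbb{N}_0}$ are the sequences of all eigenvalues, repeated according to algebraic multiplicity, ordered by nondecreasing modulus, with identical eigenvalues adjacent. Symbols with a tilde denote the corresponding objects for $(\tilde q,\tilde h,H,\tilde\beta,\tilde\gamma,d)$. "$C^m$ near $\frac\pi2$" means $C^m$ in a neighbourhood of $\frac\pi2$; by convention $C^{-1}$ means $L^1$ (no extra smoothness). $[\,\cdot\,]$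 denotes the integer part. *)

theory Defs
  imports "HOL-Complex_Analysis.Complex_Analysis"
begin

(* Intended for bounded intervals S: f is absolutely continuous on S with a.e. derivative
   g in L^1(S), written as an indefinite integral.  In particular f has one-sided limits at
   the end points not belonging to S. *)
definition has_ac_derivative_on ::
  "(real \<Rightarrow> complex) \<Rightarrow> (real \<Rightarrow> complex) \<Rightarrow> real set \<Rightarrow> bool" where
  "has_ac_derivative_on f g S \<longleftrightarrow>
     g absolutely_integrable_on S \<and>
     (\<forall>s\<in>S. \<forall>t\<in>S. s \<le> t \<longrightarrow> f t - f s = integral {s..t} g)"

(* Solutions in the sense of Caratheodory; y' is the (continuous) derivative of y on S.
   The spectral parameter is called \<mu>. *)
definition solves_on ::
  "(real \<Rightarrow> complex) \<Rightarrow> complex \<Rightarrow> real set \<Rightarrow> (real \<Rightarrow> complex) \<Rightarrow> (real \<Rightarrow> complex) \<Rightarrow> bool" where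
  "solves_on q \<mu> S y y' \<longleftrightarrow>
     has_ac_derivative_on y y' S \<and>
     (\<exists>y''. has_ac_derivative_on y' y'' S \<and>
        (AE x in lebesgue. x \<in> S \<longrightarrow> - y'' x + q x * y x = \<mu> * y x))"

definition jump_conditions ::
  "real \<Rightarrow> complex \<Rightarrow> real \<Rightarrow> (real \<Rightarrow> complex) \<Rightarrow> (real \<Rightarrow> complex) \<Rightarrow> bool" where
  "jump_conditions \<beta> \<gamma> d y y' \<longleftrightarrow>
     (\<exists>yl yr dl dr.
        (y \<longlongrightarrow> yl) (at_left d) \<and> (y \<longlongrightarrow> yr) (at_right d) \<and>
        (y' \<longlongrightarrow> dl) (at_left d) \<and> (y' \<longlongrightarrow> dr) (at_right d) \<and>
        yr = of_real \<beta> * yl \<and>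
        dr = of_real (inverse \<beta>) * dl + \<gamma> * yl)"

definition is_phi ::
  "(real \<Rightarrow> complex) \<Rightarrow> complex \<Rightarrow> real \<Rightarrow> complex \<Rightarrow> real \<Rightarrow> complex
   \<Rightarrow> (real \<Rightarrow> complex) \<times> (real \<Rightarrow> complex) \<Rightarrow> bool" where
  "is_phi q h \<beta> \<gamma> d \<mu> = (\<lambda>(y, y').
     solves_on q \<mu> {0..<d} y y' \<and> solves_on q \<mu> {d<..pi} y y' \<and>
     jump_conditions \<beta> \<gamma> d y y' \<and> y 0 = 1 \<and> y' 0 = h)"

(* The pair (phi, phi').  Its values are uniquely determined on [0,d) and (d,pi];
   only the irrelevant values at d and outside [0,pi] depend on the choice. *)
definition phi_pair ::
  "(real \<Rightarrow> complex) \<Rightarrow> complex \<Rightarrow> real \<Rightarrow> complex \<Rightarrow> real \<Rightarrow> complex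
   \<Rightarrow> (real \<Rightarrow> complex) \<times> (real \<Rightarrow> complex)" where
  "phi_pair q h \<beta> \<gamma> d \<mu> = (SOME p. is_phi q h \<beta> \<gamma> d \<mu> p)"

definition phi :: "(real \<Rightarrow> complex) \<Rightarrow> complex \<Rightarrow> real \<Rightarrow> complex \<Rightarrow> real \<Rightarrow> real \<Rightarrow> complex \<Rightarrow> complex"
  where "phi q h \<beta> \<gamma> d x \<mu> = fst (phi_pair q h \<beta> \<gamma> d \<mu>) x"

definition dphi :: "(real \<Rightarrow> complex) \<Rightarrow> complex \<Rightarrow> real \<Rightarrow> complex \<Rightarrow> real \<Rightarrow> real \<Rightarrow> complex \<Rightarrow> complex"
  where "dphi q h \<beta> \<gamma> d x \<mu> = snd (phi_pair q h \<beta> \<gamma> d \<mu>) x"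

definition Delta ::
  "(real \<Rightarrow> complex) \<Rightarrow> complex \<Rightarrow> complex \<Rightarrow> real \<Rightarrow> complex \<Rightarrow> real \<Rightarrow> complex \<Rightarrow> complex" where
  "Delta q h H \<beta> \<gamma> d \<mu> = dphi q h \<beta> \<gamma> d pi \<mu> + H * phi q h \<beta> \<gamma> d pi \<mu>"

definition Delta_inf ::
  "(real \<Rightarrow> complex) \<Rightarrow> complex \<Rightarrow> real \<Rightarrow> complex \<Rightarrow> real \<Rightarrow> complex \<Rightarrow> complex" where
  "Delta_inf q h \<beta> \<gamma> d \<mu> = - phi q h \<beta> \<gamma> d pi \<mu>"

(* lam enumerates the zeros of the entire function D, each one as often as its order,
   by nondecreasing modulus and with equal entries adjacent. *)
definition spectrum_enum :: "(complex \<Rightarrow> complex) \<Rightarrow> (nat \<Rightarrow> complex) \<Rightarrow> bool" where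
  "spectrum_enum D lam \<longleftrightarrow>
     range lam = {z. D z = 0} \<and>
     (\<forall>z. D z = 0 \<longrightarrow> finite {n. lam n = z} \<and> int (card {n. lam n = z}) = zorder D z) \<and>
     mono (\<lambda>n. cmod (lam n)) \<and>
     (\<forall>i j k. i \<le> j \<and> j \<le> k \<and> lam i = lam k \<longrightarrow> lam j = lam i)"

(* The bijection expresses that the two remaining families agree as multisets. *)
definition coincide_except :: "nat \<Rightarrow> (nat \<Rightarrow> complex) \<Rightarrow> (nat \<Rightarrow> complex) \<Rightarrow> bool" where
  "coincide_except k lam lam' \<longleftrightarrow>
     (\<exists>L L'. finite L \<and> finite L' \<and> card L = k \<and> card L' = k \<and>
        (\<exists>f. bij_betw f (- L) (- L') \<and> (\<forall>n\<in>- L. lam n = lam' (f n))))"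

definition spectra_coincide_except ::
  "nat \<Rightarrow> (complex \<Rightarrow> complex) \<Rightarrow> (complex \<Rightarrow> complex) \<Rightarrow> bool" where
  "spectra_coincide_except k D D' \<longleftrightarrow>
     (\<exists>lam lam'. spectrum_enum D lam \<and> spectrum_enum D' lam' \<and> coincide_except k lam lam')"

definition C_on :: "nat \<Rightarrow> (real \<Rightarrow> complex) \<Rightarrow> real set \<Rightarrow> bool" where
  "C_on m f U \<longleftrightarrow>
     (\<exists>D. (\<forall>x\<in>U. D 0 x = f x) \<and>
          (\<forall>k<m. \<forall>x\<in>U. (D k has_vector_derivative D (Suc k) x) (at x)) \<and>
          (\<forall>k\<le>m. continuous_on U (D k)))"

(* An element of L^1 is C^m near a if some representative is;
   by convention m = -1 imposes no condition. *)
definition C_near :: "int \<Rightarrow> (real \<Rightarrow> complex) \<Rightarrow> real \<Rightarrow> bool" where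
  "C_near m q a \<longleftrightarrow> m = -1 \<or>
     (0 \<le> m \<and> (\<exists>e>0. \<exists>g. C_on (nat m) g {a - e<..<a + e} \<and>
        (AE x in lebesgue. x \<in> {a - e<..<a + e} \<longrightarrow> q x = g x)))"

end

theory Submission
  imports Defs
begin

text \<open>
Let \<open>b = \<pi> / 2\<close>, write the spectral parameter as \<open>\<rho>\<^sup>2\<close> with \<open>\<tau> = \<bar>Im \<rho>\<bar>\<close>, and let
\<open>F = \<phi> \<phi>t' - \<phi>' \<phi>t\<close> at \<open>b\<close>, a suffix \<open>t\<close> standing for the tilde. As the potentials agree on
\<open>[b, \<pi>]\<close>, both characteristic functions are the same combination \<open>A \<phi>(b) + B \<phi>'(b)\<close>, with \<open>A\<close>, \<open>B\<close> entire
without common zeros. Hence \<open>F\<close> vanishes at the common eigenvalues with multiplicity, and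
\<open>F P = \<Delta> Q\<close> with \<open>Q\<close> entire and \<open>P\<close> a polynomial whose degree is the number of exceptional
eigenvalues. On the boundaries of suitable squares in the \<open>\<rho>\<close>-plane \<open>\<bar>\<Delta>\<bar>\<close> is bounded below by its leading
term, so \<open>Q\<close> is a polynomial. Along the imaginary axis \<open>F\<close> is the integral of \<open>(qt - q) \<phi> \<phi>t\<close>
up to exponentially smaller terms; since \<open>qt - q = o((b - x)\<^sup>m)\<close>, it is
\<open>o(exp (2 \<tau> b) / \<tau>^(m+1))\<close>, so \<open>Q\<close> tends to \<open>0\<close> there and \<open>F = 0\<close>.

Now \<open>\<phi>'/\<phi>\<close> and \<open>\<phi>t'/\<phi>t\<close> agree at \<open>b\<close>, and a Borg--Marchenko argument gives \<open>q = qt\<close> on \<open>[d, b]\<close>.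
The vanishing Wronskian is carried to \<open>d\<close>, where its asymptotics yield \<open>\<beta> = \<beta>t\<close> and then
\<open>\<gamma> = \<gamma>t\<close>; a second application of the Borg--Marchenko argument settles \<open>[0, d]\<close> and \<open>h = ht\<close>.
\<close>

text \<open>The number of exceptional eigenvalues is dictated by counting powers of \<rho>. On the
  imaginary axis \<open>P\<close> grows like \<open>\<tau> ^ (2 * k)\<close> for \<open>k\<close>
  exceptional eigenvalues, and \<Delta> like \<open>\<tau> ^ j * exp (\<tau> * \<pi>)\<close> with
  \<open>j = 1\<close> for the Robin and \<open>j = 0\<close> for the Dirichlet condition at \<pi>;
  so \<open>Q\<close> tends to 0 as soon as \<open>2 * k \<le> m + 1 + j\<close>. The midpoint
  matters because \<open>2 * b = \<pi>\<close> gives \<open>F\<close> and \<Delta> the same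
  exponential growth, while \<open>d < b\<close> makes the Wronskian at \<open>d\<close>
  exponentially smaller. The obstacle is to divide by \<Delta> without locating its zeros. Squares
  serve better than circles: on the vertical sides \<open>Re \<rho>\<close> can be chosen so that
  the \<open>cos\<close> or \<open>sin\<close> in the leading term has the largest modulus possible
  for the given imaginary part, and on the horizontal sides \<open>\<bar>Im \<rho>\<bar>\<close> is
  large. The jump adds a reflected wave to the leading term; as \<beta> is positive, its amplitude
  is strictly below that of the transmitted wave and it cannot spoil the estimate.\<close>

section \<open>Absolutely continuous functions\<close>

lemma absolutely_integrable_continuous_mult:
  fixes f g :: "real \<Rightarrow> complex"
  assumes "continuous_on {a..b} f" "g absolutely_integrable_on {a..b}"
  shows "(\<lambda>x. f x * g x) absolutely_integrable_on {a..b}"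
proof (rule absolutely_integrable_bounded_measurable_product[where h="(*)"])
  show "bilinear ((*) :: complex \<Rightarrow> _)" by (simp add: bilinear_times)
  show "f \<in> borel_measurable (lebesgue_on {a..b})"
    using assms(1) by (intro continuous_imp_measurable_on_sets_lebesgue) auto
  show "bounded (f ` {a..b})"
    using assms(1) compact_continuous_image compact_imp_bounded by blast
qed (use assms in auto)

lemma norm_integral_le:
  fixes f :: "real \<Rightarrow> complex"
  assumes "f absolutely_integrable_on S" "g integrable_on S" "\<And>x. x \<in> S \<Longrightarrow> norm (f x) \<le> g x"
  shows "norm (integral S f) \<le> integral S g"
  using assms by (intro integral_norm_bound_integral) (auto simp: set_lebesgue_integral_eq_integral(1))

lemma absolutely_integrable_norm_on:
  fixes f :: "real \<Rightarrow> complex"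
  assumes "f absolutely_integrable_on S"
  shows "(\<lambda>x. norm (f x)) integrable_on S"
  using assms by (simp add: absolutely_integrable_on_def)

text \<open>A substitute for differentiating almost everywhere: increments that are small compared with
  those of an indefinite integral force a function to be constant.\<close>

lemma eq_if_locally_small_increments:
  fixes F :: "real \<Rightarrow> 'a::real_normed_vector" and w :: "real \<Rightarrow> real"
  assumes "a \<le> b" and w: "w integrable_on {a..b}"
    and small: "\<And>e. e > 0 \<Longrightarrow> \<exists>\<delta>>0. \<forall>s t. a \<le> s \<and> s \<le> t \<and> t \<le> b \<and> t - s < \<delta> \<longrightarrow>
                  norm (F t - F s) \<le> e * integral {s..t} w"
  shows "F b = F a"
proof (cases "a = b")
  case False
  with assms have ab: "a < b" by simp
  have le: "norm (F b - F a) \<le> e * integral {a..b} w" if e0: "e > 0" for e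
  proof -
    obtain \<delta> where \<delta>: "\<delta> > 0" and
      sm: "\<And>s t. a \<le> s \<Longrightarrow> s \<le> t \<Longrightarrow> t \<le> b \<Longrightarrow> t - s < \<delta> \<Longrightarrow> norm (F t - F s) \<le> e * integral {s..t} w"
      using small[OF e0] by blast
    obtain n :: nat where n: "(b - a) / \<delta> < n" using reals_Archimedean2 by blast
    then have n0: "n > 0" using \<delta> ab by (metis divide_pos_pos diff_gt_0_iff_gt less_trans of_nat_0_less_iff)
    define p where "p i = a + real i * ((b - a) / n)" for i
    have p0: "p 0 = a" and pn: "p n = b" using n0 by (auto simp: p_def)
    have pm: "p i \<le> p (Suc i)" for i using ab n0 by (simp add: p_def algebra_simps divide_simps)
    have pa: "a \<le> p i" for i using ab by (simp add: p_def)
    have pb: "p i \<le> b" if "i \<le> n" for i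
      using mult_right_mono[of "real i" n "(b-a)/n"] that ab n0 by (simp add: p_def)
    have pd: "p (Suc i) - p i < \<delta>" for i
    proof -
      have "p (Suc i) - p i = (b - a) / n" by (simp add: p_def distrib_right del: times_divide_eq_right)
      also have "\<dots> < \<delta>" using n \<delta> n0 by (simp add: pos_divide_less_eq mult.commute)
      finally show ?thesis .
    qed
    have "i \<le> n \<Longrightarrow> norm (F (p i) - F a) \<le> e * integral {a..p i} w" for i
    proof (induction i)
      case (Suc i)
      have "norm (F (p (Suc i)) - F a) \<le> norm (F (p (Suc i)) - F (p i)) + norm (F (p i) - F a)"
        using norm_triangle_ineq[of "F (p (Suc i)) - F (p i)" "F (p i) - F a"] by simp
      also have "\<dots> \<le> e * integral {p i..p (Suc i)} w + e * integral {a..p i} w"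
        using sm[OF pa pm pb pd] Suc by (intro add_mono) auto
      also have "\<dots> = e * integral {a..p (Suc i)} w"
      proof -
        have "w integrable_on {a..p (Suc i)}"
          using Suc.prems pb by (intro integrable_subinterval_real[OF w]) auto
        from Henstock_Kurzweil_Integration.integral_combine[OF pa pm this]
        show ?thesis by (simp add: algebra_simps flip: distrib_left)
      qed
      finally show ?case .
    qed (simp add: p0)
    from this[of n] show ?thesis by (simp add: pn)
  qed
  have "norm (F b - F a) \<le> 0"
  proof (rule field_le_epsilon)
    fix e :: real assume "e > 0"
    \<comment> \<open>The integral of \<open>w\<close> may be zero or negative, so its absolute
      value plus 1 serves as divisor.\<close>
    define I where "I = \<bar>integral {a..b} w\<bar> + 1"
    have I: "I > 0" by (simp add: I_def)
    have "norm (F b - F a) \<le> e / I * integral {a..b} w" using \<open>e > 0\<close> I by (intro le) simp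
    also have "\<dots> \<le> e / I * I" using \<open>e > 0\<close> I by (intro mult_left_mono) (auto simp: I_def)
    finally show "norm (F b - F a) \<le> 0 + e" using I by simp
  qed
  then show ?thesis by simp
qed simp

lemma has_ac_derivative_onD:
  assumes "has_ac_derivative_on f g {a..b}" "a \<le> s" "s \<le> t" "t \<le> b"
  shows "f t - f s = integral {s..t} g"
  using assms by (auto simp: has_ac_derivative_on_def)

lemma has_ac_derivative_on_eq_integral:
  assumes "has_ac_derivative_on f g {a..b}" "x \<in> {a..b}"
  shows "f x = f a + integral {a..x} g"
  using has_ac_derivative_onD[OF assms(1), of a x] assms(2) by (auto simp: algebra_simps)

lemma has_ac_derivative_on_imp_abs_int:
  "has_ac_derivative_on f g S \<Longrightarrow> g absolutely_integrable_on S"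
  by (simp add: has_ac_derivative_on_def)

lemma has_ac_derivative_onI:
  assumes g: "g absolutely_integrable_on {a..b}"
    and eq: "\<And>x. x \<in> {a..b} \<Longrightarrow> f x = c + integral {a..x} g"
  shows "has_ac_derivative_on f g {a..b}"
  unfolding has_ac_derivative_on_def
proof (intro conjI ballI impI g)
  fix s t assume st: "s \<in> {a..b}" "t \<in> {a..b}" "s \<le> t"
  have "integral {a..s} g + integral {s..t} g = integral {a..t} g"
    using st by (intro Henstock_Kurzweil_Integration.integral_combine set_lebesgue_integral_eq_integral(1)
        absolutely_integrable_on_subinterval[OF g]) auto
  then show "f t - f s = integral {s..t} g" using st by (simp add: eq algebra_simps)
qed

lemma has_ac_derivative_on_imp_continuous:
  assumes "has_ac_derivative_on f g {a..b}"
  shows "continuous_on {a..b} f"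
proof -
  have "continuous_on {a..b} (\<lambda>x. f a + integral {a..x} g)"
    using has_ac_derivative_on_imp_abs_int[OF assms]
    by (intro continuous_intros indefinite_integral_continuous_1 set_lebesgue_integral_eq_integral(1))
  then show ?thesis
    by (rule continuous_on_eq) (metis has_ac_derivative_on_eq_integral[OF assms])
qed

lemma has_ac_derivative_on_subset:
  assumes "has_ac_derivative_on f g {a..b}" "{s..t} \<subseteq> {a..b}"
  shows "has_ac_derivative_on f g {s..t}"
  using assms(2) has_ac_derivative_onD[OF assms(1)]
  by (auto simp: has_ac_derivative_on_def
      intro!: absolutely_integrable_on_subinterval[OF has_ac_derivative_on_imp_abs_int[OF assms(1)]])

lemma has_ac_derivative_on_spike:
  assumes "has_ac_derivative_on f g {a..b}" "AE x in lebesgue. x \<in> {a..b} \<longrightarrow> g x = g' x"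
  shows "has_ac_derivative_on f g' {a..b}"
proof -
  from assms(2) obtain N where N: "negligible N" "\<And>x. x \<notin> N \<Longrightarrow> x \<in> {a..b} \<Longrightarrow> g x = g' x"
    unfolding eventually_ae_filter_negligible by blast
  show ?thesis unfolding has_ac_derivative_on_def
  proof (intro conjI ballI impI)
    show "g' absolutely_integrable_on {a..b}"
      using N by (intro absolutely_integrable_spike[OF has_ac_derivative_on_imp_abs_int[OF assms(1)], of N]) auto
    fix s t assume st: "s \<in> {a..b}" "t \<in> {a..b}" "s \<le> t"
    have "integral {s..t} g = integral {s..t} g'"
      using N st by (intro integral_spike[of N]) auto
    then show "f t - f s = integral {s..t} g'"
      using st assms(1) by (simp add: has_ac_derivative_on_def)
  qed
qed

lemma has_ac_derivative_on_cong:
  assumes "has_ac_derivative_on f g {a..b}"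
    "\<And>x. x \<in> {a..b} \<Longrightarrow> f x = f' x" "\<And>x. x \<in> {a..b} \<Longrightarrow> g x = g' x"
  shows "has_ac_derivative_on f' g' {a..b}"
proof -
  have "has_ac_derivative_on f g' {a..b}"
    using assms by (intro has_ac_derivative_on_spike[OF assms(1)]) auto
  then show ?thesis using assms(2) by (simp add: has_ac_derivative_on_def)
qed

lemma has_ac_derivative_on_const: "has_ac_derivative_on (\<lambda>x. c) (\<lambda>x. 0) {a..b}"
  by (simp add: has_ac_derivative_on_def)

lemma has_ac_derivative_on_add:
  assumes "has_ac_derivative_on f f' {a..b}" "has_ac_derivative_on g g' {a..b}"
  shows "has_ac_derivative_on (\<lambda>x. f x + g x) (\<lambda>x. f' x + g' x) {a..b}"
proof (rule has_ac_derivative_onI[where c="f a + g a"])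
  note i = has_ac_derivative_on_imp_abs_int[OF assms(1)] has_ac_derivative_on_imp_abs_int[OF assms(2)]
  show "(\<lambda>x. f' x + g' x) absolutely_integrable_on {a..b}" using i by (rule set_integral_add)
  fix x assume x: "x \<in> {a..b}"
  have "integral {a..x} (\<lambda>x. f' x + g' x) = integral {a..x} f' + integral {a..x} g'"
    using x by (intro Henstock_Kurzweil_Integration.integral_add set_lebesgue_integral_eq_integral(1)
        absolutely_integrable_on_subinterval[OF i(1)] absolutely_integrable_on_subinterval[OF i(2)]) auto
  then show "f x + g x = f a + g a + integral {a..x} (\<lambda>x. f' x + g' x)"
    using has_ac_derivative_on_eq_integral[OF assms(1) x] has_ac_derivative_on_eq_integral[OF assms(2) x] by simp
qed

text \<open>The product rule without differentiation almost everywhere: the defect \<open>F\<close>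
  of the identity has increments over \<open>{s..t}\<close> bounded by the oscillation of
  \<open>f\<close> and \<open>g\<close> there times the integral of \<open>w\<close>, and uniform
  continuity makes the oscillation small.\<close>

lemma has_ac_derivative_on_mult:
  assumes f: "has_ac_derivative_on f f' {a..b}" and g: "has_ac_derivative_on g g' {a..b}"
  shows "has_ac_derivative_on (\<lambda>x. f x * g x) (\<lambda>x. g x * f' x + f x * g' x) {a..b}"
    (is "has_ac_derivative_on _ ?D _")
proof -
  note if' = has_ac_derivative_on_imp_abs_int[OF f] and ig' = has_ac_derivative_on_imp_abs_int[OF g]
  note cf = has_ac_derivative_on_imp_continuous[OF f] and cg = has_ac_derivative_on_imp_continuous[OF g]
  have iD: "?D absolutely_integrable_on {a..b}"
    by (intro set_integral_add absolutely_integrable_continuous_mult cf cg if' ig')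
  define w where "w x = norm (f' x) + norm (g' x)" for x
  have iw: "w integrable_on {a..b}"
    unfolding w_def using if' ig' by (intro integrable_add absolutely_integrable_norm_on)
  define F where "F x = f x * g x - integral {a..x} ?D" for x
  \<comment> \<open>Freezing \<open>g\<close> at \<open>t\<close> and \<open>f\<close> at
    \<open>s\<close> turns the increment of the product into integrals of \<open>f'\<close> and
    \<open>g'\<close> with constant coefficients; the rest is controlled by the oscillation bound
    \<open>e\<close>.\<close>
  have incr: "norm (F t - F s) \<le> e * integral {s..t} w"
    if st: "a \<le> s" "s \<le> t" "t \<le> b"
      and ef: "\<And>x y. x \<in> {s..t} \<Longrightarrow> y \<in> {s..t} \<Longrightarrow> norm (f x - f y) \<le> e"
      and eg: "\<And>x y. x \<in> {s..t} \<Longrightarrow> y \<in> {s..t} \<Longrightarrow> norm (g x - g y) \<le> e" for s t e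
  proof -
    have sub: "{s..t} \<subseteq> {a..b}" using st by auto
    note i1 = absolutely_integrable_on_subinterval[OF if' sub]
    note i2 = absolutely_integrable_on_subinterval[OF ig' sub]
    note i3 = absolutely_integrable_on_subinterval[OF iD sub]
    have "integral {a..s} ?D + integral {s..t} ?D = integral {a..t} ?D"
      using st by (intro Henstock_Kurzweil_Integration.integral_combine set_lebesgue_integral_eq_integral(1)
          absolutely_integrable_on_subinterval[OF iD]) auto
    then have "F t - F s = (f t - f s) * g t + f s * (g t - g s) - integral {s..t} ?D"
      by (auto simp: F_def algebra_simps)
    also have "\<dots> = g t * integral {s..t} f' + f s * integral {s..t} g' - integral {s..t} ?D"
      using st by (simp add: has_ac_derivative_onD[OF f] has_ac_derivative_onD[OF g] mult.commute)
    also have "\<dots> = integral {s..t} (\<lambda>x. (g t * f' x + f s * g' x) - ?D x)"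
      by (subst Henstock_Kurzweil_Integration.integral_diff, (intro integrable_add integrable_on_mult_right set_lebesgue_integral_eq_integral(1) i1 i2 i3)+,
          subst Henstock_Kurzweil_Integration.integral_add, (intro integrable_on_mult_right set_lebesgue_integral_eq_integral(1) i1 i2)+) simp
    also have "norm \<dots> \<le> integral {s..t} (\<lambda>x. e * w x)"
    proof (rule norm_integral_le)
      show "(\<lambda>x. g t * f' x + f s * g' x - ?D x) absolutely_integrable_on {s..t}"
        by (intro set_integral_diff(1) i3 set_integral_add(1) absolutely_integrable_continuous_mult continuous_on_const i1 i2)
      show "(\<lambda>x. e * w x) integrable_on {s..t}"
        using integrable_subinterval_real[OF iw sub] by (rule integrable_on_mult_right)
      fix x assume x: "x \<in> {s..t}"
      have "norm (g t * f' x + f s * g' x - ?D x) = norm ((g t - g x) * f' x + (f s - f x) * g' x)"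
        by (simp add: algebra_simps)
      also have "\<dots> \<le> norm (g t - g x) * norm (f' x) + norm (f s - f x) * norm (g' x)"
        by (metis norm_mult norm_triangle_ineq)
      also have "\<dots> \<le> e * norm (f' x) + e * norm (g' x)"
        using x st by (intro add_mono mult_right_mono ef eg) auto
      finally show "norm (g t * f' x + f s * g' x - ?D x) \<le> e * w x" by (simp add: w_def algebra_simps)
    qed
    finally show ?thesis by simp
  qed
  have uc: "uniformly_continuous_on {a..b} f" "uniformly_continuous_on {a..b} g"
    using cf cg by (auto intro: compact_uniformly_continuous)
  have const: "F x = F a" if x: "x \<in> {a..b}" for x
  proof (rule eq_if_locally_small_increments[of a x w])
    show "w integrable_on {a..x}" using x by (intro integrable_subinterval_real[OF iw]) auto
    fix e :: real assume e: "e > 0"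
    obtain d1 where d1: "d1 > 0" "\<And>x y. x \<in> {a..b} \<Longrightarrow> y \<in> {a..b} \<Longrightarrow> dist y x < d1 \<Longrightarrow> dist (f y) (f x) < e"
      using uc(1) e unfolding uniformly_continuous_on_def by metis
    obtain d2 where d2: "d2 > 0" "\<And>x y. x \<in> {a..b} \<Longrightarrow> y \<in> {a..b} \<Longrightarrow> dist y x < d2 \<Longrightarrow> dist (g y) (g x) < e"
      using uc(2) e unfolding uniformly_continuous_on_def by metis
    show "\<exists>\<delta>>0. \<forall>s t. a \<le> s \<and> s \<le> t \<and> t \<le> x \<and> t - s < \<delta> \<longrightarrow> norm (F t - F s) \<le> e * integral {s..t} w"
    proof (intro exI[of _ "min d1 d2"] conjI allI impI)
      fix s t assume st: "a \<le> s \<and> s \<le> t \<and> t \<le> x \<and> t - s < min d1 d2"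
      show "norm (F t - F s) \<le> e * integral {s..t} w"
      proof (rule incr)
        fix u v assume "u \<in> {s..t}" "v \<in> {s..t}"
        then have *: "u \<in> {a..b}" "v \<in> {a..b}" "dist u v < d1" "dist u v < d2"
          using st x by (auto simp: dist_real_def)
        show "norm (f u - f v) \<le> e" using d1(2)[OF *(2,1,3)] by (simp add: dist_norm)
        show "norm (g u - g v) \<le> e" using d2(2)[OF *(2,1,4)] by (simp add: dist_norm)
      qed (use st x in auto)
    qed (use d1 d2 in auto)
  qed (use x in auto)
  show ?thesis
  proof (rule has_ac_derivative_onI[OF iD])
    fix x assume "x \<in> {a..b}"
    from const[OF this] show "f x * g x = f a * g a + integral {a..x} ?D" by (simp add: F_def algebra_simps)
  qed
qed

lemma has_ac_derivative_on_cmult: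
  assumes "has_ac_derivative_on f f' {a..b}"
  shows "has_ac_derivative_on (\<lambda>x. c * f x) (\<lambda>x. c * f' x) {a..b}"
  using has_ac_derivative_on_mult[OF has_ac_derivative_on_const assms] by simp

lemma has_ac_derivative_on_diff:
  assumes "has_ac_derivative_on f f' {a..b}" "has_ac_derivative_on g g' {a..b}"
  shows "has_ac_derivative_on (\<lambda>x. f x - g x) (\<lambda>x. f' x - g' x) {a..b}"
  using has_ac_derivative_on_add[OF assms(1) has_ac_derivative_on_cmult[OF assms(2), of "-1"]] by simp

lemma has_ac_derivative_on_vector_derivative:
  fixes f :: "real \<Rightarrow> complex"
  assumes "\<And>x. x \<in> {a..b} \<Longrightarrow> (f has_vector_derivative f' x) (at x within {a..b})" "continuous_on {a..b} f'"
  shows "has_ac_derivative_on f f' {a..b}"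
proof (rule has_ac_derivative_onI)
  show "f' absolutely_integrable_on {a..b}" using assms(2) by (rule absolutely_integrable_continuous_real)
  fix x assume "x \<in> {a..b}"
  then have "(f' has_integral f x - f a) {a..x}"
    by (intro fundamental_theorem_of_calculus)
      (auto intro: has_vector_derivative_within_subset[OF assms(1)])
  then show "f x = f a + integral {a..x} f'" by (simp add: integral_unique)
qed

lemma has_ac_derivative_on_reflect:
  assumes "has_ac_derivative_on f g {a..b}"
  shows "has_ac_derivative_on (\<lambda>x. f (- x)) (\<lambda>x. - g (- x)) {-b..-a}"
  unfolding has_ac_derivative_on_def
proof (intro conjI ballI impI)
  have "g absolutely_integrable_on {a..b}" by (rule has_ac_derivative_on_imp_abs_int[OF assms])
  then have "(\<lambda>x. g (- x)) absolutely_integrable_on {-b..-a}" by simp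
  then have "(\<lambda>x. - 1 * g (- x)) absolutely_integrable_on {-b..-a}"
    by (rule set_integrable_mult_right)
  then show "(\<lambda>x. - g (- x)) absolutely_integrable_on {-b..-a}" by simp
  fix s t assume st: "s \<in> {-b..-a}" "t \<in> {-b..-a}" "s \<le> t"
  have "integral {s..t} (\<lambda>x. g (- x)) = integral {-t..-s} g"
    using Henstock_Kurzweil_Integration.integral_reflect_real[of "-s" "-t" g] by simp
  then show "f (- t) - f (- s) = integral {s..t} (\<lambda>x. - g (- x))"
    using has_ac_derivative_onD[OF assms, of "-t" "-s"] st by (simp add: algebra_simps)
qed

text \<open>On a short interval \<open>g\<close> may be replaced by its value at the left end point,
  which contributes nothing because \<open>f\<close> has integral zero. The error has the form
  required by \<open>eq_if_locally_small_increments\<close>, with weight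
  \<open>norm (f x)\<close>.\<close>

lemma integral_continuous_mult_eq_0:
  fixes f g :: "real \<Rightarrow> complex"
  assumes ab: "a \<le> b" and f: "f absolutely_integrable_on {a..b}"
    and zero: "\<And>s t. a \<le> s \<Longrightarrow> s \<le> t \<Longrightarrow> t \<le> b \<Longrightarrow> integral {s..t} f = 0"
    and g: "continuous_on {a..b} g"
  shows "integral {a..b} (\<lambda>x. g x * f x) = 0"
proof -
  define F where "F x = integral {a..x} (\<lambda>x. g x * f x)" for x
  have gf: "(\<lambda>x. g x * f x) absolutely_integrable_on {a..b}"
    by (rule absolutely_integrable_continuous_mult[OF g f])
  have "F b = F a"
  proof (rule eq_if_locally_small_increments[OF ab absolutely_integrable_norm_on[OF f]])
    fix e :: real assume e: "e > 0"
    have "uniformly_continuous_on {a..b} g" using g by (auto intro: compact_uniformly_continuous)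
    then obtain \<delta> where \<delta>: "\<delta> > 0" "\<And>x y. x \<in> {a..b} \<Longrightarrow> y \<in> {a..b} \<Longrightarrow> dist y x < \<delta> \<Longrightarrow> dist (g y) (g x) < e"
      using e unfolding uniformly_continuous_on_def by metis
    have "norm (F t - F s) \<le> e * integral {s..t} (\<lambda>x. norm (f x))"
      if st: "a \<le> s" "s \<le> t" "t \<le> b" "t - s < \<delta>" for s t
    proof -
      have sub: "{s..t} \<subseteq> {a..b}" using st by auto
      note i1 = absolutely_integrable_on_subinterval[OF f sub] absolutely_integrable_on_subinterval[OF gf sub]
      have "integral {a..s} (\<lambda>x. g x * f x) + integral {s..t} (\<lambda>x. g x * f x) = integral {a..t} (\<lambda>x. g x * f x)"
        using st by (intro Henstock_Kurzweil_Integration.integral_combine set_lebesgue_integral_eq_integral(1)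
            absolutely_integrable_on_subinterval[OF gf]) auto
      then have "F t - F s = integral {s..t} (\<lambda>x. g x * f x) - g s * integral {s..t} f"
        using zero[of s t] st by (simp add: F_def flip: \<open>_ + _ = integral {a..t} _\<close>)
      also have "\<dots> = integral {s..t} (\<lambda>x. g x * f x - g s * f x)"
        by (subst Henstock_Kurzweil_Integration.integral_diff)
          (intro integrable_on_mult_right set_lebesgue_integral_eq_integral(1) i1 | simp)+
      also have "norm \<dots> \<le> integral {s..t} (\<lambda>x. e * norm (f x))"
      proof (rule norm_integral_le)
        show "(\<lambda>x. g x * f x - g s * f x) absolutely_integrable_on {s..t}"
          by (intro set_integral_diff(1) i1 absolutely_integrable_continuous_mult continuous_on_const)
        show "(\<lambda>x. e * norm (f x)) integrable_on {s..t}"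
          by (intro integrable_on_mult_right absolutely_integrable_norm_on i1)
        fix x assume x: "x \<in> {s..t}"
        have "norm (g x - g s) \<le> e"
          using \<delta>(2)[of s x] st x by (auto simp: dist_norm)
        then show "norm (g x * f x - g s * f x) \<le> e * norm (f x)"
          by (simp add: mult_right_mono norm_mult flip: left_diff_distrib)
      qed
      finally show ?thesis by simp
    qed
    then show "\<exists>\<delta>>0. \<forall>s t. a \<le> s \<and> s \<le> t \<and> t \<le> b \<and> t - s < \<delta> \<longrightarrow>
        norm (F t - F s) \<le> e * integral {s..t} (\<lambda>x. norm (f x))"
      using \<delta>(1) by blast
  qed
  then show ?thesis by (simp add: F_def)
qed

text \<open>Testing against continuous approximations of \<open>cnj f / (1 + \<bar>f\<bar>)\<close>.\<close>

lemma AE_eq_0_if_integrals_eq_0: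
  fixes f :: "real \<Rightarrow> complex"
  assumes ab: "a \<le> b" and f: "f absolutely_integrable_on {a..b}"
    and zero: "\<And>s t. a \<le> s \<Longrightarrow> s \<le> t \<Longrightarrow> t \<le> b \<Longrightarrow> integral {s..t} f = 0"
  shows "AE x in lebesgue. x \<in> {a..b} \<longrightarrow> f x = 0"
proof -
  let ?M = "lebesgue_on {a..b}"
  have fm: "f \<in> borel_measurable ?M" "integrable ?M f"
    using f by (auto simp: absolutely_integrable_measurable absolutely_integrable_imp_integrable)
  then have "f measurable_on {a..b}" by (simp add: measurable_on_iff_borel_measurable)
  then obtain N F where N: "negligible N" and cF: "\<And>n::nat. continuous_on UNIV (F n)"
    and lim: "\<And>x. x \<notin> N \<Longrightarrow> (\<lambda>n. F n x) \<longlonglongrightarrow> (if x \<in> {a..b} then f x else 0)"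
    unfolding measurable_on_def by blast
  \<comment> \<open>The denominator keeps \<open>w\<close> bounded by 1, so
    \<open>norm (f x)\<close> dominates the products; \<open>w z * z\<close> is real, nonnegative
    and zero only at \<open>z = 0\<close>.\<close>
  define w where "w z = cnj z / of_real (1 + norm z)" for z :: complex
  have w1: "norm (w z) \<le> 1" for z
    by (simp add: w_def norm_divide divide_simps) (smt (verit) norm_ge_zero norm_of_real norm_one of_real_1 of_real_add)
  have cw: "continuous_on UNIV w"
    unfolding w_def by (intro continuous_intros) (metis add_pos_nonneg norm_ge_zero of_real_eq_0_iff less_irrefl zero_less_one)
  have cwF: "continuous_on S (\<lambda>x. w (F n x))" for n S
    by (rule continuous_on_subset[OF continuous_on_compose2[OF cw cF]]) auto
  have z: "integral\<^sup>L ?M (\<lambda>x. w (F n x) * f x) = 0" for n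
  proof -
    have "integrable ?M (\<lambda>x. w (F n x) * f x)"
      by (intro absolutely_integrable_imp_integrable absolutely_integrable_continuous_mult cwF f) auto
    then have "integral\<^sup>L ?M (\<lambda>x. w (F n x) * f x) = integral {a..b} (\<lambda>x. w (F n x) * f x)"
      by (simp add: lebesgue_integral_eq_integral)
    then show ?thesis using integral_continuous_mult_eq_0[OF ab f zero cwF] by simp
  qed
  have mF: "(\<lambda>x. w (F n x)) \<in> borel_measurable ?M" for n
    by (intro continuous_imp_measurable_on_sets_lebesgue cwF) auto
  have mw: "w \<in> borel_measurable borel" using cw by (simp add: borel_measurable_continuous_onI)
  have "(\<lambda>n. integral\<^sup>L ?M (\<lambda>x. w (F n x) * f x)) \<longlonglongrightarrow> integral\<^sup>L ?M (\<lambda>x. w (f x) * f x)"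
  proof (rule integral_dominated_convergence[where w="\<lambda>x. norm (f x)"])
    show "integrable ?M (\<lambda>x. norm (f x))" using fm by simp
    show "(\<lambda>x. w (f x) * f x) \<in> borel_measurable ?M"
      using measurable_compose[OF fm(1) mw] fm(1) by (intro borel_measurable_times)
    show "(\<lambda>x. w (F n x) * f x) \<in> borel_measurable ?M" for n using mF fm by (intro borel_measurable_times)
    show "AE x in ?M. norm (w (F n x) * f x) \<le> norm (f x)" for n
      using w1 by (auto simp: norm_mult mult_left_le_one_le)
    have "AE x in lebesgue. x \<notin> N" using N unfolding eventually_ae_filter_negligible by blast
    then show "AE x in ?M. (\<lambda>n. w (F n x) * f x) \<longlonglongrightarrow> w (f x) * f x"
    proof (subst AE_restrict_space_iff, goal_cases)
      case 2 then show ?case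
      proof eventually_elim
        case (elim x)
        have "isCont w (f x)" using cw by (simp add: continuous_on_eq_continuous_at)
        with lim[OF elim] show ?case by (auto intro!: tendsto_intros isCont_tendsto_compose[of _ w])
      qed
    qed simp
  qed
  then have "integral\<^sup>L ?M (\<lambda>x. w (f x) * f x) = 0" using z by (simp add: LIMSEQ_const_iff)
  moreover have eq: "w (f x) * f x = complex_of_real ((norm (f x))\<^sup>2 / (1 + norm (f x)))" for x
    by (simp add: w_def complex_norm_square mult.commute del: of_real_add of_real_power)
  ultimately have i0: "integral\<^sup>L ?M (\<lambda>x. (norm (f x))\<^sup>2 / (1 + norm (f x))) = 0"
    by (simp add: integral_complex_of_real del: of_real_divide of_real_add of_real_power)
  have "integrable ?M (\<lambda>x. (norm (f x))\<^sup>2 / (1 + norm (f x)))"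
  proof (rule Bochner_Integration.integrable_bound)
    show "integrable ?M (\<lambda>x. norm (f x))" using fm by simp
    show "(\<lambda>x. (norm (f x))\<^sup>2 / (1 + norm (f x))) \<in> borel_measurable ?M" using fm by measurable
    show "AE x in ?M. norm ((norm (f x))\<^sup>2 / (1 + norm (f x))) \<le> norm (norm (f x))"
    proof (rule AE_I2)
      fix x
      have "0 < 1 + norm (f x)" by (simp add: add_pos_nonneg)
      then show "norm ((norm (f x))\<^sup>2 / (1 + norm (f x))) \<le> norm (norm (f x))"
        by (simp add: pos_divide_le_eq power2_eq_square algebra_simps)
    qed
  qed
  from integral_nonneg_eq_0_iff_AE[OF this] i0
  have "AE x in ?M. (norm (f x))\<^sup>2 / (1 + norm (f x)) = 0" by simp
  then have "AE x in ?M. f x = 0"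
  proof (rule AE_mp, intro AE_I2 impI)
    fix x assume "(norm (f x))\<^sup>2 / (1 + norm (f x)) = 0"
    moreover have "1 + norm (f x) \<noteq> 0" by (smt (verit) norm_ge_zero)
    ultimately show "f x = 0" by simp
  qed
  then show ?thesis by (subst (asm) AE_restrict_space_iff) auto
qed

section \<open>Solutions of the differential equation\<close>

text \<open>The potential \<open>Q\<close> contains the spectral parameter, i.e. \<open>Q = q - \<mu>\<close>, and \<open>p\<close> is \<open>y'\<close>.\<close>

definition sol :: "(real \<Rightarrow> complex) \<Rightarrow> real \<Rightarrow> real \<Rightarrow> (real \<Rightarrow> complex) \<Rightarrow> (real \<Rightarrow> complex) \<Rightarrow> bool" where
  "sol Q a c y p \<longleftrightarrow>
     has_ac_derivative_on y p {a..c} \<and> has_ac_derivative_on p (\<lambda>x. Q x * y x) {a..c}"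

lemma solD:
  assumes "sol Q a c y p"
  shows "has_ac_derivative_on y p {a..c}" "has_ac_derivative_on p (\<lambda>x. Q x * y x) {a..c}"
  using assms by (auto simp: sol_def)

lemma sol_continuous:
  assumes "sol Q a c y p"
  shows "continuous_on {a..c} y" "continuous_on {a..c} p"
  using solD[OF assms] by (auto intro: has_ac_derivative_on_imp_continuous)

lemma sol_subset:
  "sol Q a c y p \<Longrightarrow> {s..t} \<subseteq> {a..c} \<Longrightarrow> sol Q s t y p"
  unfolding sol_def by (blast intro: has_ac_derivative_on_subset)

text \<open>These are the terms of the Neumann series, not the Picard iterates: the solution and its
  derivative are the sums over \<open>n\<close>.\<close>

fun picard :: "(real \<Rightarrow> complex) \<Rightarrow> real \<Rightarrow> complex \<Rightarrow> complex \<Rightarrow> nat \<Rightarrow> (real \<Rightarrow> complex) \<times> (real \<Rightarrow> complex)" where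
  "picard Q a y0 p0 0 = (\<lambda>x. y0, \<lambda>x. p0)"
| "picard Q a y0 p0 (Suc n) =
     (\<lambda>x. integral {a..x} (snd (picard Q a y0 p0 n)),
      \<lambda>x. integral {a..x} (\<lambda>t. Q t * fst (picard Q a y0 p0 n) t))"

text \<open>\<open>V\<close> need not be differentiable everywhere, so its powers are handled by
  induction with the product rule for absolutely continuous functions.\<close>

lemma integral_power_antiderivative:
  fixes v :: "real \<Rightarrow> real"
  assumes v: "v absolutely_integrable_on {a..c}" and x: "x \<in> {a..c}"
  defines "V \<equiv> \<lambda>x. integral {a..x} v"
  shows "((\<lambda>t. V t ^ n * v t) has_integral V x ^ Suc n / Suc n) {a..x}"
proof -
  \<comment> \<open>The calculus of \<open>has_ac_derivative_on\<close> is for complex values; the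
    real part is taken at the end.\<close>
  define W where "W t = complex_of_real (V t)" for t
  have vi: "(\<lambda>t. complex_of_real (v t)) absolutely_integrable_on {a..c}"
    using v by (auto simp: absolutely_integrable_on_def integrable_on_def dest: has_integral_of_real[where 'b=complex])
  have W: "has_ac_derivative_on W (\<lambda>t. complex_of_real (v t)) {a..c}"
    by (rule has_ac_derivative_onI[where c=0, OF vi])
      (auto simp: W_def V_def intro!: integral_unique[symmetric] has_integral_of_real integrable_integral
        set_lebesgue_integral_eq_integral(1) absolutely_integrable_on_subinterval[OF v])
  have "has_ac_derivative_on (\<lambda>t. W t ^ Suc n) (\<lambda>t. Suc n * W t ^ n * v t) {a..c}" for n
  proof (induction n)
    case (Suc n)
    show ?case using has_ac_derivative_on_mult[OF W Suc.IH]
      by (rule has_ac_derivative_on_cong) (auto simp: algebra_simps)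
  qed (use W in simp)
  then have "has_ac_derivative_on (\<lambda>t. (1 / Suc n) * W t ^ Suc n) (\<lambda>t. (1 / Suc n) * (Suc n * W t ^ n * v t)) {a..c}"
    by (rule has_ac_derivative_on_cmult)
  then have ac: "has_ac_derivative_on (\<lambda>t. (1 / Suc n) * W t ^ Suc n) (\<lambda>t. complex_of_real (V t ^ n * v t)) {a..c}"
    by (rule has_ac_derivative_on_cong) (auto simp: W_def simp del: of_nat_Suc)
  have "(\<lambda>t. complex_of_real (V t ^ n * v t)) absolutely_integrable_on {a..x}"
    using x by (intro absolutely_integrable_on_subinterval[OF has_ac_derivative_on_imp_abs_int[OF ac]]) auto
  then have "(\<lambda>t. complex_of_real (V t ^ n * v t)) integrable_on {a..x}"
    by (rule set_lebesgue_integral_eq_integral(1))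
  then have "((\<lambda>t. complex_of_real (V t ^ n * v t)) has_integral complex_of_real (V x ^ Suc n / Suc n)) {a..x}"
    using has_ac_derivative_onD[OF ac, of a x] x
    by (simp add: has_integral_iff W_def V_def)
  from has_integral_linear[OF this bounded_linear_Re] show ?thesis by (simp add: o_def)
qed

text \<open>The weight \<open>1 + norm (Q t)\<close> dominates both coefficients of the first-order
  system, 1 in \<open>y' = p\<close> and \<open>Q\<close> in \<open>p' = Q y\<close>, so one
  recursion bounds both components, and integrating \<open>V ^ n\<close> times the weight produces
  the next factorial.\<close>

lemma picard_continuous_bound:
  fixes Q :: "real \<Rightarrow> complex" and y0 p0 :: complex
  assumes Q: "Q absolutely_integrable_on {a..c}"
  defines "V \<equiv> \<lambda>x. integral {a..x} (\<lambda>t. 1 + norm (Q t))" and "K \<equiv> norm y0 + norm p0"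
  shows "continuous_on {a..c} (fst (picard Q a y0 p0 n)) \<and> continuous_on {a..c} (snd (picard Q a y0 p0 n)) \<and>
    (\<forall>x\<in>{a..c}. norm (fst (picard Q a y0 p0 n) x) \<le> K * V x ^ n / fact n \<and>
                norm (snd (picard Q a y0 p0 n) x) \<le> K * V x ^ n / fact n)"
proof (induction n)
  case (Suc n)
  define y where "y = fst (picard Q a y0 p0 n)"
  define p where "p = snd (picard Q a y0 p0 n)"
  have c: "continuous_on {a..c} y" "continuous_on {a..c} p" and
    b: "\<And>x. x \<in> {a..c} \<Longrightarrow> norm (y x) \<le> K * V x ^ n / fact n"
       "\<And>x. x \<in> {a..c} \<Longrightarrow> norm (p x) \<le> K * V x ^ n / fact n"
    using Suc.IH by (auto simp: y_def p_def)
  have v: "(\<lambda>t. 1 + norm (Q t)) absolutely_integrable_on {a..c}"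
    using Q by (intro set_integral_add(1) set_integrable_norm) auto
  have i1: "p absolutely_integrable_on {a..c}" using c by (intro absolutely_integrable_continuous_real)
  have i2: "(\<lambda>t. Q t * y t) absolutely_integrable_on {a..c}"
    using absolutely_integrable_continuous_mult[OF c(1) Q] by (simp add: mult.commute)
  have *: "norm (integral {a..x} f) \<le> K * V x ^ Suc n / fact (Suc n)"
    if x: "x \<in> {a..c}" and fi: "f absolutely_integrable_on {a..c}"
      and fb: "\<And>t. t \<in> {a..c} \<Longrightarrow> norm (f t) \<le> K * V t ^ n / fact n * (1 + norm (Q t))" for x and f :: "real \<Rightarrow> complex"
  proof -
    have hi: "((\<lambda>t. K / fact n * (V t ^ n * (1 + norm (Q t)))) has_integral K / fact n * (V x ^ Suc n / Suc n)) {a..x}"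
      unfolding V_def by (intro has_integral_mult_right integral_power_antiderivative[OF v x])
    have "norm (integral {a..x} f) \<le> integral {a..x} (\<lambda>t. K / fact n * (V t ^ n * (1 + norm (Q t))))"
    proof (rule norm_integral_le)
      show "f absolutely_integrable_on {a..x}" using x by (intro absolutely_integrable_on_subinterval[OF fi]) auto
      show "(\<lambda>t. K / fact n * (V t ^ n * (1 + norm (Q t)))) integrable_on {a..x}" using hi by blast
      fix t assume "t \<in> {a..x}"
      then show "norm (f t) \<le> K / fact n * (V t ^ n * (1 + norm (Q t)))"
        using fb[of t] x by (simp add: mult.assoc)
    qed
    also have "\<dots> = K / fact n * (V x ^ Suc n / Suc n)" using hi by (rule integral_unique)
    also have "\<dots> = K * V x ^ Suc n / fact (Suc n)" by (simp add: field_simps)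
    finally show ?thesis .
  qed
  have nn: "0 \<le> K * V t ^ n / fact n" if "t \<in> {a..c}" for t
    using b(1)[OF that] norm_ge_zero order_trans by blast
  have bp: "norm (p t) \<le> K * V t ^ n / fact n * (1 + norm (Q t))" if "t \<in> {a..c}" for t
    using b(2)[OF that] mult_left_mono[OF _ nn[OF that], of 1 "1 + norm (Q t)"] by simp
  have by': "norm (Q t * y t) \<le> K * V t ^ n / fact n * (1 + norm (Q t))" if "t \<in> {a..c}" for t
  proof -
    have "norm (Q t * y t) \<le> norm (Q t) * (K * V t ^ n / fact n)"
      unfolding norm_mult by (intro mult_left_mono b(1) that norm_ge_zero)
    also have "\<dots> \<le> (1 + norm (Q t)) * (K * V t ^ n / fact n)" by (intro mult_right_mono nn that) auto
    finally show ?thesis by (simp add: mult.commute)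
  qed
  show ?case
    using *[OF _ i1 bp] *[OF _ i2 by'] i1 i2
    by (auto simp flip: y_def p_def simp del: fact_Suc
        intro!: indefinite_integral_continuous_1 set_lebesgue_integral_eq_integral(1))
qed (auto simp: K_def)

text \<open>The filter is general because it is \<open>sequentially\<close> for the Neumann series
  and \<open>at \<mu>0\<close> for the dependence on the spectral parameter.\<close>

lemma integral_mult_uniform_limit:
  fixes Q :: "real \<Rightarrow> complex"
  assumes Q: "Q absolutely_integrable_on {a..c}" and x: "x \<in> {a..c}"
    and ul: "uniform_limit {a..c} f g F"
    and cf: "\<And>n. continuous_on {a..c} (f n)" and cg: "continuous_on {a..c} g"
  shows "((\<lambda>n. integral {a..x} (\<lambda>t. Q t * f n t)) \<longlongrightarrow> integral {a..x} (\<lambda>t. Q t * g t)) F"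
proof (rule tendstoI)
  fix e :: real assume e: "e > 0"
  have sub: "{a..x} \<subseteq> {a..c}" using x by auto
  note Qx = absolutely_integrable_on_subinterval[OF Q sub]
  note iN = absolutely_integrable_norm_on[OF Qx]
  define I where "I = integral {a..x} (\<lambda>t. norm (Q t))"
  have I: "I \<ge> 0" unfolding I_def by (intro Henstock_Kurzweil_Integration.integral_nonneg iN) auto
  have "eventually (\<lambda>n. \<forall>t\<in>{a..c}. dist (f n t) (g t) < e / (I + 1)) F"
    using ul e I by (intro uniform_limitD) auto
  then show "eventually (\<lambda>n. dist (integral {a..x} (\<lambda>t. Q t * f n t)) (integral {a..x} (\<lambda>t. Q t * g t)) < e) F"
  proof eventually_elim
    case (elim n)
    have i1: "(\<lambda>t. Q t * f n t) absolutely_integrable_on {a..x}" "(\<lambda>t. Q t * g t) absolutely_integrable_on {a..x}"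
      using absolutely_integrable_continuous_mult[OF continuous_on_subset[OF cf sub] Qx]
        absolutely_integrable_continuous_mult[OF continuous_on_subset[OF cg sub] Qx] by (simp_all add: mult.commute)
    have "dist (integral {a..x} (\<lambda>t. Q t * f n t)) (integral {a..x} (\<lambda>t. Q t * g t)) =
        norm (integral {a..x} (\<lambda>t. Q t * f n t - Q t * g t))"
      by (simp add: dist_norm Henstock_Kurzweil_Integration.integral_diff set_lebesgue_integral_eq_integral(1) i1)
    also have "\<dots> \<le> integral {a..x} (\<lambda>t. norm (Q t) * (e / (I + 1)))"
    proof (rule norm_integral_le)
      show "(\<lambda>t. Q t * f n t - Q t * g t) absolutely_integrable_on {a..x}" using i1 by (rule set_integral_diff(1))
      show "(\<lambda>t. norm (Q t) * (e / (I + 1))) integrable_on {a..x}" by (intro integrable_on_mult_left iN)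
      fix t assume "t \<in> {a..x}"
      then have "norm (f n t - g t) \<le> e / (I + 1)" using elim sub by (force simp: dist_norm)
      then show "norm (Q t * f n t - Q t * g t) \<le> norm (Q t) * (e / (I + 1))"
        by (metis norm_ge_zero mult_left_mono norm_mult right_diff_distrib)
    qed
    also have "\<dots> = I * (e / (I + 1))" by (simp add: I_def)
    also have "\<dots> < e" using e I by (simp add: field_simps)
    finally show ?case .
  qed
qed

text \<open>\<open>B\<close> is the sum of the exponential series that majorises the Neumann series.
  It accompanies the existence because uniqueness transfers it to every solution with the same data,
  see \<open>sol_bound\<close>.\<close>

lemma sol_exists_bounded:
  fixes Q :: "real \<Rightarrow> complex" and y0 p0 :: complex
  assumes Q: "Q absolutely_integrable_on {a..c}" and ac: "a \<le> c"
  defines "B \<equiv> (norm y0 + norm p0) * exp (integral {a..c} (\<lambda>t. 1 + norm (Q t)))"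
  obtains y p where "sol Q a c y p" "y a = y0" "p a = p0"
    "\<And>x. x \<in> {a..c} \<Longrightarrow> norm (y x) \<le> B" "\<And>x. x \<in> {a..c} \<Longrightarrow> norm (p x) \<le> B"
proof -
  define y where "y n = fst (picard Q a y0 p0 n)" for n
  define p where "p n = snd (picard Q a y0 p0 n)" for n
  define v where "v t = 1 + norm (Q t)" for t
  define V where "V = integral {a..c} v"
  define K where "K = norm y0 + norm p0"
  note pcb = picard_continuous_bound[OF Q, of y0 p0, folded y_def p_def v_def K_def]
  have vi: "v absolutely_integrable_on {a..c}"
    unfolding v_def using Q by (intro set_integral_add(1) set_integrable_norm) auto
  have vnn: "0 \<le> v t" for t by (simp add: v_def)
  have cy: "continuous_on {a..c} (y n)" and cp: "continuous_on {a..c} (p n)" for n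
    using pcb by auto
  have Vx: "0 \<le> integral {a..x} v \<and> integral {a..x} v \<le> V" if "x \<in> {a..c}" for x
    using that unfolding V_def
    by (auto intro!: integral_subset_le Henstock_Kurzweil_Integration.integral_nonneg
        integrable_subinterval_real[OF set_lebesgue_integral_eq_integral(1)[OF vi]] simp: vnn)
  have K: "K \<ge> 0" by (simp add: K_def)
  have pw: "K * integral {a..x} v ^ n / fact n \<le> K * (V ^ n / fact n)" if "x \<in> {a..c}" for x n
    using Vx[OF that] K by (auto intro!: divide_right_mono mult_left_mono power_mono)
  have by': "norm (y n x) \<le> K * (V ^ n / fact n)" and bp: "norm (p n x) \<le> K * (V ^ n / fact n)" if "x \<in> {a..c}" for n x
    using pcb[of n] that pw[OF that, of n] by (meson order_trans)+
  have se: "(\<lambda>n. K * (V ^ n / fact n)) sums (K * exp V)"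
    using sums_mult[OF exp_converges[of V]] by (simp add: divide_inverse mult.commute)
  define Y where "Y x = (\<Sum>n. y n x)" for x
  define P where "P x = (\<Sum>n. p n x)" for x
  have uY: "uniform_limit {a..c} (\<lambda>n x. \<Sum>i<n. y i x) Y sequentially"
    unfolding Y_def by (rule Weierstrass_m_test[OF by' sums_summable[OF se]])
  have uP: "uniform_limit {a..c} (\<lambda>n x. \<Sum>i<n. p i x) P sequentially"
    unfolding P_def by (rule Weierstrass_m_test[OF bp sums_summable[OF se]])
  have sumcy: "continuous_on {a..c} (\<lambda>x. \<Sum>i<n. y i x)" and sumcp: "continuous_on {a..c} (\<lambda>x. \<Sum>i<n. p i x)" for n
    by (intro continuous_intros cy cp)+
  have cY: "continuous_on {a..c} Y" by (rule uniform_limit_theorem[OF _ uY]) (auto simp: sumcy)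
  have cP: "continuous_on {a..c} P" by (rule uniform_limit_theorem[OF _ uP]) (auto simp: sumcp)
  have BK: "B = K * exp V" by (simp add: B_def K_def V_def v_def[abs_def])
  have one: "(\<lambda>t. 1::complex) absolutely_integrable_on {a..c}" by simp
  have ipi: "p i integrable_on {a..x}" "(\<lambda>t. Q t * y i t) integrable_on {a..x}" if "x \<in> {a..c}" for i x
  proof -
    have sub: "{a..x} \<subseteq> {a..c}" using that by auto
    show "p i integrable_on {a..x}" by (intro integrable_continuous_interval continuous_on_subset[OF cp sub])
    show "(\<lambda>t. Q t * y i t) integrable_on {a..x}"
      using set_lebesgue_integral_eq_integral(1)[OF absolutely_integrable_continuous_mult[OF continuous_on_subset[OF cy sub] absolutely_integrable_on_subinterval[OF Q sub]]]
      by (simp add: mult.commute)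
  qed
  \<comment> \<open>Shifting the index makes each partial sum the Picard image of the preceding one;
    uniform convergence then yields the integral equations for \<open>Y\<close> and
    \<open>P\<close>.\<close>
  have stepY: "(\<Sum>i<Suc n. y i x) = y0 + integral {a..x} (\<lambda>t. 1 * (\<Sum>i<n. p i t))" if x: "x \<in> {a..c}" for n x
  proof -
    have "(\<Sum>i<Suc n. y i x) = y 0 x + (\<Sum>i<n. y (Suc i) x)" by (rule sum.lessThan_Suc_shift)
    also have "\<dots> = y0 + (\<Sum>i<n. integral {a..x} (p i))" by (simp add: y_def p_def)
    also have "(\<Sum>i<n. integral {a..x} (p i)) = integral {a..x} (\<lambda>t. \<Sum>i<n. p i t)"
      by (rule Henstock_Kurzweil_Integration.integral_sum[symmetric]) (auto intro: ipi x)
    finally show ?thesis by simp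
  qed
  have stepP: "(\<Sum>i<Suc n. p i x) = p0 + integral {a..x} (\<lambda>t. Q t * (\<Sum>i<n. y i t))" if x: "x \<in> {a..c}" for n x
  proof -
    have "(\<Sum>i<Suc n. p i x) = p 0 x + (\<Sum>i<n. p (Suc i) x)" by (rule sum.lessThan_Suc_shift)
    also have "\<dots> = p0 + (\<Sum>i<n. integral {a..x} (\<lambda>t. Q t * y i t))" by (simp add: y_def p_def)
    also have "(\<Sum>i<n. integral {a..x} (\<lambda>t. Q t * y i t)) = integral {a..x} (\<lambda>t. \<Sum>i<n. Q t * y i t)"
      by (rule Henstock_Kurzweil_Integration.integral_sum[symmetric]) (auto intro: ipi x)
    finally show ?thesis by (simp add: sum_distrib_left)
  qed
  have Yeq: "Y x = y0 + integral {a..x} P" if x: "x \<in> {a..c}" for x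
  proof -
    have "(\<lambda>n. y0 + integral {a..x} (\<lambda>t. 1 * (\<Sum>i<n. p i t))) \<longlonglongrightarrow> y0 + integral {a..x} (\<lambda>t. 1 * P t)"
      by (intro tendsto_intros integral_mult_uniform_limit[OF one x uP sumcp cP])
    then have "(\<lambda>n. \<Sum>i<Suc n. y i x) \<longlonglongrightarrow> y0 + integral {a..x} P" using stepY[OF x] by simp
    moreover have "(\<lambda>n. \<Sum>i<Suc n. y i x) \<longlonglongrightarrow> Y x"
      using tendsto_uniform_limitI[OF uY x] by (rule LIMSEQ_Suc)
    ultimately show ?thesis using LIMSEQ_unique by blast
  qed
  have Peq: "P x = p0 + integral {a..x} (\<lambda>t. Q t * Y t)" if x: "x \<in> {a..c}" for x
  proof -
    have "(\<lambda>n. p0 + integral {a..x} (\<lambda>t. Q t * (\<Sum>i<n. y i t))) \<longlonglongrightarrow> p0 + integral {a..x} (\<lambda>t. Q t * Y t)"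
      by (intro tendsto_intros integral_mult_uniform_limit[OF Q x uY sumcy cY])
    then have "(\<lambda>n. \<Sum>i<Suc n. p i x) \<longlonglongrightarrow> p0 + integral {a..x} (\<lambda>t. Q t * Y t)" using stepP[OF x] by simp
    moreover have "(\<lambda>n. \<Sum>i<Suc n. p i x) \<longlonglongrightarrow> P x"
      using tendsto_uniform_limitI[OF uP x] by (rule LIMSEQ_Suc)
    ultimately show ?thesis using LIMSEQ_unique by blast
  qed
  show ?thesis
  proof
    have "has_ac_derivative_on Y P {a..c}"
    proof (rule has_ac_derivative_onI[OF _ Yeq])
      show "P absolutely_integrable_on {a..c}" using cP by (rule absolutely_integrable_continuous_real)
    qed
    moreover have "has_ac_derivative_on P (\<lambda>x. Q x * Y x) {a..c}"
    proof (rule has_ac_derivative_onI[OF _ Peq])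
      show "(\<lambda>x. Q x * Y x) absolutely_integrable_on {a..c}"
        using absolutely_integrable_continuous_mult[OF cY Q] by (simp add: mult.commute)
    qed
    ultimately show "sol Q a c Y P" by (simp add: sol_def)
    show "Y a = y0" "P a = p0" using Yeq[of a] Peq[of a] ac by auto
    show "norm (Y x) \<le> B" if "x \<in> {a..c}" for x
      using norm_suminf_le[OF by'[OF that] sums_summable[OF se]] sums_unique[OF se]
      by (simp add: Y_def BK)
    show "norm (P x) \<le> B" if "x \<in> {a..c}" for x
      using norm_suminf_le[OF bp[OF that] sums_summable[OF se]] sums_unique[OF se]
      by (simp add: P_def BK)
  qed
qed

text \<open>Lagrange's identity: the products of derivatives cancel and only the difference of the
  potentials survives, so a common spectral parameter drops out.\<close>

lemma wronskian_ac_derivative: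
  assumes "sol Q1 a c y1 p1" "sol Q2 a c y2 p2"
  shows "has_ac_derivative_on (\<lambda>x. y1 x * p2 x - p1 x * y2 x)
           (\<lambda>x. (Q2 x - Q1 x) * (y1 x * y2 x)) {a..c}"
  using has_ac_derivative_on_diff[OF
      has_ac_derivative_on_mult[OF solD(1)[OF assms(1)] solD(2)[OF assms(2)]]
      has_ac_derivative_on_mult[OF solD(2)[OF assms(1)] solD(1)[OF assms(2)]]]
  by (rule has_ac_derivative_on_cong) (auto simp: algebra_simps)

lemma wronskian_eq:
  assumes "sol Q1 a c y1 p1" "sol Q2 a c y2 p2" "x \<in> {a..c}"
  shows "y1 x * p2 x - p1 x * y2 x =
    y1 a * p2 a - p1 a * y2 a + integral {a..x} (\<lambda>t. (Q2 t - Q1 t) * (y1 t * y2 t))"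
  using has_ac_derivative_on_eq_integral[OF wronskian_ac_derivative[OF assms(1,2)] assms(3)] by simp

lemma wronskian_const:
  assumes "sol Q a c y1 p1" "sol Q a c y2 p2" "x \<in> {a..c}"
  shows "y1 x * p2 x - p1 x * y2 x = y1 a * p2 a - p1 a * y2 a"
  using wronskian_eq[OF assms] by simp

lemma sol_fundamental:
  assumes "Q absolutely_integrable_on {a..c}" "a \<le> c"
  obtains C C' S S' where "sol Q a c C C'" "sol Q a c S S'"
    "C a = 1" "C' a = 0" "S a = 0" "S' a = 1"
    "\<And>x. x \<in> {a..c} \<Longrightarrow> C x * S' x - C' x * S x = 1"
proof -
  obtain C C' where C: "sol Q a c C C'" "C a = 1" "C' a = 0" by (rule sol_exists_bounded[OF assms])
  obtain S S' where S: "sol Q a c S S'" "S a = 0" "S' a = 1" by (rule sol_exists_bounded[OF assms])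
  show ?thesis using that C S wronskian_const[OF C(1) S(1)] by simp
qed

text \<open>Cramer's rule: a solution is recovered from its Wronskians with a fundamental system of
  determinant 1.\<close>

lemma solve_by_wronskians:
  fixes y p C C' S S' :: complex
  assumes "C * S' - C' * S = 1"
  shows "y = C * (y * S' - p * S) - S * (y * C' - p * C)"
    and "p = C' * (y * S' - p * S) - S' * (y * C' - p * C)"
proof -
  have "C * (y * S' - p * S) - S * (y * C' - p * C) = y * (C * S' - C' * S)" by (simp add: algebra_simps)
  then show "y = C * (y * S' - p * S) - S * (y * C' - p * C)" using assms by simp
  have "C' * (y * S' - p * S) - S' * (y * C' - p * C) = p * (C * S' - C' * S)" by (simp add: algebra_simps)
  then show "p = C' * (y * S' - p * S) - S' * (y * C' - p * C)" using assms by simp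
qed

text \<open>The Wronskians of \<open>y\<close> with \<open>C\<close> and \<open>S\<close> are
  constant, so they are known from the data at \<open>a\<close>. Uniqueness is a consequence,
  without a Gronwall inequality.\<close>

lemma sol_eq_fundamental:
  assumes y: "sol Q a c y p" and C: "sol Q a c C C'" and S: "sol Q a c S S'"
    and init: "C a = 1" "C' a = 0" "S a = 0" "S' a = 1" and x: "x \<in> {a..c}"
  shows "y x = y a * C x + p a * S x" "p x = y a * C' x + p a * S' x"
proof -
  have W: "C x * S' x - C' x * S x = 1" using wronskian_const[OF C S x] init by simp
  have W1: "y x * S' x - p x * S x = y a" using wronskian_const[OF y S x] init by simp
  have W2: "y x * C' x - p x * C x = - p a" using wronskian_const[OF y C x] init by simp
  show "y x = y a * C x + p a * S x" "p x = y a * C' x + p a * S' x"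
    using solve_by_wronskians[OF W, where y="y x" and p="p x"] unfolding W1 W2 by (simp_all add: mult.commute)
qed

lemma sol_unique:
  assumes Q: "Q absolutely_integrable_on {a..c}"
    and "sol Q a c y1 p1" "sol Q a c y2 p2" "y1 a = y2 a" "p1 a = p2 a" "x \<in> {a..c}"
  shows "y1 x = y2 x" "p1 x = p2 x"
proof -
  have "a \<le> c" using assms(6) by simp
  from sol_fundamental[OF Q this] obtain C C' S S' where f: "sol Q a c C C'" "sol Q a c S S'"
    "C a = 1" "C' a = 0" "S a = 0" "S' a = 1" by metis
  show "y1 x = y2 x" "p1 x = p2 x"
    using sol_eq_fundamental[OF assms(2) f assms(6)] sol_eq_fundamental[OF assms(3) f assms(6)] assms by simp_all
qed

lemma sol_bound:
  assumes Q: "Q absolutely_integrable_on {a..c}" and y: "sol Q a c y p" and x: "x \<in> {a..c}"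
  shows "norm (y x) \<le> (norm (y a) + norm (p a)) * exp (integral {a..c} (\<lambda>t. 1 + norm (Q t)))"
    and "norm (p x) \<le> (norm (y a) + norm (p a)) * exp (integral {a..c} (\<lambda>t. 1 + norm (Q t)))"
proof -
  have ac: "a \<le> c" using x by simp
  obtain y' p' where *: "sol Q a c y' p'" "y' a = y a" "p' a = p a"
    and b: "\<And>x. x \<in> {a..c} \<Longrightarrow> norm (y' x) \<le> (norm (y a) + norm (p a)) * exp (integral {a..c} (\<lambda>t. 1 + norm (Q t)))"
     "\<And>x. x \<in> {a..c} \<Longrightarrow> norm (p' x) \<le> (norm (y a) + norm (p a)) * exp (integral {a..c} (\<lambda>t. 1 + norm (Q t)))"
    using sol_exists_bounded[OF Q ac, of "y a" "p a"] by metis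
  show "norm (y x) \<le> (norm (y a) + norm (p a)) * exp (integral {a..c} (\<lambda>t. 1 + norm (Q t)))"
    and "norm (p x) \<le> (norm (y a) + norm (p a)) * exp (integral {a..c} (\<lambda>t. 1 + norm (Q t)))"
    using b[OF x] sol_unique[OF Q *(1) y *(2,3) x] by simp_all
qed

lemma sol_spike:
  assumes "sol Q a c y p" "AE x in lebesgue. x \<in> {a..c} \<longrightarrow> Q x = Q' x"
  shows "sol Q' a c y p"
  unfolding sol_def
proof (intro conjI solD(1)[OF assms(1)] has_ac_derivative_on_spike[OF solD(2)[OF assms(1)]])
  show "AE x in lebesgue. x \<in> {a..c} \<longrightarrow> Q x * y x = Q' x * y x"
    using assms(2) by eventually_elim auto
qed

text \<open>Turns data prescribed at the right end point into data at the left one, for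
  \<open>backward_solutions\<close>.\<close>

lemma sol_reflect:
  assumes "sol Q a c y p"
  shows "sol (\<lambda>x. Q (- x)) (- c) (- a) (\<lambda>x. y (- x)) (\<lambda>x. - p (- x))"
  unfolding sol_def
proof
  show "has_ac_derivative_on (\<lambda>x. y (- x)) (\<lambda>x. - p (- x)) {- c..- a}"
    by (rule has_ac_derivative_on_reflect[OF solD(1)[OF assms]])
  show "has_ac_derivative_on (\<lambda>x. - p (- x)) (\<lambda>x. Q (- x) * y (- x)) {- c..- a}"
    using has_ac_derivative_on_cmult[OF has_ac_derivative_on_reflect[OF solD(2)[OF assms]], of "-1"] by simp
qed

lemma absolutely_integrable_diff_const:
  fixes q :: "real \<Rightarrow> complex"
  shows "q absolutely_integrable_on {a..c} \<Longrightarrow> (\<lambda>x. q x - \<mu>) absolutely_integrable_on {a..c}"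
  by (intro set_integral_diff(1)) auto

subsection \<open>Dependence on the spectral parameter\<close>

text \<open>The data at \<open>a\<close> may depend on \<mu>: to the right of the jump they are
  combinations of the values at \<open>d\<close> of the solution on the left.\<close>

locale sol_family =
  fixes q :: "real \<Rightarrow> complex" and a c :: real and Y P :: "complex \<Rightarrow> real \<Rightarrow> complex"
  assumes ac: "a \<le> c" and q: "q absolutely_integrable_on {a..c}"
    and sol: "\<And>\<mu>. sol (\<lambda>x. q x - \<mu>) a c (Y \<mu>) (P \<mu>)"
    and init: "(\<lambda>\<mu>. Y \<mu> a) holomorphic_on UNIV" "(\<lambda>\<mu>. P \<mu> a) holomorphic_on UNIV"
begin

lemma locally_bounded:
  obtains B where "\<And>\<mu> x. \<mu> \<in> cball \<mu>0 1 \<Longrightarrow> x \<in> {a..c} \<Longrightarrow> norm (Y \<mu> x) \<le> B"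
proof -
  have "compact ((\<lambda>\<mu>. norm (Y \<mu> a) + norm (P \<mu> a)) ` cball \<mu>0 1)"
    using init by (intro compact_continuous_image continuous_intros)
      (auto intro: continuous_on_subset holomorphic_on_imp_continuous_on)
  then have "bounded ((\<lambda>\<mu>. norm (Y \<mu> a) + norm (P \<mu> a)) ` cball \<mu>0 1)" by (rule compact_imp_bounded)
  then obtain M where M: "\<And>\<mu>. \<mu> \<in> cball \<mu>0 1 \<Longrightarrow> norm (Y \<mu> a) + norm (P \<mu> a) \<le> M"
    unfolding bounded_iff by (metis (no_types, lifting) abs_le_D1 imageI real_norm_def)
  define I where "I = integral {a..c} (\<lambda>t. 1 + norm (q t) + (norm \<mu>0 + 1))"
  have "norm (Y \<mu> x) \<le> M * exp I" if \<mu>: "\<mu> \<in> cball \<mu>0 1" and x: "x \<in> {a..c}" for \<mu> x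
  proof -
    note Q = absolutely_integrable_diff_const[OF q]
    have "norm \<mu> \<le> norm \<mu>0 + 1"
      using \<mu> norm_triangle_ineq2[of \<mu> \<mu>0] by (simp add: dist_norm norm_minus_commute)
    have "integral {a..c} (\<lambda>t. 1 + norm (q t - \<mu>)) \<le> I"
      unfolding I_def
    proof (rule integral_le)
      show "(\<lambda>t. 1 + norm (q t - \<mu>)) integrable_on {a..c}"
        by (intro integrable_add absolutely_integrable_norm_on Q integrable_const_ivl)
      show "(\<lambda>t. 1 + norm (q t) + (norm \<mu>0 + 1)) integrable_on {a..c}"
        by (intro integrable_add absolutely_integrable_norm_on q integrable_const_ivl)
      fix t show "1 + norm (q t - \<mu>) \<le> 1 + norm (q t) + (norm \<mu>0 + 1)"
        using norm_triangle_ineq4[of "q t" \<mu>] \<open>norm \<mu> \<le> _\<close> by linarith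
    qed
    then have "(norm (Y \<mu> a) + norm (P \<mu> a)) * exp (integral {a..c} (\<lambda>t. 1 + norm (q t - \<mu>))) \<le> M * exp I"
      using M[OF \<mu>] norm_ge_zero[of "Y \<mu> a"] norm_ge_zero[of "P \<mu> a"]
      by (intro mult_mono) (simp_all del: norm_ge_zero)
    then show ?thesis using sol_bound(1)[OF Q sol x, of \<mu>] by simp
  qed
  then show ?thesis using that by blast
qed

text \<open>Variation of constants around \<open>\<mu>0\<close>: the term with
  \<open>\<mu> - \<mu>0\<close> is treated as a source in the equation with parameter
  \<open>\<mu>0\<close>, whose fundamental system does not depend on \<mu>. By the local bound on
  \<open>Y\<close> this source is of the size of \<open>\<mu> - \<mu>0\<close>, which gives uniform
  convergence.\<close>

lemma uniform_limit_at: "uniform_limit {a..c} Y (Y \<mu>0) (at \<mu>0)"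
  and variation_of_constants: "\<exists>C S C' S'. continuous_on {a..c} C \<and> continuous_on {a..c} S \<and> (\<forall>\<mu>. \<forall>x\<in>{a..c}.
     Y \<mu> x = C x * (Y \<mu> a + (\<mu> - \<mu>0) * integral {a..x} (\<lambda>t. S t * Y \<mu> t)) -
             S x * (- P \<mu> a + (\<mu> - \<mu>0) * integral {a..x} (\<lambda>t. C t * Y \<mu> t)) \<and>
     P \<mu> x = C' x * (Y \<mu> a + (\<mu> - \<mu>0) * integral {a..x} (\<lambda>t. S t * Y \<mu> t)) -
             S' x * (- P \<mu> a + (\<mu> - \<mu>0) * integral {a..x} (\<lambda>t. C t * Y \<mu> t)))"
proof -
  obtain C C' S S' where f: "sol (\<lambda>x. q x - \<mu>0) a c C C'" "sol (\<lambda>x. q x - \<mu>0) a c S S'"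
    "C a = 1" "C' a = 0" "S a = 0" "S' a = 1" and W: "\<And>x. x \<in> {a..c} \<Longrightarrow> C x * S' x - C' x * S x = 1"
    by (rule sol_fundamental[OF absolutely_integrable_diff_const[OF q, of \<mu>0] ac]) (rule that)
  note cC = sol_continuous(1)[OF f(1)] and cS = sol_continuous(1)[OF f(2)]
  have eq: "Y \<mu> x = C x * (Y \<mu> a + (\<mu> - \<mu>0) * integral {a..x} (\<lambda>t. S t * Y \<mu> t)) -
             S x * (- P \<mu> a + (\<mu> - \<mu>0) * integral {a..x} (\<lambda>t. C t * Y \<mu> t)) \<and>
            P \<mu> x = C' x * (Y \<mu> a + (\<mu> - \<mu>0) * integral {a..x} (\<lambda>t. S t * Y \<mu> t)) -
             S' x * (- P \<mu> a + (\<mu> - \<mu>0) * integral {a..x} (\<lambda>t. C t * Y \<mu> t))" if x: "x \<in> {a..c}" for \<mu> x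
  proof -
    have W1: "Y \<mu> x * S' x - P \<mu> x * S x = Y \<mu> a + (\<mu> - \<mu>0) * integral {a..x} (\<lambda>t. S t * Y \<mu> t)"
      using wronskian_eq[OF sol[of \<mu>] f(2) x] f by (simp add: mult.commute)
    have W2: "Y \<mu> x * C' x - P \<mu> x * C x = - P \<mu> a + (\<mu> - \<mu>0) * integral {a..x} (\<lambda>t. C t * Y \<mu> t)"
      using wronskian_eq[OF sol[of \<mu>] f(1) x] f by (simp add: mult.commute)
    show ?thesis
      using solve_by_wronskians[OF W[OF x], where y="Y \<mu> x" and p="P \<mu> x"] unfolding W1 W2 by blast
  qed
  then show "\<exists>C S C' S'. continuous_on {a..c} C \<and> continuous_on {a..c} S \<and> (\<forall>\<mu>. \<forall>x\<in>{a..c}.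
     Y \<mu> x = C x * (Y \<mu> a + (\<mu> - \<mu>0) * integral {a..x} (\<lambda>t. S t * Y \<mu> t)) -
             S x * (- P \<mu> a + (\<mu> - \<mu>0) * integral {a..x} (\<lambda>t. C t * Y \<mu> t)) \<and>
     P \<mu> x = C' x * (Y \<mu> a + (\<mu> - \<mu>0) * integral {a..x} (\<lambda>t. S t * Y \<mu> t)) -
             S' x * (- P \<mu> a + (\<mu> - \<mu>0) * integral {a..x} (\<lambda>t. C t * Y \<mu> t)))"
    using cC cS by blast
  obtain B where B: "\<And>\<mu> x. \<mu> \<in> cball \<mu>0 1 \<Longrightarrow> x \<in> {a..c} \<Longrightarrow> norm (Y \<mu> x) \<le> B"
    using locally_bounded by blast
  have "bounded (C ` {a..c} \<union> S ` {a..c})"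
    using cC cS by (simp add: compact_continuous_image compact_imp_bounded)
  then obtain D where "D > 0" "\<forall>z \<in> C ` {a..c} \<union> S ` {a..c}. norm z \<le> D"
    unfolding bounded_pos by blast
  then have D: "D > 0" "\<And>x. x \<in> {a..c} \<Longrightarrow> norm (C x) \<le> D" "\<And>x. x \<in> {a..c} \<Longrightarrow> norm (S x) \<le> D"
    by blast+
  have B0: "B \<ge> 0" using B[of \<mu>0 a] ac norm_ge_zero[of "Y \<mu>0 a"] by (simp del: norm_ge_zero)
  have int: "norm (integral {a..x} (\<lambda>t. k t * Y \<mu> t)) \<le> D * B * (c - a)"
    if k: "continuous_on {a..c} k" "\<And>x. x \<in> {a..c} \<Longrightarrow> norm (k x) \<le> D" and x: "x \<in> {a..c}" and \<mu>: "\<mu> \<in> cball \<mu>0 1" for k \<mu> x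
  proof -
    have "continuous_on {a..x} (\<lambda>t. k t * Y \<mu> t)"
      using x by (intro continuous_intros continuous_on_subset[OF k(1)] continuous_on_subset[OF sol_continuous(1)[OF sol]]) auto
    then have "norm (integral {a..x} (\<lambda>t. k t * Y \<mu> t)) \<le> D * B * (x - a)"
      using x k(2) B[OF \<mu>] D(1) by (intro integral_bound) (auto simp: norm_mult intro!: mult_mono)
    also have "\<dots> \<le> D * B * (c - a)" using x D B0 by (intro mult_left_mono) auto
    finally show ?thesis .
  qed
  define g where "g \<mu> = D * (norm (Y \<mu> a - Y \<mu>0 a) + norm (\<mu> - \<mu>0) * (D * B * (c - a))) +
      D * (norm (P \<mu> a - P \<mu>0 a) + norm (\<mu> - \<mu>0) * (D * B * (c - a)))" for \<mu>
  have le: "norm (Y \<mu> x - Y \<mu>0 x) \<le> g \<mu>" if x: "x \<in> {a..c}" and \<mu>: "\<mu> \<in> cball \<mu>0 1" for \<mu> x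
  proof -
    have "Y \<mu> x - Y \<mu>0 x = C x * ((Y \<mu> a - Y \<mu>0 a) + (\<mu> - \<mu>0) * integral {a..x} (\<lambda>t. S t * Y \<mu> t)) +
       S x * ((P \<mu> a - P \<mu>0 a) - (\<mu> - \<mu>0) * integral {a..x} (\<lambda>t. C t * Y \<mu> t))"
      using eq[OF x, of \<mu>] eq[OF x, of \<mu>0] by (simp add: algebra_simps)
    also have "norm \<dots> \<le> D * (norm (Y \<mu> a - Y \<mu>0 a) + norm (\<mu> - \<mu>0) * (D * B * (c - a))) +
      D * (norm (P \<mu> a - P \<mu>0 a) + norm (\<mu> - \<mu>0) * (D * B * (c - a)))"
    proof (rule order_trans[OF norm_triangle_ineq], rule add_mono; subst norm_mult)
      show "norm (C x) * norm ((Y \<mu> a - Y \<mu>0 a) + (\<mu> - \<mu>0) * integral {a..x} (\<lambda>t. S t * Y \<mu> t))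
        \<le> D * (norm (Y \<mu> a - Y \<mu>0 a) + norm (\<mu> - \<mu>0) * (D * B * (c - a)))"
        using int[OF cS D(3) x \<mu>] D(1) D(2)[OF x]
        by (intro mult_mono order_trans[OF norm_triangle_ineq] add_left_mono) (auto simp: norm_mult intro!: mult_left_mono)
      show "norm (S x) * norm ((P \<mu> a - P \<mu>0 a) - (\<mu> - \<mu>0) * integral {a..x} (\<lambda>t. C t * Y \<mu> t))
        \<le> D * (norm (P \<mu> a - P \<mu>0 a) + norm (\<mu> - \<mu>0) * (D * B * (c - a)))"
        using int[OF cC D(2) x \<mu>] D(1) D(3)[OF x]
        by (intro mult_mono order_trans[OF norm_triangle_ineq4] add_left_mono) (auto simp: norm_mult intro!: mult_left_mono)
    qed
    finally show ?thesis unfolding g_def .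
  qed
  have cont: "isCont (\<lambda>\<mu>. Y \<mu> a) \<mu>0" "isCont (\<lambda>\<mu>. P \<mu> a) \<mu>0"
    using init by (metis UNIV_I continuous_on_eq_continuous_at holomorphic_on_imp_continuous_on open_UNIV)+
  have "isCont g \<mu>0" unfolding g_def by (intro continuous_intros cont)
  then have "(g \<longlongrightarrow> g \<mu>0) (at \<mu>0)" by (simp add: isCont_def)
  then have g0: "(g \<longlongrightarrow> 0) (at \<mu>0)" by (simp add: g_def)
  show "uniform_limit {a..c} Y (Y \<mu>0) (at \<mu>0)"
  proof (rule uniform_limitI)
    fix e :: real assume "e > 0"
    have "eventually (\<lambda>\<mu>. norm (g \<mu>) < e) (at \<mu>0)" using tendstoD[OF g0 \<open>e > 0\<close>] by simp
    moreover have "eventually (\<lambda>\<mu>. \<mu> \<in> cball \<mu>0 1) (at \<mu>0)"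
      unfolding eventually_at by (rule exI[of _ 1]) (simp add: dist_commute)
    ultimately show "eventually (\<lambda>\<mu>. \<forall>x\<in>{a..c}. dist (Y \<mu> x) (Y \<mu>0 x) < e) (at \<mu>0)"
    proof eventually_elim
      case (elim \<mu>)
      show ?case
      proof
        fix x assume "x \<in> {a..c}"
        with le[OF this elim(2)] elim(1) show "dist (Y \<mu> x) (Y \<mu>0 x) < e" by (simp add: dist_norm)
      qed
    qed
  qed
qed

text \<open>In the variation of constants formula every integral carries a factor
  \<open>\<mu> - \<mu>0\<close>. By Caratheodory's criterion such a product is differentiable at
  \<open>\<mu>0\<close> once the integral is continuous there, and that is the uniform limit already
  proved.\<close>

lemma holomorphic:
  assumes x: "x \<in> {a..c}"
  shows "(\<lambda>\<mu>. Y \<mu> x) holomorphic_on UNIV" "(\<lambda>\<mu>. P \<mu> x) holomorphic_on UNIV"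
proof -
  have "(\<lambda>\<mu>. Y \<mu> x) field_differentiable at \<mu>0 \<and> (\<lambda>\<mu>. P \<mu> x) field_differentiable at \<mu>0" for \<mu>0
  proof -
    obtain C S C' S' where c: "continuous_on {a..c} C" "continuous_on {a..c} S" and eq: "\<And>\<mu>.
     Y \<mu> x = C x * (Y \<mu> a + (\<mu> - \<mu>0) * integral {a..x} (\<lambda>t. S t * Y \<mu> t)) -
             S x * (- P \<mu> a + (\<mu> - \<mu>0) * integral {a..x} (\<lambda>t. C t * Y \<mu> t)) \<and>
     P \<mu> x = C' x * (Y \<mu> a + (\<mu> - \<mu>0) * integral {a..x} (\<lambda>t. S t * Y \<mu> t)) -
             S' x * (- P \<mu> a + (\<mu> - \<mu>0) * integral {a..x} (\<lambda>t. C t * Y \<mu> t))"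
      using variation_of_constants[of \<mu>0] x by blast
    have d: "(\<lambda>\<mu>. (\<mu> - \<mu>0) * integral {a..x} (\<lambda>t. k t * Y \<mu> t)) field_differentiable at \<mu>0"
      if k: "continuous_on {a..c} k" for k
    proof -
      have "isCont (\<lambda>\<mu>. integral {a..x} (\<lambda>t. k t * Y \<mu> t)) \<mu>0"
        unfolding isCont_def
        by (intro integral_mult_uniform_limit[OF absolutely_integrable_continuous_real[OF k] x uniform_limit_at]
            sol_continuous(1)[OF sol])
      then show ?thesis unfolding field_differentiable_def
        by (intro exI, subst CARAT_DERIV)
          (rule exI[of _ "\<lambda>\<mu>. integral {a..x} (\<lambda>t. k t * Y \<mu> t)"], auto simp: mult.commute)
    qed
    have i: "(\<lambda>\<mu>. Y \<mu> a) field_differentiable at \<mu>0" "(\<lambda>\<mu>. P \<mu> a) field_differentiable at \<mu>0"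
      using init by (auto simp: holomorphic_on_def)
    have "(\<lambda>\<mu>. C x * (Y \<mu> a + (\<mu> - \<mu>0) * integral {a..x} (\<lambda>t. S t * Y \<mu> t)) -
             S x * (- P \<mu> a + (\<mu> - \<mu>0) * integral {a..x} (\<lambda>t. C t * Y \<mu> t))) field_differentiable at \<mu>0"
     "(\<lambda>\<mu>. C' x * (Y \<mu> a + (\<mu> - \<mu>0) * integral {a..x} (\<lambda>t. S t * Y \<mu> t)) -
             S' x * (- P \<mu> a + (\<mu> - \<mu>0) * integral {a..x} (\<lambda>t. C t * Y \<mu> t))) field_differentiable at \<mu>0"
      by (intro derivative_intros field_differentiable_diff field_differentiable_add field_differentiable_mult
          field_differentiable_minus field_differentiable_const d c i)+
    then show ?thesis using eq by simp
  qed
  then show "(\<lambda>\<mu>. Y \<mu> x) holomorphic_on UNIV" "(\<lambda>\<mu>. P \<mu> x) holomorphic_on UNIV"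
    by (auto simp: holomorphic_on_def)
qed

end

section \<open>Asymptotics for large spectral parameter\<close>

text \<open>The operator \<open>y'' - \<sigma>\<^sup>2 y\<close> factors into two operators of first
  order, so \<open>p + \<sigma> * y\<close> satisfies a linear first-order equation with source
  \<open>q * y\<close>, which the integrating factor \<open>E\<close> solves.\<close>

lemma first_order_factor:
  assumes q: "q absolutely_integrable_on {a..c}" and y: "sol (\<lambda>x. q x + \<sigma>\<^sup>2) a c y p" and x: "x \<in> {a..c}"
  shows "p x + \<sigma> * y x = exp (\<sigma> * of_real (x - a)) * (p a + \<sigma> * y a) +
           integral {a..x} (\<lambda>t. exp (\<sigma> * of_real (x - t)) * (q t * y t))"
proof -
  define E where "E t = exp (- \<sigma> * of_real (t - a))" for t
  have E: "has_ac_derivative_on E (\<lambda>t. - \<sigma> * E t) {a..c}"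
  proof (rule has_ac_derivative_on_vector_derivative)
    fix x
    have "((\<lambda>z. exp (- \<sigma> * (z - of_real a))) has_field_derivative - \<sigma> * exp (- \<sigma> * (of_real x - of_real a))) (at (of_real x))"
      by (auto intro!: derivative_eq_intros)
    from has_vector_derivative_real_field[OF this]
    show "(E has_vector_derivative - \<sigma> * E x) (at x within {a..c})"
      unfolding E_def by simp
  next
    show "continuous_on {a..c} (\<lambda>t. - \<sigma> * E t)" unfolding E_def by (intro continuous_intros)
  qed
  have Z: "has_ac_derivative_on (\<lambda>t. p t + \<sigma> * y t) (\<lambda>t. (q t + \<sigma>\<^sup>2) * y t + \<sigma> * p t) {a..c}"
    by (intro has_ac_derivative_on_add has_ac_derivative_on_cmult solD[OF y])
  have ac: "has_ac_derivative_on (\<lambda>t. E t * (p t + \<sigma> * y t)) (\<lambda>t. E t * (q t * y t)) {a..c}"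
    using has_ac_derivative_on_mult[OF E Z]
    by (rule has_ac_derivative_on_cong) (auto simp: algebra_simps power2_eq_square)
  have eq: "E x * (p x + \<sigma> * y x) = E a * (p a + \<sigma> * y a) + integral {a..x} (\<lambda>t. E t * (q t * y t))"
    by (rule has_ac_derivative_on_eq_integral[OF ac x])
  have "p x + \<sigma> * y x = inverse (E x) * (E x * (p x + \<sigma> * y x))"
    by (simp add: E_def)
  also have "\<dots> = inverse (E x) * (p a + \<sigma> * y a) + inverse (E x) * integral {a..x} (\<lambda>t. E t * (q t * y t))"
    unfolding eq by (simp add: E_def algebra_simps)
  also have "inverse (E x) * integral {a..x} (\<lambda>t. E t * (q t * y t)) =
      integral {a..x} (\<lambda>t. inverse (E x) * (E t * (q t * y t)))" by simp
  also have "\<dots> = integral {a..x} (\<lambda>t. exp (\<sigma> * of_real (x - t)) * (q t * y t))"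
    by (intro Henstock_Kurzweil_Integration.integral_cong) (simp add: E_def flip: exp_minus exp_add, simp add: algebra_simps exp_add)
  finally show ?thesis by (simp add: E_def exp_minus)
qed

text \<open>The combinations \<open>p + \<i> \<rho> y\<close> and \<open>p - \<i> \<rho> y\<close> satisfy first-order equations, by
  \<open>first_order_factor\<close>. For \<open>\<bar>\<rho>\<bar> \<ge> 2 N\<close> the maximum of their exponentially weighted size absorbs the
  perturbation by \<open>q\<close>, so that no Gronwall argument is needed.\<close>

lemma sol_estimate:
  fixes q :: "real \<Rightarrow> complex" and a c :: real and \<rho> :: complex
  defines "N \<equiv> integral {a..c} (\<lambda>t. norm (q t))" and "\<tau> \<equiv> \<bar>Im \<rho>\<bar>"
  assumes q: "q absolutely_integrable_on {a..c}" and y: "sol (\<lambda>x. q x - \<rho>\<^sup>2) a c y p"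
    and \<rho>: "\<rho> \<noteq> 0" "norm \<rho> \<ge> 2 * N" and x: "x \<in> {a..c}"
  shows "norm (y x - (y a * cos (\<rho> * of_real (x - a)) + p a * sin (\<rho> * of_real (x - a)) / \<rho>))
           \<le> 2 * N * (norm (p a) + norm \<rho> * norm (y a)) * exp (\<tau> * (x - a)) / (norm \<rho>)\<^sup>2"
    and "norm (p x - (p a * cos (\<rho> * of_real (x - a)) - y a * \<rho> * sin (\<rho> * of_real (x - a))))
           \<le> 2 * N * (norm (p a) + norm \<rho> * norm (y a)) * exp (\<tau> * (x - a)) / norm \<rho>"
proof -
  define z where "z \<sigma> t = p t + \<sigma> * y t" for \<sigma> t
  define s where "s t = norm (z (\<i> * \<rho>) t) + norm (z (- \<i> * \<rho>) t)" for t
  define u where "u t = exp (- \<tau> * (t - a)) * s t" for t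
  have ac: "a \<le> c" using x by simp
  note Nq = absolutely_integrable_norm_on[OF q]
  have N0: "N \<ge> 0" unfolding N_def by (intro Henstock_Kurzweil_Integration.integral_nonneg Nq) simp
  note cy = sol_continuous[OF y]
  have "continuous_on {a..c} u" unfolding u_def s_def z_def by (intro continuous_intros cy)
  then obtain t0 where t0: "t0 \<in> {a..c}" "\<And>t. t \<in> {a..c} \<Longrightarrow> u t \<le> u t0"
    using continuous_attains_sup[of "{a..c}" u] ac by auto
  define M where "M = u t0"
  have sle: "s t \<le> exp (\<tau> * (t - a)) * M" if "t \<in> {a..c}" for t
    using mult_left_mono[OF t0(2)[OF that], of "exp (\<tau> * (t - a))"]
    by (simp add: u_def M_def mult.assoc[symmetric] exp_minus flip: exp_add)
  have yle: "norm (y t) \<le> s t / (2 * norm \<rho>)" for t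
  proof -
    have "2 * \<i> * \<rho> * y t = z (\<i> * \<rho>) t - z (- \<i> * \<rho>) t" by (simp add: z_def algebra_simps)
    then have "norm (2 * \<i> * \<rho> * y t) \<le> s t" unfolding s_def by (metis norm_triangle_ineq4)
    then show ?thesis using \<rho> by (simp add: norm_mult field_simps)
  qed
  have zerr: "norm (z \<sigma> x - exp (\<sigma> * of_real (x - a)) * z \<sigma> a) \<le> exp (\<tau> * (x - a)) * M * N / (2 * norm \<rho>)"
    if x: "x \<in> {a..c}" and \<sigma>: "\<sigma> = \<i> * \<rho> \<or> \<sigma> = - \<i> * \<rho>" for x \<sigma>
  proof -
    have "\<sigma>\<^sup>2 = - \<rho>\<^sup>2" using \<sigma> by (auto simp: power_mult_distrib)
    then have y': "sol (\<lambda>x. q x + \<sigma>\<^sup>2) a c y p" using y by simp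
    have re: "Re \<sigma> \<le> \<tau>" using \<sigma> by (auto simp: \<tau>_def)
    have sub: "{a..x} \<subseteq> {a..c}" using x by auto
    have "z \<sigma> x - exp (\<sigma> * of_real (x - a)) * z \<sigma> a = integral {a..x} (\<lambda>t. exp (\<sigma> * of_real (x - t)) * (q t * y t))"
      using first_order_factor[OF q y' x] by (simp add: z_def)
    also have "norm \<dots> \<le> integral {a..x} (\<lambda>t. (exp (\<tau> * (x - a)) * M / (2 * norm \<rho>)) * norm (q t))"
    proof (rule norm_integral_le)
      have "(\<lambda>t. (exp (\<sigma> * of_real (x - t)) * y t) * q t) absolutely_integrable_on {a..x}"
        by (intro absolutely_integrable_continuous_mult continuous_intros continuous_on_subset[OF cy(1) sub]
            absolutely_integrable_on_subinterval[OF q sub])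
      then show "(\<lambda>t. exp (\<sigma> * of_real (x - t)) * (q t * y t)) absolutely_integrable_on {a..x}"
        by (simp add: algebra_simps)
      show "(\<lambda>t. (exp (\<tau> * (x - a)) * M / (2 * norm \<rho>)) * norm (q t)) integrable_on {a..x}"
        by (intro integrable_on_mult_right integrable_subinterval_real[OF Nq sub])
      fix t assume t: "t \<in> {a..x}"
      have "norm (exp (\<sigma> * of_real (x - t)) * (q t * y t)) = exp (Re \<sigma> * (x - t)) * (norm (q t) * norm (y t))"
        by (simp add: norm_mult)
      also have "\<dots> \<le> exp (\<tau> * (x - t)) * (norm (q t) * (exp (\<tau> * (t - a)) * M / (2 * norm \<rho>)))"
        using t sub re \<rho> by (intro mult_mono mult_left_mono order_trans[OF yle] divide_right_mono sle) (auto intro!: mult_right_mono)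
      also have "\<dots> = (exp (\<tau> * (x - t)) * exp (\<tau> * (t - a)) * M / (2 * norm \<rho>)) * norm (q t)" by simp
      also have "exp (\<tau> * (x - t)) * exp (\<tau> * (t - a)) = exp (\<tau> * (x - a))"
        by (simp flip: exp_add add: algebra_simps)
      finally show "norm (exp (\<sigma> * of_real (x - t)) * (q t * y t)) \<le> (exp (\<tau> * (x - a)) * M / (2 * norm \<rho>)) * norm (q t)" .
    qed
    also have "\<dots> = (exp (\<tau> * (x - a)) * M / (2 * norm \<rho>)) * integral {a..x} (\<lambda>t. norm (q t))" by simp
    also have "\<dots> \<le> (exp (\<tau> * (x - a)) * M / (2 * norm \<rho>)) * N"
    proof (rule mult_left_mono)
      show "integral {a..x} (\<lambda>t. norm (q t)) \<le> N"
        unfolding N_def by (intro integral_subset_le sub Nq integrable_subinterval_real[OF Nq sub]) simp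
      show "0 \<le> exp (\<tau> * (x - a)) * M / (2 * norm \<rho>)" by (simp add: M_def u_def s_def)
    qed
    finally show ?thesis by simp
  qed
  have exple: "norm (exp (\<sigma> * of_real (x - a))) \<le> exp (\<tau> * (x - a))"
    if x: "x \<in> {a..c}" and \<sigma>: "\<sigma> = \<i> * \<rho> \<or> \<sigma> = - \<i> * \<rho>" for x \<sigma>
    using x \<sigma> by (auto simp: \<tau>_def intro!: mult_right_mono)
  have zle: "norm (z \<sigma> x) \<le> exp (\<tau> * (x - a)) * (norm (z \<sigma> a) + M * N / (2 * norm \<rho>))"
    if x: "x \<in> {a..c}" and \<sigma>: "\<sigma> = \<i> * \<rho> \<or> \<sigma> = - \<i> * \<rho>" for x \<sigma>
  proof -
    have "norm (z \<sigma> x) \<le> norm (exp (\<sigma> * of_real (x - a)) * z \<sigma> a) + norm (z \<sigma> x - exp (\<sigma> * of_real (x - a)) * z \<sigma> a)"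
      by (rule norm_triangle_sub)
    also have "\<dots> \<le> exp (\<tau> * (x - a)) * norm (z \<sigma> a) + exp (\<tau> * (x - a)) * M * N / (2 * norm \<rho>)"
      unfolding norm_mult by (intro add_mono mult_right_mono zerr exple that) simp
    finally show ?thesis by (simp add: distrib_left)
  qed
  have "s t0 \<le> exp (\<tau> * (t0 - a)) * (s a + M * N / norm \<rho>)"
  proof -
    define \<kappa> where "\<kappa> = M * N / (2 * norm \<rho>)"
    have "M * N / norm \<rho> = 2 * \<kappa>" by (simp add: \<kappa>_def)
    then show ?thesis
      using zle[OF t0(1), of "\<i> * \<rho>", folded \<kappa>_def] zle[OF t0(1), of "- \<i> * \<rho>", folded \<kappa>_def]
      by (simp add: s_def distrib_left)
  qed
  from mult_left_mono[OF this, of "exp (- \<tau> * (t0 - a))"]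
  have "M \<le> s a + M * N / norm \<rho>"
    by (simp add: M_def u_def mult.assoc[symmetric] exp_minus flip: exp_add)
  also have "M * N / norm \<rho> \<le> M * (1 / 2)"
  proof -
    have "N / norm \<rho> \<le> 1 / 2" using \<rho> by (simp add: field_simps)
    from mult_left_mono[OF this, of M] show ?thesis by (simp add: M_def u_def s_def)
  qed
  finally have M: "M \<le> 2 * s a" by simp
  have sa: "s a \<le> 2 * (norm (p a) + norm \<rho> * norm (y a))"
    using norm_triangle_ineq[of "p a" "\<i> * \<rho> * y a"] norm_triangle_ineq[of "p a" "- \<i> * \<rho> * y a"]
    by (simp add: s_def z_def norm_mult)
  define e where "e = 2 * N * (norm (p a) + norm \<rho> * norm (y a)) * exp (\<tau> * (x - a)) / norm \<rho>"
  have err: "norm (z \<sigma> x - exp (\<sigma> * of_real (x - a)) * z \<sigma> a) \<le> e" if \<sigma>: "\<sigma> = \<i> * \<rho> \<or> \<sigma> = - \<i> * \<rho>" for \<sigma>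
  proof -
    have "M * (exp (\<tau> * (x - a)) * N / (2 * norm \<rho>)) \<le> (4 * (norm (p a) + norm \<rho> * norm (y a))) * (exp (\<tau> * (x - a)) * N / (2 * norm \<rho>))"
      using M sa N0 by (intro mult_right_mono) auto
    also have "\<dots> = e" using \<rho>(1) by (simp add: e_def field_simps)
    finally show ?thesis using zerr[OF x \<sigma>] by (simp add: mult.commute mult.left_commute)
  qed
  define \<theta> where "\<theta> = \<rho> * of_real (x - a)"
  define Z1 where "Z1 = z (\<i> * \<rho>) x - exp (\<i> * \<rho> * of_real (x - a)) * z (\<i> * \<rho>) a"
  define Z2 where "Z2 = z (- \<i> * \<rho>) x - exp (- \<i> * \<rho> * of_real (x - a)) * z (- \<i> * \<rho>) a"
  have Z: "norm Z1 \<le> e" "norm Z2 \<le> e" using err[of "\<i> * \<rho>"] err[of "- \<i> * \<rho>"] by (simp_all add: Z1_def Z2_def)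
  have ex: "exp (\<i> * \<rho> * of_real (x - a)) = cos \<theta> + \<i> * sin \<theta>" "exp (- \<i> * \<rho> * of_real (x - a)) = cos \<theta> - \<i> * sin \<theta>"
    using exp_Euler[of \<theta>] exp_minus_Euler[of \<theta>] by (simp_all add: \<theta>_def mult.assoc)
  have "2 * \<i> * \<rho> * (y x - (y a * cos \<theta> + p a * sin \<theta> / \<rho>)) = Z1 - Z2"
    using \<rho>(1) unfolding Z1_def Z2_def ex z_def by (simp add: field_simps)
  then have "norm (2 * \<i> * \<rho>) * norm (y x - (y a * cos \<theta> + p a * sin \<theta> / \<rho>)) \<le> 2 * e"
    unfolding norm_mult[symmetric] using norm_triangle_ineq4[of Z1 Z2] Z by simp
  then have "norm (y x - (y a * cos \<theta> + p a * sin \<theta> / \<rho>)) \<le> e / norm \<rho>"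
    using \<rho>(1) by (simp only: norm_mult) (simp add: pos_le_divide_eq mult.commute)
  then show "norm (y x - (y a * cos (\<rho> * of_real (x - a)) + p a * sin (\<rho> * of_real (x - a)) / \<rho>))
           \<le> 2 * N * (norm (p a) + norm \<rho> * norm (y a)) * exp (\<tau> * (x - a)) / (norm \<rho>)\<^sup>2"
    by (simp add: e_def \<theta>_def power2_eq_square)
  have "2 * (p x - (p a * cos \<theta> - y a * \<rho> * sin \<theta>)) = Z1 + Z2"
    unfolding Z1_def Z2_def ex z_def by (simp add: algebra_simps)
  then have "norm (2 * (p x - (p a * cos \<theta> - y a * \<rho> * sin \<theta>))) \<le> 2 * e"
    using norm_triangle_ineq[of Z1 Z2] Z by simp
  then show "norm (p x - (p a * cos (\<rho> * of_real (x - a)) - y a * \<rho> * sin (\<rho> * of_real (x - a))))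
           \<le> 2 * N * (norm (p a) + norm \<rho> * norm (y a)) * exp (\<tau> * (x - a)) / norm \<rho>"
    by (simp only: norm_mult \<theta>_def e_def) simp
qed

section \<open>Entire functions\<close>

text \<open>The boundary of a square with half side \<open>r\<close>. Its vertical sides have
  constant \<open>\<bar>Re z\<bar>\<close>, which can be placed where \<open>cos\<close> or
  \<open>sin\<close> is extremal on the real axis; on the horizontal sides
  \<open>\<bar>Im z\<bar>\<close> equals \<open>r\<close>.\<close>

definition on_square :: "real \<Rightarrow> complex \<Rightarrow> bool" where
  "on_square r z \<longleftrightarrow> max \<bar>Re z\<bar> \<bar>Im z\<bar> = r"

lemma norm_ge_on_square: "on_square r z \<Longrightarrow> r \<le> norm z"
  using abs_Re_le_cmod[of z] abs_Im_le_cmod[of z] by (auto simp: on_square_def)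

lemma norm_le_on_square: "on_square r z \<Longrightarrow> norm z \<le> 2 * r"
  using cmod_le[of z] by (auto simp: on_square_def)

lemma maximum_modulus_square:
  assumes g: "g holomorphic_on UNIV" and le: "\<And>z. on_square r z \<Longrightarrow> norm (g z) \<le> B"
    and \<xi>: "norm \<xi> \<le> r"
  shows "norm (g \<xi>) \<le> B"
proof -
  define S where "S = {z. \<bar>Re z\<bar> \<le> r \<and> \<bar>Im z\<bar> \<le> r}"
  define T where "T = {z. \<bar>Re z\<bar> < r \<and> \<bar>Im z\<bar> < r}"
  have clS: "closed S" unfolding S_def
    by (intro closed_Collect_conj closed_Collect_le continuous_intros)
  have "open T" unfolding T_def
    by (intro open_Collect_conj open_Collect_less continuous_intros)
  then have TS: "T \<subseteq> interior S" by (intro interior_maximal) (auto simp: S_def T_def)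
  show ?thesis
  proof (rule maximum_modulus_frontier[of g S])
    show "g holomorphic_on interior S" "continuous_on (closure S) g"
      using g by (auto intro: holomorphic_on_subset continuous_on_subset holomorphic_on_imp_continuous_on)
    show "bounded S" unfolding bounded_iff
    proof (intro exI ballI)
      fix z assume "z \<in> S" then show "norm z \<le> 2 * r" using cmod_le[of z] by (auto simp: S_def)
    qed
    show "\<xi> \<in> S" using \<xi> abs_Re_le_cmod[of \<xi>] abs_Im_le_cmod[of \<xi>] by (auto simp: S_def)
    fix z assume "z \<in> frontier S"
    then have "z \<in> S" "z \<notin> T" using clS TS by (auto simp: frontier_def)
    then have "on_square r z" by (auto simp: S_def T_def on_square_def)
    then show "norm (g z) \<le> B" by (rule le)
  qed
qed

lemma filterlim_arith_at_top:
  "\<kappa> > 0 \<Longrightarrow> s \<ge> 0 \<Longrightarrow> filterlim (\<lambda>N. (real N + s) * \<kappa>) at_top sequentially"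
proof -
  assume "\<kappa> > 0" "s \<ge> 0"
  have "filterlim (\<lambda>N. real N + s) at_top sequentially"
    by (rule filterlim_at_top_mono[OF filterlim_real_sequentially]) (use \<open>s \<ge> 0\<close> in auto)
  then show ?thesis using \<open>\<kappa> > 0\<close> by (intro filterlim_at_top_mult_tendsto_pos[OF tendsto_const])
qed

text \<open>The half sides grow arithmetically, so a point of large modulus lies inside a square not
  much larger than its modulus; the maximum principle spreads the bound to the whole plane and
  Liouville's theorem makes \<open>g\<close> a polynomial. A nonconstant polynomial is unbounded
  along every sequence tending to infinity, and a constant with limit 0 is 0.\<close>

lemma entire_eq_0_by_squares:
  fixes g :: "complex \<Rightarrow> complex" and s \<kappa> :: real
  defines "r \<equiv> \<lambda>N::nat. (real N + s) * \<kappa>"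
  assumes g: "g holomorphic_on UNIV" and pos: "s \<ge> 0" "\<kappa> > 0"
    and le: "\<And>N z. N \<ge> N0 \<Longrightarrow> on_square (r N) z \<Longrightarrow> norm (g z) \<le> C * r N ^ n"
    and lim: "(\<lambda>N. g (\<i> * of_real (r N))) \<longlonglongrightarrow> 0"
  shows "g z = 0"
proof -
  \<comment> \<open>For \<open>norm z \<ge> A\<close> the first square containing \<open>z\<close>
    has index at least \<open>N0\<close>, by \<open>r N0\<close>, and half side at most
    \<open>norm z + (1 + s) * \<kappa> \<le> 2 * norm z\<close>.\<close>
  define A where "A = max (r N0) (max 1 ((1 + s) * \<kappa>))"
  have C0: "C * r N0 ^ n \<ge> 0"
  proof -
    have "r N0 \<ge> 0" using pos by (simp add: r_def)
    then have "on_square (r N0) (\<i> * of_real (r N0))" by (simp add: on_square_def)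
    from le[OF order_refl this] show ?thesis by (rule order_trans[OF norm_ge_zero])
  qed
  have bound: "norm (g z) \<le> (\<bar>C\<bar> * 2 ^ n) * norm z ^ n" if z: "A \<le> norm z" for z
  proof -
    define N where "N = nat \<lceil>norm z / \<kappa>\<rceil>"
    have N: "real N \<ge> norm z / \<kappa>" "real N \<le> norm z / \<kappa> + 1"
      unfolding N_def using pos of_int_ceiling_le_add_one[of "norm z / \<kappa>"] real_nat_ceiling_ge[of "norm z / \<kappa>"]
      by (simp_all add: of_nat_nat)
    have rN: "r N \<ge> norm z"
    proof -
      have "norm z = (norm z / \<kappa>) * \<kappa>" using pos by simp
      also have "\<dots> \<le> r N" unfolding r_def using N pos by (intro mult_right_mono) auto
      finally show ?thesis .
    qed
    have "r N \<le> (norm z / \<kappa> + 1 + s) * \<kappa>" unfolding r_def using N pos by (intro mult_right_mono) auto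
    also have "\<dots> = norm z + (1 + s) * \<kappa>" using pos by (simp add: field_simps)
    finally have rN2: "r N \<le> 2 * norm z" using z by (simp add: A_def)
    have "r N \<ge> r N0" using rN z by (simp add: A_def)
    then have "N \<ge> N0" using pos by (simp add: r_def)
    have rN0: "r N \<ge> 0" using pos by (simp add: r_def)
    have "norm (g z) \<le> C * r N ^ n"
      by (rule maximum_modulus_square[OF g le[OF \<open>N \<ge> N0\<close>] rN])
    also have "\<dots> \<le> \<bar>C\<bar> * (2 * norm z) ^ n" using rN0 rN2 by (intro mult_mono power_mono) auto
    finally show ?thesis by (simp add: power_mult_distrib mult.assoc)
  qed
  define a where "a k = (deriv ^^ k) g 0 / fact k" for k
  have poly: "g z = (\<Sum>k\<le>n. a k * z ^ k)" for z
    unfolding a_def by (rule Liouville_polynomial[OF g bound])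
  have inf: "filterlim (\<lambda>N. \<i> * of_real (r N)) at_infinity sequentially"
  proof -
    have "filterlim (\<lambda>N. (real N + s) * \<kappa>) at_top sequentially"
      by (rule filterlim_arith_at_top[OF pos(2,1)])
    then have "filterlim (\<lambda>N. norm (\<i> * of_real (r N))) at_top sequentially"
      by (rule filterlim_at_top_mono) (auto simp: r_def norm_mult simp del: of_real_mult of_real_add intro!: always_eventually)
    then show ?thesis by (simp add: filterlim_at_infinity_conv_norm_at_top)
  qed
  have "a k = 0" if "k \<noteq> 0" "k \<le> n" for k
  proof (rule ccontr)
    assume "a k \<noteq> 0"
    with that have "eventually (\<lambda>z. norm (\<Sum>i\<le>n. a i * z ^ i) \<ge> 1) at_infinity"
      by (intro polyfun_extremal) auto
    then have "eventually (\<lambda>N. norm (g (\<i> * of_real (r N))) \<ge> 1) sequentially"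
      unfolding poly[symmetric] by (rule eventually_compose_filterlim[OF _ inf])
    moreover have "eventually (\<lambda>N. norm (g (\<i> * of_real (r N))) < 1) sequentially"
      using tendstoD[OF lim zero_less_one] by simp
    ultimately have "eventually (\<lambda>N::nat. False) sequentially" by eventually_elim simp
    then show False by simp
  qed
  then have const: "g z = a 0" for z
    unfolding poly[of z] by (subst sum.atMost_shift) simp
  then have "a 0 = 0" using lim by (simp add: LIMSEQ_const_iff)
  then show ?thesis using const by simp
qed

text \<open>Vanishing to order at least \<open>n\<close>; unlike \<open>zorder\<close> this also makes sense for the zero function.\<close>

definition order_ge :: "(complex \<Rightarrow> complex) \<Rightarrow> complex \<Rightarrow> nat \<Rightarrow> bool" where
  "order_ge f z n \<longleftrightarrow> (\<exists>v. isCont v z \<and> (\<forall>\<^sub>F w in nhds z. f w = (w - z) ^ n * v w))"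

lemma order_ge_mono:
  assumes "order_ge f z n" "m \<le> n"
  shows "order_ge f z m"
proof -
  from assms obtain v where v: "isCont v z" "\<forall>\<^sub>F w in nhds z. f w = (w - z) ^ n * v w" by (auto simp: order_ge_def)
  show ?thesis unfolding order_ge_def
  proof (intro exI conjI)
    show "isCont (\<lambda>w. (w - z) ^ (n - m) * v w) z" by (intro continuous_intros v)
    show "\<forall>\<^sub>F w in nhds z. f w = (w - z) ^ m * ((w - z) ^ (n - m) * v w)"
      using v(2) by eventually_elim (use assms(2) in \<open>simp flip: power_add mult.assoc\<close>)
  qed
qed

lemma order_ge_mult:
  assumes "order_ge f z m" "order_ge g z n"
  shows "order_ge (\<lambda>w. f w * g w) z (m + n)"
proof -
  from assms obtain v u where v: "isCont v z" "\<forall>\<^sub>F w in nhds z. f w = (w - z) ^ m * v w"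
    and u: "isCont u z" "\<forall>\<^sub>F w in nhds z. g w = (w - z) ^ n * u w" by (auto simp: order_ge_def)
  show ?thesis unfolding order_ge_def
  proof (intro exI conjI)
    show "isCont (\<lambda>w. v w * u w) z" by (intro continuous_intros v u)
    show "\<forall>\<^sub>F w in nhds z. f w * g w = (w - z) ^ (m + n) * (v w * u w)"
      using v(2) u(2) by eventually_elim (simp add: power_add)
  qed
qed

lemma order_ge_0: "isCont f z \<Longrightarrow> order_ge f z 0"
  by (auto simp: order_ge_def)

lemma order_ge_diff:
  assumes "order_ge f z n" "order_ge g z n"
  shows "order_ge (\<lambda>w. f w - g w) z n"
proof -
  from assms obtain v u where v: "isCont v z" "\<forall>\<^sub>F w in nhds z. f w = (w - z) ^ n * v w"
    and u: "isCont u z" "\<forall>\<^sub>F w in nhds z. g w = (w - z) ^ n * u w" by (auto simp: order_ge_def)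
  show ?thesis unfolding order_ge_def
  proof (intro exI conjI)
    show "isCont (\<lambda>w. v w - u w) z" by (intro continuous_intros v u)
    show "\<forall>\<^sub>F w in nhds z. f w - g w = (w - z) ^ n * (v w - u w)"
      using v(2) u(2) by eventually_elim (simp add: algebra_simps)
  qed
qed

lemma order_ge_cancel:
  assumes "order_ge (\<lambda>w. h w * f w) z n" "isCont h z" "h z \<noteq> 0"
  shows "order_ge f z n"
proof -
  from assms obtain v where v: "isCont v z" "\<forall>\<^sub>F w in nhds z. h w * f w = (w - z) ^ n * v w"
    by (auto simp: order_ge_def)
  have "\<forall>\<^sub>F w in nhds z. h w \<noteq> 0"
    using assms(2,3) by (simp add: eventually_nhds_conv_at isCont_def tendsto_imp_eventually_ne)
  show ?thesis unfolding order_ge_def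
  proof (intro exI conjI)
    show "isCont (\<lambda>w. v w / h w) z" by (intro continuous_intros v assms)
    show "\<forall>\<^sub>F w in nhds z. f w = (w - z) ^ n * (v w / h w)"
      using v(2) \<open>\<forall>\<^sub>F w in nhds z. h w \<noteq> 0\<close>
      by eventually_elim (simp add: field_simps)
  qed
qed

lemma entire_local_form:
  assumes D: "D holomorphic_on UNIV" "D z0 \<noteq> 0"
  obtains u where "isCont u z" "u z \<noteq> 0"
    "\<forall>\<^sub>F w in nhds z. D w = u w * (w - z) ^ nat (zorder D z)"
proof -
  obtain r where r: "r > 0" "zor_poly D z holomorphic_on cball z r"
    "\<forall>w\<in>cball z r. D w = zor_poly D z w * (w - z) ^ nat (zorder D z) \<and> zor_poly D z w \<noteq> 0"
    using zorder_exist_zero[OF D(1) open_UNIV connected_UNIV UNIV_I, of z] D(2) by blast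
  show ?thesis
  proof
    have "continuous_on (ball z r) (zor_poly D z)"
      by (meson ball_subset_cball continuous_on_subset holomorphic_on_imp_continuous_on r(2))
    then show "isCont (zor_poly D z) z"
      using r(1) by (simp add: continuous_on_eq_continuous_at)
    show "zor_poly D z z \<noteq> 0" using r by auto
    have "\<forall>\<^sub>F w in nhds z. w \<in> ball z r" using r(1) by (intro eventually_nhds_in_open) auto
    then show "\<forall>\<^sub>F w in nhds z. D w = zor_poly D z w * (w - z) ^ nat (zorder D z)"
      by eventually_elim (use r(3) in auto)
  qed
qed

text \<open>The order condition makes \<open>f / D\<close> converge at every zero of
  \<open>D\<close>, and \<open>remove_sings\<close> fills in the limits. The point \<open>z0\<close>
  shows that \<open>D\<close> does not vanish identically, so that its zeros have finite
  order.\<close>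

lemma entire_quotient:
  fixes f D :: "complex \<Rightarrow> complex"
  assumes f: "f holomorphic_on UNIV" and D: "D holomorphic_on UNIV" "D z0 \<noteq> 0"
    and ord: "\<And>z. D z = 0 \<Longrightarrow> order_ge f z (nat (zorder D z))"
  obtains Q where "Q holomorphic_on UNIV" "\<And>z. D z \<noteq> 0 \<Longrightarrow> Q z = f z / D z"
proof -
  define Q where "Q = remove_sings (\<lambda>z. f z / D z)"
  have an: "(\<lambda>z. f z / D z) analytic_on {z}" if "D z \<noteq> 0" for z
    using that f D(1) by (intro analytic_on_divide) (auto simp: analytic_on_open[of UNIV] intro: analytic_on_subset[of _ UNIV])
  have "Q analytic_on {z}" for z
  proof (cases "D z = 0")
    case False
    then show ?thesis unfolding Q_def by (intro remove_sings_analytic_on an)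
  next
    case True
    obtain u where u: "isCont u z" "u z \<noteq> 0" "\<forall>\<^sub>F w in nhds z. D w = u w * (w - z) ^ nat (zorder D z)"
      using entire_local_form[OF D] by metis
    obtain v where v: "isCont v z" "\<forall>\<^sub>F w in nhds z. f w = (w - z) ^ nat (zorder D z) * v w"
      using ord[OF True] by (auto simp: order_ge_def)
    have un: "\<forall>\<^sub>F w in at z. u w \<noteq> 0"
      using u(1,2) by (simp add: isCont_def tendsto_imp_eventually_ne)
    have ne: "\<forall>\<^sub>F w in at z. w \<noteq> z" by (simp add: eventually_at_filter)
    note u' = eventually_nhds_conv_at[THEN iffD1, OF u(3), THEN conjunct1]
    note v' = eventually_nhds_conv_at[THEN iffD1, OF v(2), THEN conjunct1]
    have eq: "\<forall>\<^sub>F w in at z. f w / D w = v w / u w"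
      using un ne u' v'
      by eventually_elim (simp add: field_simps)
    have "((\<lambda>w. v w / u w) \<longlongrightarrow> v z / u z) (at z)"
      using u v by (intro tendsto_divide) (auto simp: isCont_def)
    then have lim: "(\<lambda>w. f w / D w) \<midarrow>z\<rightarrow> v z / u z"
      using eq by (simp add: tendsto_cong)
    have Dn: "\<forall>\<^sub>F w in at z. D w \<noteq> 0"
      using un ne u' by eventually_elim simp
    have "isolated_singularity_at (\<lambda>z. f z / D z) z"
    proof -
      have "\<forall>\<^sub>F w in at z. (\<lambda>z. f z / D z) analytic_on {w}" using Dn by eventually_elim (rule an)
      then obtain d where d: "d > 0" "\<And>w. w \<noteq> z \<Longrightarrow> dist w z < d \<Longrightarrow> (\<lambda>z. f z / D z) analytic_on {w}"
        unfolding eventually_at by blast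
      then have "(\<lambda>z. f z / D z) analytic_on ball z d - {z}"
        by (subst analytic_on_analytic_at) (auto simp: dist_commute)
      then show ?thesis unfolding isolated_singularity_at_def using d(1) by blast
    qed
    then show ?thesis unfolding Q_def using lim by (rule remove_sings_analytic_at)
  qed
  then have "Q analytic_on UNIV" by (subst analytic_on_analytic_at) auto
  then have "Q holomorphic_on UNIV" by (simp add: analytic_on_open)
  moreover have "Q z = f z / D z" if "D z \<noteq> 0" for z
    unfolding Q_def using remove_sings_at_analytic[OF an[OF that]] .
  ultimately show ?thesis using that by blast
qed

lemma order_ge_prod:
  fixes lam :: "nat \<Rightarrow> complex"
  assumes "finite L"
  shows "order_ge (\<lambda>w. \<Prod>n\<in>L. w - lam n) z (card {n\<in>L. lam n = z})"
proof -
  have "(\<Prod>n\<in>L. w - lam n) = (w - z) ^ card {n\<in>L. lam n = z} * (\<Prod>n\<in>{n\<in>L. lam n \<noteq> z}. w - lam n)" for w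
  proof -
    have "(\<Prod>n\<in>L. w - lam n) = (\<Prod>n\<in>{n\<in>L. lam n = z} \<union> {n\<in>L. lam n \<noteq> z}. w - lam n)"
      by (rule prod.cong) auto
    also have "\<dots> = (\<Prod>n\<in>{n\<in>L. lam n = z}. w - lam n) * (\<Prod>n\<in>{n\<in>L. lam n \<noteq> z}. w - lam n)"
      using assms by (intro prod.union_disjoint) auto
    finally show ?thesis by simp
  qed
  then show ?thesis unfolding order_ge_def
    by (intro exI[of _ "\<lambda>w. \<Prod>n\<in>{n\<in>L. lam n \<noteq> z}. w - lam n"]) (auto intro!: continuous_intros)
qed

text \<open>\<open>A * F\<close> and \<open>B * F\<close> are combinations of \<open>D\<close> and
  \<open>D'\<close> with entire coefficients, so at a common zero both vanish to the common
  multiplicity; as \<open>A\<close> or \<open>B\<close> is nonzero there, \<open>F\<close> inherits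
  it. The product over \<open>L\<close> supplies the multiplicity of the exceptional eigenvalues.
  Only \<open>D\<close> is divided out, so the product runs over the exceptional indices of
  \<open>D\<close> alone.\<close>

lemma common_spectrum_quotient:
  fixes D D' F A B y p yt pt :: "complex \<Rightarrow> complex"
  assumes hol: "D holomorphic_on UNIV" "D' holomorphic_on UNIV" "F holomorphic_on UNIV"
      "A holomorphic_on UNIV" "B holomorphic_on UNIV" "y holomorphic_on UNIV" "p holomorphic_on UNIV"
      "yt holomorphic_on UNIV" "pt holomorphic_on UNIV"
    and D: "\<And>z. D z = A z * y z + B z * p z" and D': "\<And>z. D' z = A z * yt z + B z * pt z"
    and F: "\<And>z. F z = y z * pt z - p z * yt z"
    and AB: "\<And>z. A z \<noteq> 0 \<or> B z \<noteq> 0"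
    and nz: "D z0 \<noteq> 0" "D' z1 \<noteq> 0"
    and sp: "spectra_coincide_except k D D'"
  obtains Q lam and L :: "nat set" where "Q holomorphic_on UNIV" "finite L" "card L = k"
    "\<And>z. D z \<noteq> 0 \<Longrightarrow> Q z = F z * (\<Prod>n\<in>L. z - lam n) / D z"
proof -
  from sp obtain lam lam' L L' f where lam: "spectrum_enum D lam" "spectrum_enum D' lam'"
    and L: "finite L" "finite L'" "card L = k" and f: "bij_betw f (- L) (- L')" "\<And>n. n \<in> - L \<Longrightarrow> lam n = lam' (f n)"
    unfolding spectra_coincide_except_def coincide_except_def by blast
  have cont: "isCont h z" if "h holomorphic_on UNIV" for h :: "complex \<Rightarrow> complex" and z
    using that by (metis UNIV_I continuous_on_eq_continuous_at holomorphic_on_imp_continuous_on open_UNIV)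
  \<comment> \<open>Cramer's rule for the two linear equations that express \<open>D\<close> and
    \<open>D'\<close> through \<open>A\<close> and \<open>B\<close>.\<close>
  have AF: "A z * F z = D z * pt z - p z * D' z" and BF: "B z * F z = y z * D' z - D z * yt z" for z
    unfolding D D' F by (simp_all add: algebra_simps)
  have ordD: "order_ge E z (nat (zorder E z))" if E: "E holomorphic_on UNIV" "E z2 \<noteq> 0" for E z z2
  proof -
    obtain u where "isCont u z" "\<forall>\<^sub>F w in nhds z. E w = u w * (w - z) ^ nat (zorder E z)"
      using entire_local_form[OF E] by metis
    then show ?thesis unfolding order_ge_def by (auto simp: mult.commute)
  qed
  define P where "P z = (\<Prod>n\<in>L. z - lam n)" for z
  have holP: "P holomorphic_on UNIV" unfolding P_def by (intro holomorphic_intros)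
  have ord: "order_ge (\<lambda>w. F w * P w) z (nat (zorder D z))" if z: "D z = 0" for z
  proof -
    \<comment> \<open>The multiplicity of \<open>z\<close> splits into the indices outside
      \<open>L\<close>, which are matched with eigenvalues of the second problem and are counted by
      \<open>m\<close>, and those in \<open>L\<close>, which are zeros of \<open>P\<close>.\<close>
    define m where "m = card {n \<in> - L. lam n = z}"
    have "finite {n. lam n = z} \<and> int (card {n. lam n = z}) = zorder D z"
      using lam(1) z unfolding spectrum_enum_def by blast
    then have fin: "finite {n. lam n = z}" and cd: "nat (zorder D z) = card {n. lam n = z}"
      by (metis, metis nat_int)
    have "card {n. lam n = z} = card ({n \<in> - L. lam n = z} \<union> {n \<in> L. lam n = z})"
      by (rule arg_cong[where f=card]) auto
    also have "\<dots> = m + card {n \<in> L. lam n = z}"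
      unfolding m_def using fin by (intro card_Un_disjoint) (auto intro: finite_subset)
    finally have split: "nat (zorder D z) = m + card {n \<in> L. lam n = z}" using cd by simp
    have m1: "m \<le> nat (zorder D z)" using split by simp
    \<comment> \<open>For \<open>m = 0\<close> nothing is claimed, which covers the case that
      \<open>z\<close> is no zero of \<open>D'\<close>. Otherwise a matched index shows that
      \<open>z\<close> is one, and \<open>lam'\<close> counts its order.\<close>
    have m2: "m \<le> nat (zorder D' z)"
    proof (cases "m = 0")
      case False
      then have "{n \<in> - L. lam n = z} \<noteq> {}" unfolding m_def by (metis card.empty)
      then obtain n where n: "n \<in> - L" "lam n = z" by blast
      then have "z \<in> range lam'" using f(2) by auto
      then have "D' z = 0" using lam(2) unfolding spectrum_enum_def by blast
      then have "finite {n. lam' n = z} \<and> int (card {n. lam' n = z}) = zorder D' z"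
        using lam(2) unfolding spectrum_enum_def by blast
      then have fin': "finite {n. lam' n = z}" and cd': "nat (zorder D' z) = card {n. lam' n = z}"
        by (metis, metis nat_int)
      have "m = card (f ` {n \<in> - L. lam n = z})"
        unfolding m_def using f(1) by (intro card_image[symmetric]) (auto simp: bij_betw_def intro: inj_on_subset)
      also have "\<dots> \<le> card {n. lam' n = z}" using f(2) by (intro card_mono fin') auto
      finally show ?thesis using cd' by simp
    qed simp
    have oD: "order_ge D z m" by (rule order_ge_mono[OF ordD[OF hol(1) nz(1)] m1])
    have oD': "order_ge D' z m" by (rule order_ge_mono[OF ordD[OF hol(2) nz(2)] m2])
    have "order_ge (\<lambda>w. D w * pt w) z (m + 0)" "order_ge (\<lambda>w. D w * yt w) z (m + 0)"
      "order_ge (\<lambda>w. p w * D' w) z (0 + m)" "order_ge (\<lambda>w. y w * D' w) z (0 + m)"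
      by (intro order_ge_mult oD oD' order_ge_0 cont hol)+
    then have "order_ge (\<lambda>w. A w * F w) z m" "order_ge (\<lambda>w. B w * F w) z m"
      unfolding AF BF by (auto intro!: order_ge_diff)
    then have "order_ge F z m"
      using AB[of z] order_ge_cancel[OF _ cont[OF hol(4)]] order_ge_cancel[OF _ cont[OF hol(5)]] by blast
    from order_ge_mult[OF this order_ge_prod[OF L(1), of lam z]]
    show ?thesis by (simp add: split P_def)
  qed
  have "(\<lambda>w. F w * P w) holomorphic_on UNIV" by (intro holomorphic_intros hol holP)
  from entire_quotient[OF this hol(1) nz(1) ord] obtain Q where
    Q: "Q holomorphic_on UNIV" "\<And>z. D z \<noteq> 0 \<Longrightarrow> Q z = F z * P z / D z" by blast
  show ?thesis by (rule that[OF Q(1) L(1,3), of lam]) (simp add: Q(2) P_def)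
qed

section \<open>The problem with a jump\<close>

lemma norm_sin_squared_Re_Im:
  "norm (sin z) ^ 2 = sin (Re z) ^ 2 + (exp (Im z) - inverse (exp (Im z))) ^ 2 / 4"
proof -
  have "sin z = cos (of_real pi / 2 - z)" by (rule sin_cos_eq)
  then show ?thesis
    using norm_cos_squared[of "of_real pi / 2 - z"]
    by (simp add: sin_cos_eq[of "Re z"] exp_minus power2_commute)
qed

lemma norm_cos_sin_le_cosh: "norm (cos z) \<le> cosh (Im z)" "norm (sin z) \<le> cosh (Im z)"
proof -
  have c: "(cosh (Im z))\<^sup>2 = 1 + (exp (Im z) - inverse (exp (Im z)))\<^sup>2 / 4"
    by (simp add: cosh_field_def exp_minus power2_eq_square field_simps)
  have "(norm (cos z))\<^sup>2 \<le> (cosh (Im z))\<^sup>2" "(norm (sin z))\<^sup>2 \<le> (cosh (Im z))\<^sup>2"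
    unfolding norm_cos_squared norm_sin_squared_Re_Im c by (simp_all add: abs_square_le_1)
  then show "norm (cos z) \<le> cosh (Im z)" "norm (sin z) \<le> cosh (Im z)"
    by (auto intro: power2_le_imp_le cosh_real_nonneg)
qed

lemma sinh_le_norm_cos_sin: "sinh \<bar>Im z\<bar> \<le> norm (cos z)" "sinh \<bar>Im z\<bar> \<le> norm (sin z)"
proof -
  have "(sinh (Im z))\<^sup>2 = (exp (Im z) - inverse (exp (Im z)))\<^sup>2 / 4"
    by (simp add: sinh_field_def exp_minus power_divide)
  moreover have "(sinh \<bar>Im z\<bar>)\<^sup>2 = (sinh (Im z))\<^sup>2" by (simp add: abs_if)
  ultimately have e: "(sinh \<bar>Im z\<bar>)\<^sup>2 = (exp (Im z) - inverse (exp (Im z)))\<^sup>2 / 4" by simp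
  have "(sinh \<bar>Im z\<bar>)\<^sup>2 \<le> (norm (cos z))\<^sup>2" "(sinh \<bar>Im z\<bar>)\<^sup>2 \<le> (norm (sin z))\<^sup>2"
    unfolding norm_cos_squared norm_sin_squared_Re_Im e by simp_all
  then show "sinh \<bar>Im z\<bar> \<le> norm (cos z)" "sinh \<bar>Im z\<bar> \<le> norm (sin z)"
    by (auto intro: power2_le_imp_le)
qed

text \<open>Applied on the vertical sides of the squares, where the modulus thus attains the upper
  bound \<open>cosh\<close>.\<close>

lemma norm_cos_sin_eq_cosh:
  shows "(cos (Re z))\<^sup>2 = 1 \<Longrightarrow> norm (cos z) = cosh (Im z)"
    and "(sin (Re z))\<^sup>2 = 1 \<Longrightarrow> norm (sin z) = cosh (Im z)"
proof -
  have c: "(cosh (Im z))\<^sup>2 = 1 + (exp (Im z) - inverse (exp (Im z)))\<^sup>2 / 4"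
    by (simp add: cosh_field_def exp_minus power2_eq_square field_simps)
  show "(cos (Re z))\<^sup>2 = 1 \<Longrightarrow> norm (cos z) = cosh (Im z)"
    and "(sin (Re z))\<^sup>2 = 1 \<Longrightarrow> norm (sin z) = cosh (Im z)"
    by (rule power2_eq_imp_eq; simp add: norm_cos_squared norm_sin_squared_Re_Im c)+
qed

lemma cosh_le_exp_abs: "cosh (x::real) \<le> exp \<bar>x\<bar>"
  by (simp add: cosh_field_def abs_if)

lemma norm_cos_sin_le_exp:
  assumes "s \<ge> 0"
  shows "norm (cos (\<rho> * of_real s)) \<le> exp (\<bar>Im \<rho>\<bar> * s)" "norm (sin (\<rho> * of_real s)) \<le> exp (\<bar>Im \<rho>\<bar> * s)"
  using norm_cos_sin_le_cosh[of "\<rho> * of_real s"] cosh_le_exp_abs[of "Im \<rho> * s"] assms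
  by (simp_all add: abs_mult)

lemma cosh_le_cosh:
  assumes "\<bar>x\<bar> \<le> \<bar>y :: real\<bar>" shows "cosh x \<le> cosh y"
  using assms cosh_real_nonneg_le_iff[of "\<bar>x\<bar>" "\<bar>y\<bar>"] by simp

text \<open>The data at \<open>a\<close> are known only up to an error one power of \<rho> below the
  leading part \<open>u\<close>, \<open>\<rho> * v\<close>, and may already have grown like
  \<open>exp (\<tau> * a)\<close>. In this form the estimate serves both intervals: the left one
  with the exact data 1 and \<open>h\<close>, the right one with the asymptotics carried across the
  jump.\<close>

lemma sol_asymptotics:
  fixes q :: "real \<Rightarrow> complex" and a c :: real and \<rho> u v :: complex
  defines "N \<equiv> integral {a..c} (\<lambda>t. norm (q t))" and "\<tau> \<equiv> \<bar>Im \<rho>\<bar>"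
  assumes q: "q absolutely_integrable_on {a..c}" and y: "sol (\<lambda>x. q x - \<rho>\<^sup>2) a c y p"
    and \<rho>: "norm \<rho> \<ge> 1" "norm \<rho> \<ge> 2 * N" and x: "x \<in> {a..c}"
    and init: "norm (y a - u) \<le> K0 * exp (\<tau> * a) / norm \<rho>" "norm (p a - \<rho> * v) \<le> K0 * exp (\<tau> * a)"
    and uv: "norm u \<le> M * exp (\<tau> * a)" "norm v \<le> M * exp (\<tau> * a)"
  shows "norm (y x - (u * cos (\<rho> * of_real (x - a)) + v * sin (\<rho> * of_real (x - a))))
           \<le> (4 * N * (K0 + M) + 2 * K0) * exp (\<tau> * x) / norm \<rho>"
    and "norm (p x - \<rho> * (v * cos (\<rho> * of_real (x - a)) - u * sin (\<rho> * of_real (x - a))))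
           \<le> (4 * N * (K0 + M) + 2 * K0) * exp (\<tau> * x)"
proof -
  have \<rho>0: "\<rho> \<noteq> 0" "norm \<rho> > 0" using \<rho> by auto
  have N0: "N \<ge> 0" unfolding N_def by (intro Henstock_Kurzweil_Integration.integral_nonneg absolutely_integrable_norm_on q) simp
  define E where "E = exp (\<tau> * a)"
  have E: "E > 0" by (simp add: E_def)
  have K0: "K0 \<ge> 0" using order_trans[OF norm_ge_zero init(2)] by (simp add: zero_le_mult_iff)
  define C where "C = cos (\<rho> * of_real (x - a))"
  define S where "S = sin (\<rho> * of_real (x - a))"
  define e where "e = exp (\<tau> * (x - a))"
  have Ee: "E * e = exp (\<tau> * x)" by (simp add: E_def e_def algebra_simps flip: exp_add)
  have e: "e > 0" by (simp add: e_def)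
  have CS: "norm C \<le> e" "norm S \<le> e"
    using norm_cos_sin_le_exp[of "x - a" \<rho>] x by (simp_all add: C_def S_def e_def \<tau>_def)
  note est = sol_estimate[OF q y \<rho>0(1) \<rho>(2)[unfolded N_def] x, folded N_def \<tau>_def, folded C_def S_def e_def]
  have ya: "norm \<rho> * norm (y a) \<le> K0 * E + norm \<rho> * (M * E)"
  proof -
    have "norm (y a) \<le> norm (y a - u) + norm u" by (metis norm_triangle_sub add.commute)
    also have "\<dots> \<le> K0 * E / norm \<rho> + M * E" using init uv by (auto simp: E_def)
    finally show ?thesis using \<rho>0 by (simp add: field_simps)
  qed
  have pa: "norm (p a) \<le> K0 * E + norm \<rho> * (M * E)"
  proof -
    have "norm (p a) \<le> norm (p a - \<rho> * v) + norm (\<rho> * v)" by (metis norm_triangle_sub add.commute)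
    also have "\<dots> \<le> K0 * E + norm \<rho> * (M * E)" using init(2) uv(2)
      by (auto simp: E_def norm_mult intro!: add_mono mult_left_mono)
    finally show ?thesis .
  qed
  have "norm (p a) + norm \<rho> * norm (y a) \<le> 2 * (K0 * E) + 2 * (norm \<rho> * (M * E))" using ya pa by simp
  also have "\<dots> \<le> 2 * (norm \<rho> * (K0 * E)) + 2 * (norm \<rho> * (M * E))"
    using mult_right_mono[OF \<rho>(1), of "K0 * E"] K0 E by simp
  finally have s: "norm (p a) + norm \<rho> * norm (y a) \<le> 2 * norm \<rho> * (K0 + M) * E" by (simp add: algebra_simps)
  have sN: "2 * N * (norm (p a) + norm \<rho> * norm (y a)) * e / norm \<rho> \<le> 4 * N * (K0 + M) * (E * e)"
  proof -
    have "2 * N * (norm (p a) + norm \<rho> * norm (y a)) * e / norm \<rho> \<le> 2 * N * (2 * norm \<rho> * (K0 + M) * E) * e / norm \<rho>"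
      using s N0 e by (intro divide_right_mono mult_right_mono mult_left_mono) auto
    also have "\<dots> = 4 * N * (K0 + M) * (E * e)" using \<rho>0 by (simp add: field_simps)
    finally show ?thesis .
  qed
  have "norm (p x - \<rho> * (v * C - u * S)) = norm ((p x - (p a * C - y a * \<rho> * S)) + (p a - \<rho> * v) * C - \<rho> * ((y a - u) * S))"
    by (simp add: algebra_simps)
  also have "\<dots> \<le> norm (p x - (p a * C - y a * \<rho> * S)) + norm ((p a - \<rho> * v) * C) + norm (\<rho> * ((y a - u) * S))"
    by (intro order_trans[OF norm_triangle_ineq4] add_right_mono norm_triangle_ineq)
  also have "\<dots> \<le> 4 * N * (K0 + M) * (E * e) + K0 * E * e + norm \<rho> * (K0 * E / norm \<rho> * e)"
    unfolding norm_mult using est(2) sN init CS K0 E e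
    by (intro add_mono mult_mono mult_left_mono) (auto simp: E_def)
  also have "\<dots> = (4 * N * (K0 + M) + 2 * K0) * exp (\<tau> * x)" using \<rho>0 by (simp add: algebra_simps flip: Ee)
  finally show "norm (p x - \<rho> * (v * cos (\<rho> * of_real (x - a)) - u * sin (\<rho> * of_real (x - a))))
           \<le> (4 * N * (K0 + M) + 2 * K0) * exp (\<tau> * x)" by (simp only: C_def S_def)
  have "y x - (u * C + v * S) = (y x - (y a * C + p a * S / \<rho>)) + (y a - u) * C + (p a - \<rho> * v) * S / \<rho>"
    using \<rho>0 by (simp add: field_simps)
  then have "norm (y x - (u * C + v * S)) = norm ((y x - (y a * C + p a * S / \<rho>)) + (y a - u) * C + (p a - \<rho> * v) * S / \<rho>)"
    by (rule arg_cong)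
  also have "\<dots> \<le> norm (y x - (y a * C + p a * S / \<rho>)) + norm ((y a - u) * C) + norm ((p a - \<rho> * v) * S / \<rho>)"
    by (intro order_trans[OF norm_triangle_ineq] add_right_mono norm_triangle_ineq)
  also have "\<dots> \<le> 4 * N * (K0 + M) * (E * e) / norm \<rho> + K0 * E / norm \<rho> * e + K0 * E * e / norm \<rho>"
    unfolding norm_mult norm_divide
  proof (intro add_mono mult_mono divide_right_mono)
    have "norm (y x - (y a * C + p a * S / \<rho>)) \<le> (2 * N * (norm (p a) + norm \<rho> * norm (y a)) * e / norm \<rho>) / norm \<rho>"
      using est(1) by (simp add: power2_eq_square)
    also have "\<dots> \<le> 4 * N * (K0 + M) * (E * e) / norm \<rho>" using sN by (rule divide_right_mono) simp
    finally show "norm (y x - (y a * C + p a * S / \<rho>)) \<le> 4 * N * (K0 + M) * (E * e) / norm \<rho>" .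
  qed (use init CS K0 E in \<open>auto simp: E_def\<close>)
  also have "\<dots> = (4 * N * (K0 + M) + 2 * K0) * exp (\<tau> * x) / norm \<rho>"
    by (simp add: algebra_simps add_divide_distrib flip: Ee)
  finally show "norm (y x - (u * cos (\<rho> * of_real (x - a)) + v * sin (\<rho> * of_real (x - a))))
           \<le> (4 * N * (K0 + M) + 2 * K0) * exp (\<tau> * x) / norm \<rho>" by (simp only: C_def S_def)
qed

text \<open>\<open>(Y1, P1)\<close> and \<open>(Y2, P2)\<close> are the parts of \<open>(\<phi>, \<phi>')\<close> to the left and to the right of \<open>d\<close>,
  each extended to \<open>d\<close> by its one-sided limit.\<close>

locale jump_problem =
  fixes q :: "real \<Rightarrow> complex" and h \<gamma> :: complex and \<beta> d c :: real
    and Y1 P1 Y2 P2 :: "complex \<Rightarrow> real \<Rightarrow> complex"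
  assumes d: "0 < d" "d < c" and q: "q absolutely_integrable_on {0..c}" and \<beta>: "\<beta> > 0"
    and sol1: "\<And>\<mu>. sol (\<lambda>x. q x - \<mu>) 0 d (Y1 \<mu>) (P1 \<mu>)"
    and init1: "\<And>\<mu>. Y1 \<mu> 0 = 1" "\<And>\<mu>. P1 \<mu> 0 = h"
    and sol2: "\<And>\<mu>. sol (\<lambda>x. q x - \<mu>) d c (Y2 \<mu>) (P2 \<mu>)"
    and init2: "\<And>\<mu>. Y2 \<mu> d = \<beta> * Y1 \<mu> d" "\<And>\<mu>. P2 \<mu> d = P1 \<mu> d / \<beta> + \<gamma> * Y1 \<mu> d"
begin

text \<open>Amplitudes of the transmitted and reflected waves: with \<open>A = \<rho> d\<close> and
  \<open>B = \<rho> (x - d)\<close>, the leading term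
  \<open>\<beta> cos A cos B - sin A sin B / \<beta>\<close> equals
  \<open>ap cos (A + B) + am cos (A - B)\<close>.\<close>

definition ap :: real where "ap = (\<beta> + 1 / \<beta>) / 2"
definition am :: real where "am = (\<beta> - 1 / \<beta>) / 2"

text \<open>Here the sign of \<beta> enters: the reflected wave cannot cancel the transmitted one,
  and the lower bounds on the squares rest on this gap.\<close>

lemma am_less_ap: "\<bar>am\<bar> < ap"
  using \<beta> by (simp add: ap_def am_def abs_less_iff)

lemma q1: "q absolutely_integrable_on {0..d}" and q2: "q absolutely_integrable_on {d..c}"
  using d by (auto intro!: absolutely_integrable_on_subinterval[OF q])

sublocale f1: sol_family q 0 d Y1 P1
  by unfold_locales (use d q1 sol1 init1 in auto)

sublocale f2: sol_family q d c Y2 P2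
  by unfold_locales
    (use d q2 sol2 \<beta> in \<open>auto simp: init2 intro!: holomorphic_intros f1.holomorphic\<close>)

lemma asymptotics:
  obtains K R where "R \<ge> 1" "K \<ge> 0"
    "\<And>(\<rho>::complex) (x::real). norm \<rho> \<ge> R \<Longrightarrow> x \<in> {0..d} \<Longrightarrow>
       norm (Y1 (\<rho>\<^sup>2) x - cos (\<rho> * of_real x)) \<le> K * exp (\<bar>Im \<rho>\<bar> * x) / norm \<rho>"
    "\<And>(\<rho>::complex) (x::real). norm \<rho> \<ge> R \<Longrightarrow> x \<in> {0..d} \<Longrightarrow>
       norm (P1 (\<rho>\<^sup>2) x + \<rho> * sin (\<rho> * of_real x)) \<le> K * exp (\<bar>Im \<rho>\<bar> * x)"
    "\<And>(\<rho>::complex) (x::real). norm \<rho> \<ge> R \<Longrightarrow> x \<in> {d..c} \<Longrightarrow>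
       norm (Y2 (\<rho>\<^sup>2) x - (ap * cos (\<rho> * of_real x) + am * cos (\<rho> * of_real (2 * d - x)))) \<le> K * exp (\<bar>Im \<rho>\<bar> * x) / norm \<rho>"
    "\<And>(\<rho>::complex) (x::real). norm \<rho> \<ge> R \<Longrightarrow> x \<in> {d..c} \<Longrightarrow>
       norm (P2 (\<rho>\<^sup>2) x + \<rho> * (ap * sin (\<rho> * of_real x) - am * sin (\<rho> * of_real (2 * d - x)))) \<le> K * exp (\<bar>Im \<rho>\<bar> * x)"
proof -
  define N1 where "N1 = integral {0..d} (\<lambda>t. norm (q t))"
  define N2 where "N2 = integral {d..c} (\<lambda>t. norm (q t))"
  have N0: "N1 \<ge> 0" "N2 \<ge> 0" unfolding N1_def N2_def
    by (intro Henstock_Kurzweil_Integration.integral_nonneg absolutely_integrable_norm_on q1 q2; simp)+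
  define K1 where "K1 = 4 * N1 * (norm h + 1) + 2 * norm h"
  \<comment> \<open>The sum of the errors after the jump: \<open>\<beta> * K1\<close> for the
    function, the bracket for the derivative. The coefficient \<gamma> enters only the error because
    \<open>\<gamma> * y\<close> is one power of \<rho> smaller than the derivative.\<close>
  define K0 where "K0 = \<beta> * K1 + (K1 / \<beta> + norm \<gamma> * (1 + K1))"
  define M where "M = \<beta> + 1 / \<beta>"
  define K2 where "K2 = 4 * N2 * (K0 + M) + 2 * K0"
  define R where "R = max 1 (max (2 * N1) (2 * N2))"
  have K1: "K1 \<ge> 0" using N0 by (simp add: K1_def)
  have M0: "M \<ge> 0" using \<beta> by (simp add: M_def)
  have K0: "K0 \<ge> 0" using K1 \<beta> by (simp add: K0_def)
  have K2: "K2 \<ge> 0" using N0 K0 M0 by (simp add: K2_def)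
  have R: "norm \<rho> \<ge> 1" "norm \<rho> \<ge> 2 * N1" "norm \<rho> \<ge> 2 * N2" if "norm \<rho> \<ge> R" for \<rho> :: complex
    using that by (auto simp: R_def)
  have A1: "norm (Y1 (\<rho>\<^sup>2) x - cos (\<rho> * of_real x)) \<le> K1 * exp (\<bar>Im \<rho>\<bar> * x) / norm \<rho>"
    and A2: "norm (P1 (\<rho>\<^sup>2) x + \<rho> * sin (\<rho> * of_real x)) \<le> K1 * exp (\<bar>Im \<rho>\<bar> * x)"
    if \<rho>: "norm \<rho> \<ge> R" and x: "x \<in> {0..d}" for \<rho> :: complex and x
    using sol_asymptotics[OF q1 sol1 R(1)[OF \<rho>] R(2)[OF \<rho>, unfolded N1_def] x, where u=1 and v=0 and ?K0.0="norm h" and M=1]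
    by (simp_all add: init1 K1_def N1_def)
  have A34: "norm (Y2 (\<rho>\<^sup>2) x - (ap * cos (\<rho> * of_real x) + am * cos (\<rho> * of_real (2 * d - x)))) \<le> K2 * exp (\<bar>Im \<rho>\<bar> * x) / norm \<rho> \<and>
    norm (P2 (\<rho>\<^sup>2) x + \<rho> * (ap * sin (\<rho> * of_real x) - am * sin (\<rho> * of_real (2 * d - x)))) \<le> K2 * exp (\<bar>Im \<rho>\<bar> * x)"
    if \<rho>: "norm \<rho> \<ge> R" and x: "x \<in> {d..c}" for \<rho> :: complex and x
  proof -
    have dd: "d \<in> {0..d}" using d by simp
    define A where "A = \<rho> * of_real d"
    define B where "B = \<rho> * of_real (x - d)"
    define E where "E = exp (\<bar>Im \<rho>\<bar> * d)"
    \<comment> \<open>\<open>u\<close> and \<open>\<rho> * v\<close> are the leading parts of the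
      data to the right of \<open>d\<close>; both amplitudes are at most
      \<open>M = \<beta> + 1 / \<beta>\<close>.\<close>
    define u where "u = \<beta> * cos A"
    define v where "v = - sin A / \<beta>"
    have r1: "norm \<rho> \<ge> 1" by (rule R(1)[OF \<rho>])
    have E: "E > 0" by (simp add: E_def)
    have cs: "norm (cos A) \<le> E" "norm (sin A) \<le> E" using norm_cos_sin_le_exp[of d \<rho>] d by (simp_all add: A_def E_def)
    have Y1d: "norm (Y1 (\<rho>\<^sup>2) d) \<le> (1 + K1) * E"
    proof -
      have "norm (Y1 (\<rho>\<^sup>2) d) \<le> norm (cos A) + norm (Y1 (\<rho>\<^sup>2) d - cos A)" by (rule norm_triangle_sub)
      also have "\<dots> \<le> E + K1 * E / norm \<rho>" using cs A1[OF \<rho> dd] by (intro add_mono) (auto simp: A_def E_def)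
      also have "\<dots> \<le> E + K1 * E"
      proof -
        have "K1 * E / norm \<rho> \<le> K1 * E / 1" using r1 K1 E by (intro divide_left_mono) auto
        then show ?thesis by simp
      qed
      finally show ?thesis by (simp add: algebra_simps)
    qed
    have iY: "norm (Y2 (\<rho>\<^sup>2) d - u) \<le> K0 * exp (\<bar>Im \<rho>\<bar> * d) / norm \<rho>"
    proof -
      have "norm (Y2 (\<rho>\<^sup>2) d - u) = \<beta> * norm (Y1 (\<rho>\<^sup>2) d - cos A)"
        using \<beta> by (simp add: init2 u_def norm_mult flip: right_diff_distrib)
      also have "\<dots> \<le> \<beta> * (K1 * E / norm \<rho>)" using A1[OF \<rho> dd] \<beta> by (intro mult_left_mono) (auto simp: A_def E_def)
      also have "\<dots> = \<beta> * K1 * (E / norm \<rho>)" by simp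
      also have "\<dots> \<le> K0 * (E / norm \<rho>)" using K1 \<beta> E by (intro mult_right_mono) (auto simp: K0_def)
      finally show ?thesis by (simp add: E_def)
    qed
    have iP: "norm (P2 (\<rho>\<^sup>2) d - \<rho> * v) \<le> K0 * exp (\<bar>Im \<rho>\<bar> * d)"
    proof -
      have "P2 (\<rho>\<^sup>2) d - \<rho> * v = (P1 (\<rho>\<^sup>2) d + \<rho> * sin A) / \<beta> + \<gamma> * Y1 (\<rho>\<^sup>2) d"
        by (simp add: init2 v_def add_divide_distrib)
      also have "norm \<dots> \<le> norm (P1 (\<rho>\<^sup>2) d + \<rho> * sin A) / \<beta> + norm \<gamma> * norm (Y1 (\<rho>\<^sup>2) d)"
        using \<beta> by (intro order_trans[OF norm_triangle_ineq]) (simp add: norm_mult norm_divide)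
      also have "\<dots> \<le> K1 * E / \<beta> + norm \<gamma> * ((1 + K1) * E)"
        using A2[OF \<rho> dd] \<beta> Y1d by (intro add_mono divide_right_mono mult_left_mono) (auto simp: A_def E_def)
      also have "\<dots> = (K1 / \<beta> + norm \<gamma> * (1 + K1)) * E" by (simp add: algebra_simps)
      also have "\<dots> \<le> K0 * E" using K1 \<beta> E by (intro mult_right_mono) (auto simp: K0_def)
      finally show ?thesis by (simp add: E_def)
    qed
    have uM: "norm u \<le> M * exp (\<bar>Im \<rho>\<bar> * d)" and vM: "norm v \<le> M * exp (\<bar>Im \<rho>\<bar> * d)"
      unfolding E_def[symmetric] u_def v_def norm_mult norm_divide norm_minus_cancel M_def
      using cs \<beta> E mult_mono[of \<beta> "\<beta> + 1/\<beta>" "norm (cos A)" E] mult_mono[of "1/\<beta>" "\<beta> + 1/\<beta>" "norm (sin A)" E] by simp_all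
    note est = sol_asymptotics[OF q2 sol2 R(1)[OF \<rho>] R(3)[OF \<rho>, unfolded N2_def] x iY iP uM vM, folded N2_def, folded K2_def B_def]
    have AB: "A + B = \<rho> * of_real x" "A - B = \<rho> * of_real (2 * d - x)" by (simp_all add: A_def B_def algebra_simps)
    have main: "u * cos B + v * sin B = ap * cos (A + B) + am * cos (A - B)"
      "v * cos B - u * sin B = - (ap * sin (A + B) - am * sin (A - B))"
      using \<beta> unfolding u_def v_def ap_def am_def cos_add cos_diff sin_add sin_diff by (simp_all add: field_simps)
    show ?thesis using est unfolding main AB by (simp add: algebra_simps)
  qed
  define K where "K = max K1 K2"
  have le: "K1 * exp t \<le> K * exp t" "K2 * exp t \<le> K * exp t" for t :: real by (auto simp: K_def)
  have B1: "norm (Y1 (\<rho>\<^sup>2) x - cos (\<rho> * of_real x)) \<le> K * exp (\<bar>Im \<rho>\<bar> * x) / norm \<rho>"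
   and B2: "norm (P1 (\<rho>\<^sup>2) x + \<rho> * sin (\<rho> * of_real x)) \<le> K * exp (\<bar>Im \<rho>\<bar> * x)"
    if "norm \<rho> \<ge> R" "x \<in> {0..d}" for \<rho> :: complex and x :: real
    using A1[OF that] A2[OF that] le by (meson divide_right_mono norm_ge_zero order_trans)+
  have B3: "norm (Y2 (\<rho>\<^sup>2) x - (ap * cos (\<rho> * of_real x) + am * cos (\<rho> * of_real (2 * d - x)))) \<le> K * exp (\<bar>Im \<rho>\<bar> * x) / norm \<rho>"
   and B4: "norm (P2 (\<rho>\<^sup>2) x + \<rho> * (ap * sin (\<rho> * of_real x) - am * sin (\<rho> * of_real (2 * d - x)))) \<le> K * exp (\<bar>Im \<rho>\<bar> * x)"
    if "norm \<rho> \<ge> R" "x \<in> {d..c}" for \<rho> :: complex and x :: real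
    using A34[OF that] le by (meson divide_right_mono norm_ge_zero order_trans)+
  have "R \<ge> 1" "K \<ge> 0" using K1 by (simp_all add: R_def K_def)
  then show ?thesis using B1 B2 B3 B4 by (rule that)
qed

end

text \<open>If \<open>c1\<close> attains \<open>cosh t\<close>, the gap
  \<open>a - \<bar>b\<bar>\<close> alone suffices. If only \<open>sinh t\<close> is available, the
  threshold for \<open>t\<close> together with \<open>exp (2 * t) \<ge> 2 * t\<close> makes
  \<open>(a + \<bar>b\<bar>) * exp (- t)\<close> at most half of
  \<open>(a - \<bar>b\<bar>) * exp t\<close>.\<close>

lemma exp_le_combination:
  fixes a b :: real and c1 c2 :: complex
  assumes ab: "\<bar>b\<bar> < a" and t: "t \<ge> 0" and c2: "norm c2 \<le> cosh t"
    and c1: "norm c1 \<ge> cosh t \<or> norm c1 \<ge> sinh t \<and> t \<ge> (a + \<bar>b\<bar>) / (a - \<bar>b\<bar>)"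
  shows "(a - \<bar>b\<bar>) / 4 * exp t \<le> norm (of_real a * c1 + of_real b * c2)"
proof -
  have "norm (of_real a * c1) - norm (of_real b * c2) \<le> norm (of_real a * c1 + of_real b * c2)"
    by (rule norm_diff_ineq)
  then have ge: "a * norm c1 - \<bar>b\<bar> * cosh t \<le> norm (of_real a * c1 + of_real b * c2)"
    using ab mult_left_mono[OF c2, of "\<bar>b\<bar>"] by (simp add: norm_mult)
  have a: "a > 0" using ab by simp
  show ?thesis
  proof (cases "norm c1 \<ge> cosh t")
    case True
    have "exp t / 4 \<le> cosh t"
      using exp_gt_zero[of t] exp_gt_zero[of "- t"] unfolding cosh_field_def by (simp add: field_simps del: exp_gt_zero)
    from mult_left_mono[OF this, of "a - \<bar>b\<bar>"]
    have "(a - \<bar>b\<bar>) / 4 * exp t \<le> (a - \<bar>b\<bar>) * cosh t" using ab by simp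
    also have "\<dots> \<le> a * norm c1 - \<bar>b\<bar> * cosh t"
      using mult_left_mono[OF True, of a] a by (simp add: algebra_simps)
    finally show ?thesis using ge by simp
  next
    case False
    then have s: "norm c1 \<ge> sinh t" and t0: "t \<ge> (a + \<bar>b\<bar>) / (a - \<bar>b\<bar>)" using c1 by auto
    have "exp t * exp t \<ge> 2 * t" using exp_ge_add_one_self[of "2 * t"] by (simp add: exp_double power2_eq_square)
    moreover have "(a - \<bar>b\<bar>) * t \<ge> a + \<bar>b\<bar>" using t0 ab by (simp add: pos_divide_le_eq mult.commute)
    moreover have "(a - \<bar>b\<bar>) * (exp t * exp t) \<ge> (a - \<bar>b\<bar>) * (2 * t)"
      using calculation(1) ab by (intro mult_left_mono) auto
    ultimately have "2 * (a + \<bar>b\<bar>) \<le> (a - \<bar>b\<bar>) * (exp t * exp t)" by simp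
    from mult_right_mono[OF this, of "exp (- t)"]
    have "2 * (a + \<bar>b\<bar>) * exp (- t) \<le> (a - \<bar>b\<bar>) * exp t" by (simp add: mult.assoc flip: exp_add)
    then have h: "2 * ((a + \<bar>b\<bar>) * exp (- t)) \<le> (a - \<bar>b\<bar>) * exp t" by (simp only: mult.assoc)
    have "a * sinh t - \<bar>b\<bar> * cosh t = ((a - \<bar>b\<bar>) * exp t) / 2 - ((a + \<bar>b\<bar>) * exp (- t)) / 2"
      by (simp add: cosh_field_def sinh_field_def algebra_simps add_divide_distrib diff_divide_distrib)
    moreover have "x / 4 \<le> x / 2 - y / 2" if "2 * y \<le> x" for x y :: real
      using that by simp
    ultimately have "(a - \<bar>b\<bar>) / 4 * exp t \<le> a * sinh t - \<bar>b\<bar> * cosh t"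
      using h by (metis times_divide_eq_left)
    also have "\<dots> \<le> a * norm c1 - \<bar>b\<bar> * cosh t" using mult_left_mono[OF s, of a] a by simp
    finally show ?thesis using ge by simp
  qed
qed

text \<open>Supplies the alternatives of \<open>exp_le_combination\<close>: vertical sides give
  \<open>cosh\<close> because the condition on \<open>r * X\<close> makes the real part extremal,
  horizontal sides give \<open>sinh\<close> with a large argument.\<close>

lemma on_square_cos_sin:
  fixes \<rho> :: complex and r s X t :: real
  assumes sq: "on_square r \<rho>" and X: "X > 0" and s: "\<bar>s\<bar> \<le> X" and r: "r * X \<ge> t"
  shows "(cos (r * X))\<^sup>2 = 1 \<Longrightarrow> norm (cos (\<rho> * of_real X)) \<ge> cosh (\<bar>Im \<rho>\<bar> * X) \<or>
           norm (cos (\<rho> * of_real X)) \<ge> sinh (\<bar>Im \<rho>\<bar> * X) \<and> \<bar>Im \<rho>\<bar> * X \<ge> t"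
    and "(sin (r * X))\<^sup>2 = 1 \<Longrightarrow> norm (sin (\<rho> * of_real X)) \<ge> cosh (\<bar>Im \<rho>\<bar> * X) \<or>
           norm (sin (\<rho> * of_real X)) \<ge> sinh (\<bar>Im \<rho>\<bar> * X) \<and> \<bar>Im \<rho>\<bar> * X \<ge> t"
    and "norm (cos (\<rho> * of_real s)) \<le> cosh (\<bar>Im \<rho>\<bar> * X)"
    and "norm (sin (\<rho> * of_real s)) \<le> cosh (\<bar>Im \<rho>\<bar> * X)"
proof -
  have ch: "cosh (\<bar>Im \<rho>\<bar> * X) = cosh (Im \<rho> * X)" by (simp add: abs_if)
  have sh: "sinh (\<bar>Im \<rho>\<bar> * X) = sinh \<bar>Im (\<rho> * of_real X)\<bar>" using X by (simp add: abs_mult)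
  consider "\<bar>Re \<rho>\<bar> = r" | "\<bar>Im \<rho>\<bar> = r" using sq unfolding on_square_def by linarith
  note cases = this
  show "norm (cos (\<rho> * of_real X)) \<ge> cosh (\<bar>Im \<rho>\<bar> * X) \<or>
           norm (cos (\<rho> * of_real X)) \<ge> sinh (\<bar>Im \<rho>\<bar> * X) \<and> \<bar>Im \<rho>\<bar> * X \<ge> t" if c: "(cos (r * X))\<^sup>2 = 1"
  proof (cases rule: cases)
    case 1
    then have "cos (Re (\<rho> * of_real X)) = cos (r * X)" by (auto simp: abs_if split: if_splits)
    then show ?thesis using norm_cos_sin_eq_cosh(1)[of "\<rho> * of_real X"] c by (simp add: ch)
  next
    case 2
    have "sinh (\<bar>Im \<rho>\<bar> * X) \<le> norm (cos (\<rho> * of_real X))"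
      unfolding sh by (rule sinh_le_norm_cos_sin)
    then show ?thesis using r 2 by simp
  qed
  show "norm (sin (\<rho> * of_real X)) \<ge> cosh (\<bar>Im \<rho>\<bar> * X) \<or>
           norm (sin (\<rho> * of_real X)) \<ge> sinh (\<bar>Im \<rho>\<bar> * X) \<and> \<bar>Im \<rho>\<bar> * X \<ge> t" if c: "(sin (r * X))\<^sup>2 = 1"
  proof (cases rule: cases)
    case 1
    then have "(sin (Re (\<rho> * of_real X)))\<^sup>2 = (sin (r * X))\<^sup>2" by (auto simp: abs_if split: if_splits)
    then show ?thesis using norm_cos_sin_eq_cosh(2)[of "\<rho> * of_real X"] c by (simp add: ch)
  next
    case 2
    have "sinh (\<bar>Im \<rho>\<bar> * X) \<le> norm (sin (\<rho> * of_real X))"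
      unfolding sh by (rule sinh_le_norm_cos_sin)
    then show ?thesis using r 2 by simp
  qed
  have "cosh (Im (\<rho> * of_real s)) \<le> cosh (\<bar>Im \<rho>\<bar> * X)"
    using s X by (intro cosh_le_cosh) (auto simp: abs_mult intro!: mult_left_mono)
  then show "norm (cos (\<rho> * of_real s)) \<le> cosh (\<bar>Im \<rho>\<bar> * X)" "norm (sin (\<rho> * of_real s)) \<le> cosh (\<bar>Im \<rho>\<bar> * X)"
    using norm_cos_sin_le_cosh[of "\<rho> * of_real s"] by linarith+
qed

lemma norm_ge_half_of_approximation:
  fixes y m :: complex
  assumes "2 * c * E \<le> norm m" "norm (y - m) \<le> e" "e \<le> c * E"
  shows "c * E \<le> norm y"
  using assms norm_triangle_sub[of m y] by (simp add: norm_minus_commute)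

section \<open>Upper bounds, and lower bounds on the squares\<close>

context jump_problem
begin

lemma upper_bounds:
  obtains K R where "R \<ge> 1" "K \<ge> 0"
    "\<And>(\<rho>::complex) (x::real). norm \<rho> \<ge> R \<Longrightarrow> x \<in> {0..d} \<Longrightarrow> norm (Y1 (\<rho>\<^sup>2) x) \<le> K * exp (\<bar>Im \<rho>\<bar> * x)"
    "\<And>(\<rho>::complex) (x::real). norm \<rho> \<ge> R \<Longrightarrow> x \<in> {d..c} \<Longrightarrow> norm (Y2 (\<rho>\<^sup>2) x) \<le> K * exp (\<bar>Im \<rho>\<bar> * x)"
    "\<And>(\<rho>::complex) (x::real). norm \<rho> \<ge> R \<Longrightarrow> x \<in> {d..c} \<Longrightarrow> norm (P2 (\<rho>\<^sup>2) x) \<le> K * norm \<rho> * exp (\<bar>Im \<rho>\<bar> * x)"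
proof -
  obtain K R where R: "R \<ge> 1" and K: "K \<ge> 0" and A1:
    "\<And>(\<rho>::complex) (x::real). norm \<rho> \<ge> R \<Longrightarrow> x \<in> {0..d} \<Longrightarrow>
       norm (Y1 (\<rho>\<^sup>2) x - cos (\<rho> * of_real x)) \<le> K * exp (\<bar>Im \<rho>\<bar> * x) / norm \<rho>" and A3:
    "\<And>(\<rho>::complex) (x::real). norm \<rho> \<ge> R \<Longrightarrow> x \<in> {d..c} \<Longrightarrow>
       norm (Y2 (\<rho>\<^sup>2) x - (ap * cos (\<rho> * of_real x) + am * cos (\<rho> * of_real (2 * d - x)))) \<le> K * exp (\<bar>Im \<rho>\<bar> * x) / norm \<rho>" and A4:
    "\<And>(\<rho>::complex) (x::real). norm \<rho> \<ge> R \<Longrightarrow> x \<in> {d..c} \<Longrightarrow>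
       norm (P2 (\<rho>\<^sup>2) x + \<rho> * (ap * sin (\<rho> * of_real x) - am * sin (\<rho> * of_real (2 * d - x)))) \<le> K * exp (\<bar>Im \<rho>\<bar> * x)"
    using asymptotics by metis
  define M where "M = K + (1 + ap + \<bar>am\<bar>)"
  have ap: "ap > 0" using am_less_ap by simp
  have le: "K * E / norm \<rho> + L * E \<le> M * E"
    if "norm \<rho> \<ge> R" "E \<ge> 0" "L \<le> 1 + ap + \<bar>am\<bar>" for E L :: real and \<rho> :: complex
  proof -
    have "K * E / norm \<rho> \<le> K * E / 1" using that R K by (intro divide_left_mono) auto
    moreover have "L * E \<le> (1 + ap + \<bar>am\<bar>) * E" using that by (intro mult_right_mono) auto
    ultimately show ?thesis by (simp add: M_def algebra_simps)
  qed
  have tri: "norm y \<le> e1 + e2" if "norm (y - m) \<le> e1" "norm m \<le> e2" for y m :: complex and e1 e2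
    using norm_triangle_sub[of y m] that by simp
  show ?thesis
  proof (rule that[of R M])
    show "R \<ge> 1" by (rule R)
    show "M \<ge> 0" using K ap by (simp add: M_def)
  next
    fix \<rho> :: complex and x :: real assume \<rho>: "norm \<rho> \<ge> R" and x: "x \<in> {0..d}"
    have "norm (cos (\<rho> * of_real x)) \<le> 1 * exp (\<bar>Im \<rho>\<bar> * x)" using norm_cos_sin_le_exp(1)[of x \<rho>] x by simp
    from tri[OF A1[OF \<rho> x] this] show "norm (Y1 (\<rho>\<^sup>2) x) \<le> M * exp (\<bar>Im \<rho>\<bar> * x)"
      by (rule order_trans) (rule le[OF \<rho>], use ap in auto)
  next
    fix \<rho> :: complex and x :: real assume \<rho>: "norm \<rho> \<ge> R" and x: "x \<in> {d..c}"
    define E where "E = exp (\<bar>Im \<rho>\<bar> * x)"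
    have sx: "norm (cos (\<rho> * of_real s)) \<le> E \<and> norm (sin (\<rho> * of_real s)) \<le> E" if "\<bar>s\<bar> \<le> x" for s
    proof -
      have "cosh (Im (\<rho> * of_real s)) \<le> cosh (\<bar>Im \<rho>\<bar> * x)"
        using that by (intro cosh_le_cosh) (auto simp: abs_mult intro!: mult_left_mono)
      also have "\<dots> \<le> E" using cosh_le_exp_abs[of "\<bar>Im \<rho>\<bar> * x"] x d by (simp add: E_def abs_mult)
      finally show ?thesis using norm_cos_sin_le_cosh[of "\<rho> * of_real s"] by linarith
    qed
    have s: "\<bar>x\<bar> \<le> x" "\<bar>2 * d - x\<bar> \<le> x" using x d by auto
    have comb: "norm (of_real ap * u + of_real am * v) \<le> (ap + \<bar>am\<bar>) * E" "norm (of_real ap * u - of_real am * v) \<le> (ap + \<bar>am\<bar>) * E"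
      if "norm u \<le> E" "norm v \<le> E" for u v :: complex
    proof -
      have "norm (of_real ap * u) \<le> ap * E" "norm (of_real am * v) \<le> \<bar>am\<bar> * E"
        using that ap by (auto simp: norm_mult intro!: mult_left_mono)
      then show "norm (of_real ap * u + of_real am * v) \<le> (ap + \<bar>am\<bar>) * E" "norm (of_real ap * u - of_real am * v) \<le> (ap + \<bar>am\<bar>) * E"
        using norm_triangle_ineq[of "of_real ap * u" "of_real am * v"] norm_triangle_ineq4[of "of_real ap * u" "of_real am * v"]
        unfolding distrib_right by linarith+
    qed
    have "norm (ap * cos (\<rho> * of_real x) + am * cos (\<rho> * of_real (2 * d - x))) \<le> (ap + \<bar>am\<bar>) * exp (\<bar>Im \<rho>\<bar> * x)"
      unfolding E_def[symmetric] by (rule comb(1)) (use sx s in blast)+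
    from tri[OF A3[OF \<rho> x] this] show "norm (Y2 (\<rho>\<^sup>2) x) \<le> M * exp (\<bar>Im \<rho>\<bar> * x)"
      by (rule order_trans) (rule le[OF \<rho>], auto)
    have m: "norm (- (\<rho> * (ap * sin (\<rho> * of_real x) - am * sin (\<rho> * of_real (2 * d - x))))) \<le> norm \<rho> * ((ap + \<bar>am\<bar>) * E)"
      unfolding norm_minus_cancel norm_mult by (intro mult_left_mono comb(2)) (use sx s in blast, use sx s in blast, simp)
    have "norm (P2 (\<rho>\<^sup>2) x) \<le> K * E + norm \<rho> * ((ap + \<bar>am\<bar>) * E)"
      by (rule tri[OF _ m]) (use A4[OF \<rho> x] in \<open>simp add: E_def\<close>)
    also have "\<dots> = norm \<rho> * (K * E / norm \<rho> + (ap + \<bar>am\<bar>) * E)" using \<rho> R by (auto simp: distrib_left)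
    also have "\<dots> \<le> norm \<rho> * (M * E)" by (intro mult_left_mono le[OF \<rho>]) (auto simp: E_def)
    finally show "norm (P2 (\<rho>\<^sup>2) x) \<le> M * norm \<rho> * exp (\<bar>Im \<rho>\<bar> * x)" by (simp add: E_def algebra_simps)
  qed
qed

lemma lower_bound_Y1:
  obtains k R where "k > 0" "R \<ge> 1"
    "\<And>\<rho> r. on_square r \<rho> \<Longrightarrow> r \<ge> R \<Longrightarrow> (cos (r * d))\<^sup>2 = 1 \<Longrightarrow> k * exp (\<bar>Im \<rho>\<bar> * d) \<le> norm (Y1 (\<rho>\<^sup>2) d)"
proof -
  obtain K R where R: "R \<ge> 1" and K: "K \<ge> 0" and A1:
    "\<And>(\<rho>::complex) (x::real). norm \<rho> \<ge> R \<Longrightarrow> x \<in> {0..d} \<Longrightarrow>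
       norm (Y1 (\<rho>\<^sup>2) x - cos (\<rho> * of_real x)) \<le> K * exp (\<bar>Im \<rho>\<bar> * x) / norm \<rho>"
    using asymptotics by metis
  \<comment> \<open>\<open>1 / d\<close> gives \<open>r * d \<ge> 1\<close>, the threshold of
    \<open>exp_le_combination\<close> for \<open>a = 1\<close>, \<open>b = 0\<close>;
    \<open>8 * K\<close> pushes the error below \<open>1 / 8\<close>, half of the main bound
    \<open>1 / 4\<close>.\<close>
  define R' where "R' = max R (max (1 / d) (8 * K))"
  show ?thesis
  proof (rule that[of "1 / 8" R'])
    fix \<rho> r assume sq: "on_square r \<rho>" and r: "r \<ge> R'" and cr: "(cos (r * d))\<^sup>2 = 1"
    have \<rho>: "norm \<rho> \<ge> R" "norm \<rho> \<ge> 8 * K" "norm \<rho> \<ge> 1" using norm_ge_on_square[OF sq] r R by (auto simp: R'_def)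
    have rd: "r * d \<ge> 1" using r d by (simp add: R'_def pos_divide_le_eq)
    have "(1 - \<bar>0\<bar>) / 4 * exp (\<bar>Im \<rho>\<bar> * d) \<le> norm (of_real 1 * cos (\<rho> * of_real d) + of_real 0 * (0::complex))"
      using on_square_cos_sin(1)[OF sq d(1) _ rd cr, of 0] d by (intro exp_le_combination) auto
    then have "2 * (1 / 8) * exp (\<bar>Im \<rho>\<bar> * d) \<le> norm (cos (\<rho> * of_real d))" by simp
    then show "1 / 8 * exp (\<bar>Im \<rho>\<bar> * d) \<le> norm (Y1 (\<rho>\<^sup>2) d)"
    proof (rule norm_ge_half_of_approximation[OF _ A1[OF \<rho>(1)]])
      show "K * exp (\<bar>Im \<rho>\<bar> * d) / norm \<rho> \<le> 1 / 8 * exp (\<bar>Im \<rho>\<bar> * d)"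
        using \<rho> by (simp add: divide_le_eq mult_right_mono)
    qed (use d in auto)
  qed (use R in \<open>auto simp: R'_def\<close>)
qed

lemma lower_bound_Y2:
  assumes X: "X \<in> {d..c}"
  obtains k R where "k > 0" "R \<ge> 1"
    "\<And>\<rho> r. on_square r \<rho> \<Longrightarrow> r \<ge> R \<Longrightarrow> (cos (r * X))\<^sup>2 = 1 \<Longrightarrow> k * exp (\<bar>Im \<rho>\<bar> * X) \<le> norm (Y2 (\<rho>\<^sup>2) X)"
proof -
  obtain K R where R: "R \<ge> 1" and K: "K \<ge> 0" and A3:
    "\<And>(\<rho>::complex) (x::real). norm \<rho> \<ge> R \<Longrightarrow> x \<in> {d..c} \<Longrightarrow>
       norm (Y2 (\<rho>\<^sup>2) x - (ap * cos (\<rho> * of_real x) + am * cos (\<rho> * of_real (2 * d - x)))) \<le> K * exp (\<bar>Im \<rho>\<bar> * x) / norm \<rho>"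
    using asymptotics by metis
  define k where "k = (ap - \<bar>am\<bar>) / 8"
  have k: "k > 0" using am_less_ap by (simp add: k_def)
  have X0: "X > 0" using X d by simp
  define t where "t = (ap + \<bar>am\<bar>) / (ap - \<bar>am\<bar>)"
  define R' where "R' = max R (max (t / X) (K / k))"
  show ?thesis
  proof (rule that[of k R'])
    fix \<rho> r assume sq: "on_square r \<rho>" and r: "r \<ge> R'" and cr: "(cos (r * X))\<^sup>2 = 1"
    have \<rho>: "norm \<rho> \<ge> R" "norm \<rho> \<ge> K / k" "norm \<rho> \<ge> 1" using norm_ge_on_square[OF sq] r R by (auto simp: R'_def)
    have rX: "r * X \<ge> t" using r X0 by (simp add: R'_def pos_divide_le_eq)
    have s: "\<bar>2 * d - X\<bar> \<le> X" using X d by auto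
    have "2 * k * exp (\<bar>Im \<rho>\<bar> * X) = (ap - \<bar>am\<bar>) / 4 * exp (\<bar>Im \<rho>\<bar> * X)" by (simp add: k_def)
    also have "\<dots> \<le> norm (of_real ap * cos (\<rho> * of_real X) + of_real am * cos (\<rho> * of_real (2 * d - X)))"
      using on_square_cos_sin(1,3)[OF sq X0 s rX] cr X0 am_less_ap
      by (intro exp_le_combination) (auto simp: t_def)
    finally show "k * exp (\<bar>Im \<rho>\<bar> * X) \<le> norm (Y2 (\<rho>\<^sup>2) X)"
    proof (rule norm_ge_half_of_approximation[OF _ A3[OF \<rho>(1) X]])
      have "K \<le> k * norm \<rho>" using \<rho>(2) k by (simp add: divide_le_eq mult.commute)
      then show "K * exp (\<bar>Im \<rho>\<bar> * X) / norm \<rho> \<le> k * exp (\<bar>Im \<rho>\<bar> * X)"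
        using \<rho>(3) k by (simp add: divide_le_eq mult_right_mono mult.commute mult.left_commute)
    qed
  qed (use R k in \<open>auto simp: R'_def\<close>)
qed

lemma lower_bound_P2:
  obtains k R where "k > 0" "R \<ge> 1"
    "\<And>\<rho> r. on_square r \<rho> \<Longrightarrow> r \<ge> R \<Longrightarrow> (sin (r * c))\<^sup>2 = 1 \<Longrightarrow>
       k * (norm \<rho> * exp (\<bar>Im \<rho>\<bar> * c)) \<le> norm (P2 (\<rho>\<^sup>2) c + H * Y2 (\<rho>\<^sup>2) c)"
proof -
  obtain K0 R0 where R0: "R0 \<ge> 1" and K0: "K0 \<ge> 0" and A4:
    "\<And>(\<rho>::complex) (x::real). norm \<rho> \<ge> R0 \<Longrightarrow> x \<in> {d..c} \<Longrightarrow>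
       norm (P2 (\<rho>\<^sup>2) x + \<rho> * (ap * sin (\<rho> * of_real x) - am * sin (\<rho> * of_real (2 * d - x)))) \<le> K0 * exp (\<bar>Im \<rho>\<bar> * x)"
    using asymptotics by metis
  obtain K1 R1 where R1: "R1 \<ge> 1" and K1: "K1 \<ge> 0" and U:
    "\<And>(\<rho>::complex) (x::real). norm \<rho> \<ge> R1 \<Longrightarrow> x \<in> {d..c} \<Longrightarrow> norm (Y2 (\<rho>\<^sup>2) x) \<le> K1 * exp (\<bar>Im \<rho>\<bar> * x)"
    using upper_bounds by metis
  define K where "K = K0 + norm H * K1"
  define k where "k = (ap - \<bar>am\<bar>) / 8"
  have k: "k > 0" using am_less_ap by (simp add: k_def)
  have c0: "c > 0" using d by simp
  have cc: "c \<in> {d..c}" using d by simp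
  define t where "t = (ap + \<bar>am\<bar>) / (ap - \<bar>am\<bar>)"
  define R' where "R' = max (max R0 R1) (max (t / c) (K / k))"
  show ?thesis
  proof (rule that[of k R'])
    fix \<rho> r assume sq: "on_square r \<rho>" and r: "r \<ge> R'" and cr: "(sin (r * c))\<^sup>2 = 1"
    have \<rho>: "norm \<rho> \<ge> R0" "norm \<rho> \<ge> K / k" "norm \<rho> \<ge> 1" "norm \<rho> \<ge> R1" using norm_ge_on_square[OF sq] r R0 by (auto simp: R'_def)
    have rX: "r * c \<ge> t" using r c0 by (simp add: R'_def pos_divide_le_eq)
    have s: "\<bar>2 * d - c\<bar> \<le> c" using d by auto
    define m where "m = - (\<rho> * (ap * sin (\<rho> * of_real c) - am * sin (\<rho> * of_real (2 * d - c))))"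
    \<comment> \<open>Differentiation reverses the sign of the reflected wave, hence
      \<open>- am\<close>; the gap is unaffected.\<close>
    have "2 * k * exp (\<bar>Im \<rho>\<bar> * c) = (ap - \<bar>-am\<bar>) / 4 * exp (\<bar>Im \<rho>\<bar> * c)" by (simp add: k_def)
    also have "\<dots> \<le> norm (of_real ap * sin (\<rho> * of_real c) + of_real (-am) * sin (\<rho> * of_real (2 * d - c)))"
      using on_square_cos_sin(2,4)[OF sq c0 s rX] cr c0 am_less_ap
      by (intro exp_le_combination) (auto simp: t_def)
    finally have "2 * k * exp (\<bar>Im \<rho>\<bar> * c) \<le> norm (of_real ap * sin (\<rho> * of_real c) + of_real (-am) * sin (\<rho> * of_real (2 * d - c)))" .
    from mult_left_mono[OF this norm_ge_zero[of \<rho>]]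
    have "2 * k * (norm \<rho> * exp (\<bar>Im \<rho>\<bar> * c)) \<le> norm m"
      unfolding m_def norm_minus_cancel norm_mult by (simp add: mult.left_commute)
    then show "k * (norm \<rho> * exp (\<bar>Im \<rho>\<bar> * c)) \<le> norm (P2 (\<rho>\<^sup>2) c + H * Y2 (\<rho>\<^sup>2) c)"
    proof (rule norm_ge_half_of_approximation)
      have "norm (P2 (\<rho>\<^sup>2) c + H * Y2 (\<rho>\<^sup>2) c - m) \<le> norm (P2 (\<rho>\<^sup>2) c - m) + norm (H * Y2 (\<rho>\<^sup>2) c)"
        using norm_triangle_ineq[of "P2 (\<rho>\<^sup>2) c - m" "H * Y2 (\<rho>\<^sup>2) c"] by (simp add: algebra_simps)
      also have "\<dots> \<le> K0 * exp (\<bar>Im \<rho>\<bar> * c) + norm H * (K1 * exp (\<bar>Im \<rho>\<bar> * c))"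
        using A4[OF \<rho>(1) cc] U[OF \<rho>(4) cc] unfolding norm_mult
        by (intro add_mono mult_left_mono) (auto simp: m_def)
      finally show "norm (P2 (\<rho>\<^sup>2) c + H * Y2 (\<rho>\<^sup>2) c - m) \<le> K * exp (\<bar>Im \<rho>\<bar> * c)" by (simp add: K_def algebra_simps)
      have "K \<le> k * norm \<rho>" using \<rho>(2) k by (simp add: divide_le_eq mult.commute)
      from mult_right_mono[OF this, of "exp (\<bar>Im \<rho>\<bar> * c)"]
      show "K * exp (\<bar>Im \<rho>\<bar> * c) \<le> k * (norm \<rho> * exp (\<bar>Im \<rho>\<bar> * c))" by (simp add: mult.assoc)
    qed
  qed (use R0 k in \<open>auto simp: R'_def\<close>)
qed

end

section \<open>A Borg--Marchenko uniqueness theorem\<close>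

lemma has_ac_derivative_on_0_continuous:
  fixes g :: "real \<Rightarrow> complex"
  assumes ac: "has_ac_derivative_on (\<lambda>x. 0) g {a..b}" and g: "continuous_on {a..b} g" and "a < b" and x: "x \<in> {a..b}"
  shows "g x = 0"
proof -
  have "((\<lambda>u. integral {a..u} g) has_vector_derivative g x) (at x within {a..b})"
    by (rule integral_has_vector_derivative[OF g x])
  moreover have "((\<lambda>u. integral {a..u} g) has_vector_derivative 0) (at x within {a..b})"
  proof (rule has_vector_derivative_transform[OF x, of _ "\<lambda>u. 0"])
    show "\<And>u. u \<in> {a..b} \<Longrightarrow> integral {a..u} g = 0" using has_ac_derivative_on_eq_integral[OF ac] by simp
  qed simp
  ultimately show ?thesis
    using vector_derivative_unique_within_closed_interval[of a b x] \<open>a < b\<close> x by (metis box_real(2))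
qed

text \<open>Solutions with data at the right end, obtained by reflection. The growth of
  \<open>S\<close> towards \<open>a\<close> is exactly compensated by the decay of
  \<open>Y x / Y b\<close> in \<open>borg_marchenko\<close>, and the factor
  \<open>1 / norm \<rho>\<close> is the gain that makes the argument work.\<close>

lemma backward_solutions:
  fixes q :: "real \<Rightarrow> complex"
  assumes ab: "a \<le> b" and q: "q absolutely_integrable_on {a..b}"
  obtains C C' S S' R where
    "\<And>\<mu>. sol (\<lambda>x. q x - \<mu>) a b (C \<mu>) (C' \<mu>)" "\<And>\<mu>. sol (\<lambda>x. q x - \<mu>) a b (S \<mu>) (S' \<mu>)"
    "\<And>\<mu>. C \<mu> b = 1" "\<And>\<mu>. C' \<mu> b = 0" "\<And>\<mu>. S \<mu> b = 0" "\<And>\<mu>. S' \<mu> b = 1"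
    "\<And>x. x \<in> {a..b} \<Longrightarrow> (\<lambda>\<mu>. C \<mu> x) holomorphic_on UNIV" "\<And>x. x \<in> {a..b} \<Longrightarrow> (\<lambda>\<mu>. S \<mu> x) holomorphic_on UNIV"
    "R \<ge> 1" "\<And>(\<rho>::complex) (x::real). norm \<rho> \<ge> R \<Longrightarrow> x \<in> {a..b} \<Longrightarrow> norm (S (\<rho>\<^sup>2) x) \<le> 2 * exp (\<bar>Im \<rho>\<bar> * (b - x)) / norm \<rho>"
proof -
  define q' where "q' x = q (- x)" for x
  have q': "q' absolutely_integrable_on {-b..-a}" unfolding q'_def using q by simp
  have ab': "- b \<le> - a" using ab by simp
  note Q = absolutely_integrable_diff_const[OF q']
  have "\<exists>f. sol (\<lambda>x. q' x - \<mu>) (-b) (-a) (fst f) (snd f) \<and> fst f (-b) = u \<and> snd f (-b) = v" for \<mu> u v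
    using sol_exists_bounded[OF Q[of \<mu>] ab', of u v] by (metis fst_conv snd_conv)
  then obtain f where f: "\<And>\<mu> u v. sol (\<lambda>x. q' x - \<mu>) (-b) (-a) (fst (f \<mu> u v)) (snd (f \<mu> u v))"
    "\<And>\<mu> u v. fst (f \<mu> u v) (-b) = u" "\<And>\<mu> u v. snd (f \<mu> u v) (-b) = v" by metis
  define C where "C \<mu> x = fst (f \<mu> 1 0) (- x)" for \<mu> x
  define C' where "C' \<mu> x = - snd (f \<mu> 1 0) (- x)" for \<mu> x
  \<comment> \<open>Reflection reverses the sign of the derivative, so the slope \<open>-1\<close>
    here becomes \<open>S' \<mu> b = 1\<close>.\<close>
  define S where "S \<mu> x = fst (f \<mu> 0 (-1)) (- x)" for \<mu> x
  define S' where "S' \<mu> x = - snd (f \<mu> 0 (-1)) (- x)" for \<mu> x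
  interpret fc: sol_family q' "-b" "-a" "\<lambda>\<mu>. fst (f \<mu> 1 0)" "\<lambda>\<mu>. snd (f \<mu> 1 0)"
    by unfold_locales (use ab' q' f in auto)
  interpret fs: sol_family q' "-b" "-a" "\<lambda>\<mu>. fst (f \<mu> 0 (-1))" "\<lambda>\<mu>. snd (f \<mu> 0 (-1))"
    by unfold_locales (use ab' q' f in auto)
  define N where "N = integral {-b..-a} (\<lambda>t. norm (q' t))"
  define R where "R = max 1 (2 * N)"
  have N0: "N \<ge> 0" unfolding N_def by (intro Henstock_Kurzweil_Integration.integral_nonneg absolutely_integrable_norm_on q') simp
  show ?thesis
  proof (rule that[of C C' S S' R])
    show "sol (\<lambda>x. q x - \<mu>) a b (C \<mu>) (C' \<mu>)" for \<mu>
      using sol_reflect[OF f(1)[of \<mu> 1 0]] by (simp add: C_def[abs_def] C'_def[abs_def] q'_def)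
    show "sol (\<lambda>x. q x - \<mu>) a b (S \<mu>) (S' \<mu>)" for \<mu>
      using sol_reflect[OF f(1)[of \<mu> 0 "-1"]] by (simp add: S_def[abs_def] S'_def[abs_def] q'_def)
    show "C \<mu> b = 1" "C' \<mu> b = 0" "S \<mu> b = 0" "S' \<mu> b = 1" for \<mu>
      by (simp_all add: C_def C'_def S_def S'_def f)
    show "(\<lambda>\<mu>. C \<mu> x) holomorphic_on UNIV" "(\<lambda>\<mu>. S \<mu> x) holomorphic_on UNIV" if "x \<in> {a..b}" for x
      unfolding C_def S_def using that by (auto intro: fc.holomorphic fs.holomorphic)
    show "R \<ge> 1" by (simp add: R_def)
    fix \<rho> :: complex and x :: real assume \<rho>: "norm \<rho> \<ge> R" and x: "x \<in> {a..b}"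
    have r: "\<rho> \<noteq> 0" "norm \<rho> \<ge> 2 * N" "norm \<rho> \<ge> 1" using \<rho> by (auto simp: R_def)
    have x': "- x \<in> {-b..-a}" using x by auto
    define e where "e = exp (\<bar>Im \<rho>\<bar> * (b - x))"
    define s where "s = sin (\<rho> * of_real (b - x)) / \<rho>"
    have "norm (fst (f (\<rho>\<^sup>2) 0 (-1)) (- x) + s) \<le> 2 * N * e / (norm \<rho>)\<^sup>2"
      using sol_estimate(1)[OF q' f(1) r(1) r(2)[unfolded N_def] x', of 0 "-1", folded N_def]
      by (simp add: f s_def e_def)
    also have "\<dots> = (2 * N / norm \<rho>) * (e / norm \<rho>)" by (simp add: power2_eq_square)
    also have "\<dots> \<le> 1 * (e / norm \<rho>)" using r by (intro mult_right_mono) (auto simp: e_def divide_le_eq_1)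
    finally have 1: "norm (S (\<rho>\<^sup>2) x + s) \<le> e / norm \<rho>" by (simp add: S_def)
    have 2: "norm s \<le> e / norm \<rho>"
      unfolding s_def e_def norm_divide using x by (intro divide_right_mono norm_cos_sin_le_exp) auto
    have "norm (S (\<rho>\<^sup>2) x) \<le> e / norm \<rho> + e / norm \<rho>"
      using norm_triangle_ineq4[of "S (\<rho>\<^sup>2) x + s" s] 1 2 by simp
    then show "norm (S (\<rho>\<^sup>2) x) \<le> 2 * exp (\<bar>Im \<rho>\<bar> * (b - x)) / norm \<rho>" by (simp add: e_def)
  qed
qed

text \<open>The pairs \<open>(C, S)\<close> and \<open>(Ct, St)\<close> are parallel, hence differ
  by a scalar function \<open>k\<close>. The unit Wronskians and the differentiated parallelism
  force \<open>k\<^sup>2 = 1\<close>, so \<open>k\<close> is constant by continuity and equals 1 by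
  its value at \<open>b\<close>. Then \<open>q - qt\<close> annihilates both \<open>C\<close> and
  \<open>S\<close>, which have no common zero.\<close>

lemma eq_potential_if_proportional_solutions:
  fixes q qt :: "real \<Rightarrow> complex"
  assumes ab: "a < b" and q: "q absolutely_integrable_on {a..b}" "qt absolutely_integrable_on {a..b}"
    and C: "sol q a b C C'" and S: "sol q a b S S'" and Ct: "sol qt a b Ct Ct'" and St: "sol qt a b St St'"
    and init: "C b = 1" "C' b = 0" "S b = 0" "S' b = 1" "Ct b = 1" "Ct' b = 0" "St b = 0" "St' b = 1"
    and parallel: "\<And>x. x \<in> {a..b} \<Longrightarrow> S x * Ct x = St x * C x"
  shows "AE x in lebesgue. x \<in> {a..b} \<longrightarrow> q x = qt x"
proof -
  note cont = sol_continuous[OF C] sol_continuous[OF S] sol_continuous[OF Ct] sol_continuous[OF St]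
  have bb: "b \<in> {a..b}" using ab by simp
  have W: "C x * S' x - C' x * S x = 1" if "x \<in> {a..b}" for x
    using wronskian_const[OF C S that] wronskian_const[OF C S bb] init by simp
  have Wt: "Ct x * St' x - Ct' x * St x = 1" if "x \<in> {a..b}" for x
    using wronskian_const[OF Ct St that] wronskian_const[OF Ct St bb] init by simp
  define D where "D x = (Ct x * S' x + S x * Ct' x) - (C x * St' x + St x * C' x)" for x
  have "has_ac_derivative_on (\<lambda>x. S x * Ct x - St x * C x) D {a..b}"
    using has_ac_derivative_on_diff[OF has_ac_derivative_on_mult[OF solD(1)[OF S] solD(1)[OF Ct]]
        has_ac_derivative_on_mult[OF solD(1)[OF St] solD(1)[OF C]]]
    unfolding D_def .
  then have "has_ac_derivative_on (\<lambda>x. 0) D {a..b}"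
    by (rule has_ac_derivative_on_cong) (auto simp: parallel)
  moreover have "continuous_on {a..b} D" unfolding D_def by (intro continuous_intros cont)
  ultimately have D0: "D x = 0" if "x \<in> {a..b}" for x
    by (rule has_ac_derivative_on_0_continuous) (use ab that in auto)
  \<comment> \<open>A formula for the scalar without division, read off from parallelism and the
    Wronskian of \<open>C\<close> and \<open>S\<close>. The vanishing of \<open>D\<close> provides
    the second expression \<open>C St' - S Ct'\<close>, and the product of the two is the Wronskian
    of \<open>Ct\<close> and \<open>St\<close>.\<close>
  define k where "k x = Ct x * S' x - St x * C' x" for x
  have kC: "Ct x = k x * C x" and kS: "St x = k x * S x" if x: "x \<in> {a..b}" for x
  proof -
    have "k x * C x = Ct x * (C x * S' x) - (St x * C x) * C' x" by (simp add: k_def algebra_simps)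
    also have "\<dots> = Ct x * (C x * S' x - C' x * S x)" unfolding parallel[OF x, symmetric] by (simp add: algebra_simps)
    finally show "Ct x = k x * C x" using W[OF x] by simp
    have "k x * S x = (S x * Ct x) * S' x - St x * (C' x * S x)" by (simp add: k_def algebra_simps)
    also have "\<dots> = St x * (C x * S' x - C' x * S x)" unfolding parallel[OF x] by (simp add: algebra_simps)
    finally show "St x = k x * S x" using W[OF x] by simp
  qed
  have k2: "k x * k x = 1" if x: "x \<in> {a..b}" for x
  proof -
    have "C x * St' x - S x * Ct' x = k x" using D0[OF x] by (simp add: D_def k_def algebra_simps)
    then have "k x * k x = k x * (C x * St' x - S x * Ct' x)" by simp
    also have "\<dots> = (k x * C x) * St' x - Ct' x * (k x * S x)" by (simp add: algebra_simps)
    also have "\<dots> = 1" unfolding kC[OF x, symmetric] kS[OF x, symmetric] by (rule Wt[OF x])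
    finally show ?thesis .
  qed
  have ck: "continuous_on {a..b} k" unfolding k_def by (intro continuous_intros cont)
  have "k ` {a..b} \<subseteq> {1, -1}"
  proof (rule image_subsetI)
    fix x assume "x \<in> {a..b}"
    from k2[OF this] show "k x \<in> {1, -1}" by (simp add: square_eq_1_iff)
  qed
  then have "finite (k ` {a..b})" by (rule finite_subset) simp
  with ck have "k constant_on {a..b}" by (intro continuous_finite_range_constant) auto
  then obtain z where z: "\<And>x. x \<in> {a..b} \<Longrightarrow> k x = z" unfolding constant_on_def by blast
  have "k b = 1" by (simp add: k_def init)
  then have k1: "k x = 1" if "x \<in> {a..b}" for x using z[OF that] z[OF bb] by simp
  have ae: "AE x in lebesgue. x \<in> {a..b} \<longrightarrow> (q x - qt x) * f x = 0"
    if f: "sol q a b f f'" "sol qt a b ft ft'" and eq: "\<And>x. x \<in> {a..b} \<Longrightarrow> ft x = f x" for f f' ft ft'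
  proof -
    have "has_ac_derivative_on (\<lambda>x. f x - ft x) (\<lambda>x. f' x - ft' x) {a..b}"
      by (intro has_ac_derivative_on_diff solD(1)[OF f(1)] solD(1)[OF f(2)])
    then have "has_ac_derivative_on (\<lambda>x. 0) (\<lambda>x. f' x - ft' x) {a..b}"
      by (rule has_ac_derivative_on_cong) (auto simp: eq)
    then have d: "f' x - ft' x = 0" if "x \<in> {a..b}" for x
      by (rule has_ac_derivative_on_0_continuous)
        (use ab that in \<open>auto intro!: continuous_intros sol_continuous(2)[OF f(1)] sol_continuous(2)[OF f(2)]\<close>)
    have "has_ac_derivative_on (\<lambda>x. f' x - ft' x) (\<lambda>x. q x * f x - qt x * ft x) {a..b}"
      by (intro has_ac_derivative_on_diff solD(2)[OF f(1)] solD(2)[OF f(2)])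
    then have ac: "has_ac_derivative_on (\<lambda>x. 0) (\<lambda>x. (q x - qt x) * f x) {a..b}"
      by (rule has_ac_derivative_on_cong) (auto simp: eq d algebra_simps)
    show ?thesis
    proof (rule AE_eq_0_if_integrals_eq_0)
      show "(\<lambda>x. (q x - qt x) * f x) absolutely_integrable_on {a..b}" by (rule has_ac_derivative_on_imp_abs_int[OF ac])
      show "integral {s..t} (\<lambda>x. (q x - qt x) * f x) = 0" if "a \<le> s" "s \<le> t" "t \<le> b" for s t
        using has_ac_derivative_onD[OF ac that] by simp
    qed (use ab in simp)
  qed
  have "AE x in lebesgue. x \<in> {a..b} \<longrightarrow> (q x - qt x) * C x = 0"
    by (rule ae[OF C Ct]) (use kC k1 in simp)
  moreover have "AE x in lebesgue. x \<in> {a..b} \<longrightarrow> (q x - qt x) * S x = 0"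
    by (rule ae[OF S St]) (use kS k1 in simp)
  ultimately show ?thesis
  proof eventually_elim
    case (elim x)
    then show ?case using W[of x] by auto
  qed
qed

text \<open>The function \<open>S Ct - St C\<close> is entire in the spectral parameter and, since both families have
  the same logarithmic derivative at \<open>b\<close>, equals \<open>S Yt / Yt(b) - St Y / Y(b)\<close>, which is
  \<open>O(1 / \<rho>)\<close> on the squares.\<close>

lemma borg_marchenko:
  fixes q qt :: "real \<Rightarrow> complex" and Y P Yt Pt :: "complex \<Rightarrow> real \<Rightarrow> complex" and s \<kappa> a b K :: real
  defines "r \<equiv> \<lambda>N::nat. (real N + s) * \<kappa>"
  assumes ab: "a < b" and q: "q absolutely_integrable_on {a..b}" "qt absolutely_integrable_on {a..b}"
    and Y: "\<And>\<mu>. sol (\<lambda>x. q x - \<mu>) a b (Y \<mu>) (P \<mu>)" and Yt: "\<And>\<mu>. sol (\<lambda>x. qt x - \<mu>) a b (Yt \<mu>) (Pt \<mu>)"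
    and W: "\<And>\<mu>. Y \<mu> b * Pt \<mu> b = P \<mu> b * Yt \<mu> b"
    and pos: "s \<ge> 0" "\<kappa> > 0"
    and bY: "\<And>N \<rho> x. N \<ge> N0 \<Longrightarrow> on_square (r N) \<rho> \<Longrightarrow> x \<in> {a..b} \<Longrightarrow>
       Y (\<rho>\<^sup>2) b \<noteq> 0 \<and> norm (Y (\<rho>\<^sup>2) x) \<le> K * exp (- (\<bar>Im \<rho>\<bar> * (b - x))) * norm (Y (\<rho>\<^sup>2) b)"
    and bYt: "\<And>N \<rho> x. N \<ge> N0 \<Longrightarrow> on_square (r N) \<rho> \<Longrightarrow> x \<in> {a..b} \<Longrightarrow>
       Yt (\<rho>\<^sup>2) b \<noteq> 0 \<and> norm (Yt (\<rho>\<^sup>2) x) \<le> K * exp (- (\<bar>Im \<rho>\<bar> * (b - x))) * norm (Yt (\<rho>\<^sup>2) b)"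
  shows "AE x in lebesgue. x \<in> {a..b} \<longrightarrow> q x = qt x"
proof -
  have ab': "a \<le> b" and bb: "b \<in> {a..b}" using ab by auto
  obtain C C' S S' R where C: "\<And>\<mu>. sol (\<lambda>x. q x - \<mu>) a b (C \<mu>) (C' \<mu>)" and S: "\<And>\<mu>. sol (\<lambda>x. q x - \<mu>) a b (S \<mu>) (S' \<mu>)"
    and init: "\<And>\<mu>. C \<mu> b = 1" "\<And>\<mu>. C' \<mu> b = 0" "\<And>\<mu>. S \<mu> b = 0" "\<And>\<mu>. S' \<mu> b = 1"
    and hol: "\<And>x. x \<in> {a..b} \<Longrightarrow> (\<lambda>\<mu>. C \<mu> x) holomorphic_on UNIV" "\<And>x. x \<in> {a..b} \<Longrightarrow> (\<lambda>\<mu>. S \<mu> x) holomorphic_on UNIV"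
    and R: "R \<ge> 1" and bS: "\<And>(\<rho>::complex) (x::real). norm \<rho> \<ge> R \<Longrightarrow> x \<in> {a..b} \<Longrightarrow> norm (S (\<rho>\<^sup>2) x) \<le> 2 * exp (\<bar>Im \<rho>\<bar> * (b - x)) / norm \<rho>"
    by (rule backward_solutions[OF ab' q(1)]) (rule that)
  obtain Ct Ct' St St' Rt where Ct: "\<And>\<mu>. sol (\<lambda>x. qt x - \<mu>) a b (Ct \<mu>) (Ct' \<mu>)" and St: "\<And>\<mu>. sol (\<lambda>x. qt x - \<mu>) a b (St \<mu>) (St' \<mu>)"
    and initt: "\<And>\<mu>. Ct \<mu> b = 1" "\<And>\<mu>. Ct' \<mu> b = 0" "\<And>\<mu>. St \<mu> b = 0" "\<And>\<mu>. St' \<mu> b = 1"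
    and holt: "\<And>x. x \<in> {a..b} \<Longrightarrow> (\<lambda>\<mu>. Ct \<mu> x) holomorphic_on UNIV" "\<And>x. x \<in> {a..b} \<Longrightarrow> (\<lambda>\<mu>. St \<mu> x) holomorphic_on UNIV"
    and Rt: "Rt \<ge> 1" and bSt: "\<And>(\<rho>::complex) (x::real). norm \<rho> \<ge> Rt \<Longrightarrow> x \<in> {a..b} \<Longrightarrow> norm (St (\<rho>\<^sup>2) x) \<le> 2 * exp (\<bar>Im \<rho>\<bar> * (b - x)) / norm \<rho>"
    by (rule backward_solutions[OF ab' q(2)]) (rule that)
  have rep: "y x = y b * c x + p b * z x"
    if y: "sol Q a b y p" and c: "sol Q a b c c'" and z: "sol Q a b z z'"
      and i: "c b = 1" "c' b = 0" "z b = 0" "z' b = 1" and x: "x \<in> {a..b}" for Q y p c c' z z' x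
  proof -
    have cz: "c x * z' x - c' x * z x = 1"
      using wronskian_const[OF c z x] wronskian_const[OF c z bb] i by simp
    have w1: "y x * z' x - p x * z x = y b" using wronskian_const[OF y z x] wronskian_const[OF y z bb] i by simp
    have w2: "y x * c' x - p x * c x = - p b" using wronskian_const[OF y c x] wronskian_const[OF y c bb] i by simp
    show ?thesis using solve_by_wronskians(1)[OF cz, where y="y x" and p="p x"] unfolding w1 w2 by (simp add: mult.commute)
  qed
  define N1 where "N1 = max N0 (nat \<lceil>max R Rt / \<kappa>\<rceil>)"
  have rN1: "r N \<ge> R" "r N \<ge> Rt" "r N \<ge> 1" "N \<ge> N0" if "N \<ge> N1" for N
  proof -
    have "max R Rt / \<kappa> \<le> real N" using that real_nat_ceiling_ge[of "max R Rt / \<kappa>"] by (simp add: N1_def)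
    then have "max R Rt \<le> real N * \<kappa>" using pos by (simp add: pos_divide_le_eq)
    also have "\<dots> \<le> r N" unfolding r_def using pos by (intro mult_right_mono) auto
    finally show "r N \<ge> R" "r N \<ge> Rt" "r N \<ge> 1" using R by auto
    show "N \<ge> N0" using that by (simp add: N1_def)
  qed
  \<comment> \<open>Parallelism at the single parameter \<mu> = 0 is enough: there the equations
    involve \<open>q\<close> and \<open>qt\<close> themselves.\<close>
  have zero: "S 0 x * Ct 0 x - St 0 x * C 0 x = 0" if x: "x \<in> {a..b}" for x
  proof -
    define G where "G \<mu> = S \<mu> x * Ct \<mu> x - St \<mu> x * C \<mu> x" for \<mu>
    have G: "G holomorphic_on UNIV" unfolding G_def by (intro holomorphic_intros hol holt x)
    have bound: "norm (G (\<rho>\<^sup>2)) \<le> 4 * K / norm \<rho>" if N: "N \<ge> N1" and sq: "on_square (r N) \<rho>" for N \<rho>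
    proof -
      have n: "norm \<rho> \<ge> R" "norm \<rho> \<ge> Rt" "norm \<rho> \<ge> 1" using rN1[OF N] norm_ge_on_square[OF sq] by auto
      define y where "y = Y (\<rho>\<^sup>2) b"
      define yt where "yt = Yt (\<rho>\<^sup>2) b"
      have y0: "y \<noteq> 0" "yt \<noteq> 0" using bY[OF rN1(4)[OF N] sq x] bYt[OF rN1(4)[OF N] sq x] by (auto simp: y_def yt_def)
      have "Y (\<rho>\<^sup>2) x = y * C (\<rho>\<^sup>2) x + P (\<rho>\<^sup>2) b * S (\<rho>\<^sup>2) x"
        unfolding y_def by (rule rep[OF Y C S init x])
      moreover have "Yt (\<rho>\<^sup>2) x = yt * Ct (\<rho>\<^sup>2) x + Pt (\<rho>\<^sup>2) b * St (\<rho>\<^sup>2) x"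
        unfolding yt_def by (rule rep[OF Yt Ct St initt x])
      ultimately have "y * (S (\<rho>\<^sup>2) x * Yt (\<rho>\<^sup>2) x) - yt * (St (\<rho>\<^sup>2) x * Y (\<rho>\<^sup>2) x) =
        y * yt * G (\<rho>\<^sup>2) + S (\<rho>\<^sup>2) x * St (\<rho>\<^sup>2) x * (y * Pt (\<rho>\<^sup>2) b - P (\<rho>\<^sup>2) b * yt)"
        by (simp add: G_def algebra_simps)
      also have "y * Pt (\<rho>\<^sup>2) b - P (\<rho>\<^sup>2) b * yt = 0" using W[of "\<rho>\<^sup>2"] by (simp add: y_def yt_def)
      finally have "y * (S (\<rho>\<^sup>2) x * Yt (\<rho>\<^sup>2) x) - yt * (St (\<rho>\<^sup>2) x * Y (\<rho>\<^sup>2) x) = y * yt * G (\<rho>\<^sup>2)" by simp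
      then have "G (\<rho>\<^sup>2) = S (\<rho>\<^sup>2) x * (Yt (\<rho>\<^sup>2) x / yt) - St (\<rho>\<^sup>2) x * (Y (\<rho>\<^sup>2) x / y)"
        using y0 by (simp add: field_simps)
      then have "norm (G (\<rho>\<^sup>2)) \<le> norm (S (\<rho>\<^sup>2) x) * norm (Yt (\<rho>\<^sup>2) x / yt) + norm (St (\<rho>\<^sup>2) x) * norm (Y (\<rho>\<^sup>2) x / y)"
        using norm_triangle_ineq4 by (simp flip: norm_mult)
      also have "\<dots> \<le> (2 * exp (\<bar>Im \<rho>\<bar> * (b - x)) / norm \<rho>) * (K * exp (- (\<bar>Im \<rho>\<bar> * (b - x)))) +
          (2 * exp (\<bar>Im \<rho>\<bar> * (b - x)) / norm \<rho>) * (K * exp (- (\<bar>Im \<rho>\<bar> * (b - x))))"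
      proof (intro add_mono mult_mono)
        show "norm (S (\<rho>\<^sup>2) x) \<le> 2 * exp (\<bar>Im \<rho>\<bar> * (b - x)) / norm \<rho>" by (rule bS[OF n(1) x])
        show "norm (St (\<rho>\<^sup>2) x) \<le> 2 * exp (\<bar>Im \<rho>\<bar> * (b - x)) / norm \<rho>" by (rule bSt[OF n(2) x])
        show "norm (Yt (\<rho>\<^sup>2) x / yt) \<le> K * exp (- (\<bar>Im \<rho>\<bar> * (b - x)))"
          using bYt[OF rN1(4)[OF N] sq x] y0 by (simp add: norm_divide yt_def pos_divide_le_eq)
        show "norm (Y (\<rho>\<^sup>2) x / y) \<le> K * exp (- (\<bar>Im \<rho>\<bar> * (b - x)))"
          using bY[OF rN1(4)[OF N] sq x] y0 by (simp add: norm_divide y_def pos_divide_le_eq)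
      qed auto
      also have "\<dots> = 4 * K / norm \<rho>"
      proof -
        have "(2 * exp t / n) * (K * exp (- t)) + (2 * exp t / n) * (K * exp (- t)) = 4 * K / n" for t n :: real
          by (simp add: exp_minus field_simps)
        then show ?thesis .
      qed
      finally show ?thesis .
    qed
    have K0: "K \<ge> 0"
    proof -
      have "on_square (r N1) (of_real (r N1))" using rN1(3)[of N1] by (simp add: on_square_def)
      from order_trans[OF norm_ge_zero bound[OF order_refl this]] rN1(3)[of N1] show ?thesis
        by (simp add: zero_le_divide_iff)
    qed
    \<comment> \<open>The argument runs in the variable \<rho>. \<open>G\<close> is bounded on the
      squares, so the degree is \<open>n = 0\<close>, and the bound with \<open>norm \<rho>\<close>
      in the denominator gives the limit.\<close>
    have "G (0\<^sup>2) = 0"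
    proof (rule entire_eq_0_by_squares[where g="\<lambda>\<rho>. G (\<rho>\<^sup>2)" and s=s and \<kappa>=\<kappa> and n=0 and C="4 * K" and ?N0.0=N1])
      show "(\<lambda>\<rho>. G (\<rho>\<^sup>2)) holomorphic_on UNIV"
      proof -
        have "G \<circ> (\<lambda>\<rho>. \<rho>\<^sup>2) holomorphic_on UNIV"
          by (rule holomorphic_on_compose_gen[OF _ G]) (intro holomorphic_intros, simp)
        then show ?thesis by (simp add: o_def)
      qed
      fix N \<rho> assume N: "N \<ge> N1" and sq: "on_square ((real N + s) * \<kappa>) \<rho>"
      have sq': "on_square (r N) \<rho>" using sq by (simp add: r_def)
      have "norm \<rho> \<ge> 1" using rN1(3)[OF N] norm_ge_on_square[OF sq'] by simp
      then have "4 * K / norm \<rho> \<le> 4 * K / 1" using K0 by (intro divide_left_mono) auto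
      with bound[OF N sq'] show "norm (G (\<rho>\<^sup>2)) \<le> 4 * K * ((real N + s) * \<kappa>) ^ 0" by simp
    next
      have "filterlim r at_top sequentially"
        unfolding r_def by (rule filterlim_arith_at_top[OF pos(2,1)])
      then have t0: "(\<lambda>N. 4 * K / r N) \<longlonglongrightarrow> 0"
        by (rule real_tendsto_divide_at_top[OF tendsto_const])
      show "(\<lambda>N. G ((\<i> * of_real ((real N + s) * \<kappa>))\<^sup>2)) \<longlonglongrightarrow> 0"
      proof (rule Lim_null_comparison[OF _ t0])
        show "\<forall>\<^sub>F N in sequentially. norm (G ((\<i> * of_real ((real N + s) * \<kappa>))\<^sup>2)) \<le> 4 * K / r N"
        proof (rule eventually_sequentiallyI)
          fix N assume N: "N \<ge> N1"
          have "on_square (r N) (\<i> * of_real (r N))" using rN1(3)[OF N] by (simp add: on_square_def)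
          have n: "norm (\<i> * complex_of_real (r N)) = r N" using rN1(3)[OF N] by (simp add: norm_mult)
          from bound[OF N \<open>on_square _ _\<close>]
          show "norm (G ((\<i> * of_real ((real N + s) * \<kappa>))\<^sup>2)) \<le> 4 * K / r N"
            unfolding n by (simp only: r_def)
        qed
      qed
    qed (use pos in auto)
    then show ?thesis by (simp add: G_def)
  qed
  show ?thesis
  proof (rule eq_potential_if_proportional_solutions[OF ab q])
    show "sol q a b (C 0) (C' 0)" "sol q a b (S 0) (S' 0)" using C[of 0] S[of 0] by simp_all
    show "sol qt a b (Ct 0) (Ct' 0)" "sol qt a b (St 0) (St' 0)" using Ct[of 0] St[of 0] by simp_all
    show "S 0 x * Ct 0 x = St 0 x * C 0 x" if "x \<in> {a..b}" for x using zero[OF that] by simp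
  qed (simp_all add: init initt)
qed

section \<open>From solutions on half-open intervals to closed intervals and back\<close>

lemma has_ac_derivative_on_close_right:
  assumes ac: "has_ac_derivative_on f g {a..<b}" and lim: "(f \<longlongrightarrow> l) (at_left b)" and ab: "a < b"
  shows "has_ac_derivative_on (f(b := l)) g {a..b}"
proof -
  have "g absolutely_integrable_on {a..<b}" by (rule has_ac_derivative_on_imp_abs_int[OF ac])
  then have g: "g absolutely_integrable_on {a..b}"
    by (rule absolutely_integrable_spike_set) (auto intro: negligible_subset[of "{b}"])
  have eq: "f t = f a + integral {a..t} g" if "t \<in> {a..<b}" for t
  proof -
    have "\<forall>s\<in>{a..<b}. \<forall>t\<in>{a..<b}. s \<le> t \<longrightarrow> f t - f s = integral {s..t} g"
      using ac unfolding has_ac_derivative_on_def by simp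
    then have "f t - f a = integral {a..t} g" using that ab by simp
    then show ?thesis by (simp add: algebra_simps)
  qed
  have "continuous_on {a..b} (\<lambda>t. f a + integral {a..t} g)"
    by (intro continuous_intros indefinite_integral_continuous_1 set_lebesgue_integral_eq_integral(1) g)
  then have "((\<lambda>t. f a + integral {a..t} g) \<longlongrightarrow> f a + integral {a..b} g) (at_left b)"
    using ab by (metis (no_types, lifting) at_within_Icc_at_left atLeastAtMost_iff continuous_on_def less_imp_le order_refl)
  moreover have "\<forall>\<^sub>F t in at_left b. f a + integral {a..t} g = f t"
    using eventually_at_left_real[OF ab] by eventually_elim (rule eq[symmetric], simp)
  ultimately have "(f \<longlongrightarrow> f a + integral {a..b} g) (at_left b)" by (rule Lim_transform_eventually)
  then have l: "l = f a + integral {a..b} g" using tendsto_unique[OF _ lim] by simp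
  show ?thesis
  proof (rule has_ac_derivative_onI[OF g])
    show "(f(b := l)) x = f a + integral {a..x} g" if "x \<in> {a..b}" for x
      using eq[of x] l that by (cases "x = b") simp_all
  qed
qed

lemma has_ac_derivative_on_close_left:
  assumes ac: "has_ac_derivative_on f g {a<..b}" and lim: "(f \<longlongrightarrow> l) (at_right a)" and ab: "a < b"
  shows "has_ac_derivative_on (f(a := l)) g {a..b}"
proof -
  have "g absolutely_integrable_on {a<..b}" by (rule has_ac_derivative_on_imp_abs_int[OF ac])
  then have g: "g absolutely_integrable_on {a..b}"
    by (rule absolutely_integrable_spike_set) (auto intro: negligible_subset[of "{a}"])
  define c where "c = f b - integral {a..b} g"
  have eq: "f t = c + integral {a..t} g" if "t \<in> {a<..b}" for t
  proof -
    have "\<forall>s\<in>{a<..b}. \<forall>t\<in>{a<..b}. s \<le> t \<longrightarrow> f t - f s = integral {s..t} g"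
      using ac unfolding has_ac_derivative_on_def by simp
    then have "f b - f t = integral {t..b} g" using that ab by simp
    moreover have "integral {a..t} g + integral {t..b} g = integral {a..b} g"
      using that by (intro Henstock_Kurzweil_Integration.integral_combine set_lebesgue_integral_eq_integral(1) g) auto
    ultimately show ?thesis by (simp add: c_def algebra_simps)
  qed
  have "continuous_on {a..b} (\<lambda>t. c + integral {a..t} g)"
    by (intro continuous_intros indefinite_integral_continuous_1 set_lebesgue_integral_eq_integral(1) g)
  then have "((\<lambda>t. c + integral {a..t} g) \<longlongrightarrow> c + integral {a..a} g) (at_right a)"
    using ab by (metis (no_types, lifting) at_within_Icc_at_right atLeastAtMost_iff continuous_on_def less_imp_le order_refl)
  moreover have "\<forall>\<^sub>F t in at_right a. c + integral {a..t} g = f t"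
    using eventually_at_right_real[OF ab] by eventually_elim (rule eq[symmetric], simp)
  ultimately have "(f \<longlongrightarrow> c + integral {a..a} g) (at_right a)" by (rule Lim_transform_eventually)
  then have l: "l = c + integral {a..a} g" using tendsto_unique[OF _ lim] by simp
  show ?thesis
  proof (rule has_ac_derivative_onI[OF g])
    show "(f(a := l)) x = c + integral {a..x} g" if "x \<in> {a..b}" for x
      using eq[of x] l that by (cases "x = a") simp_all
  qed
qed

lemma has_ac_derivative_on_restrict:
  assumes ac: "has_ac_derivative_on f g {a..b}" and S: "S \<subseteq> {a..b}" "is_interval S" "S \<in> sets borel"
    and eq: "\<And>x. x \<in> S \<Longrightarrow> f x = f' x" "\<And>x. x \<in> S \<Longrightarrow> g x = g' x"
  shows "has_ac_derivative_on f' g' S"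
  unfolding has_ac_derivative_on_def
proof (intro conjI ballI impI)
  have "S \<in> sets lebesgue" using S(3) by (metis sets_completionI_sets sets_lborel)
  then have "g absolutely_integrable_on S"
    using set_integrable_subset[OF has_ac_derivative_on_imp_abs_int[OF ac]] S(1) by blast
  then show "g' absolutely_integrable_on S"
    by (rule absolutely_integrable_spike[OF _ negligible_empty]) (simp add: eq)
  fix s t assume st: "s \<in> S" "t \<in> S" "s \<le> t"
  have sub: "x \<in> S" if "x \<in> {s..t}" for x using S(2) st(1,2) that unfolding is_interval_1 by (meson atLeastAtMost_iff)
  have "integral {s..t} g = integral {s..t} g'" by (intro Henstock_Kurzweil_Integration.integral_cong) (simp add: eq sub)
  then show "f' t - f' s = integral {s..t} g'"
    using has_ac_derivative_onD[OF ac, of s t] st(3) subsetD[OF S(1) st(1)] subsetD[OF S(1) st(2)]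
    by (simp add: eq[OF st(1)] eq[OF st(2)])
qed

text \<open>\<open>ext\<close> abstracts from the two closing lemmas, so both sides of the jump are
  covered: \<open>e\<close> is the missing end point and \<open>F\<close> the one-sided filter
  there.\<close>

lemma solves_on_imp_sol:
  assumes y: "solves_on q \<mu> S y y'" and S: "{a..b} - {e} \<subseteq> S"
    and ext: "\<And>f f' l. has_ac_derivative_on f f' S \<Longrightarrow> (f \<longlongrightarrow> l) F \<Longrightarrow> has_ac_derivative_on (f(e := l)) f' {a..b}"
    and lim: "(y \<longlongrightarrow> l) F" "(y' \<longlongrightarrow> l') F"
  shows "sol (\<lambda>x. q x - \<mu>) a b (y(e := l)) (y'(e := l'))"
proof -
  from y obtain y'' where ac: "has_ac_derivative_on y y' S" "has_ac_derivative_on y' y'' S"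
    and ae: "AE x in lebesgue. x \<in> S \<longrightarrow> - y'' x + q x * y x = \<mu> * y x"
    unfolding solves_on_def by blast
  have "AE x in lebesgue. x \<notin> {e}" using negligible_sing[of e] unfolding eventually_ae_filter_negligible by blast
  then have ne: "AE x in lebesgue. x \<noteq> e" by simp
  show ?thesis unfolding sol_def
  proof
    have "AE x in lebesgue. x \<in> {a..b} \<longrightarrow> y' x = (y'(e := l')) x"
      using ne by eventually_elim simp
    then show "has_ac_derivative_on (y(e := l)) (y'(e := l')) {a..b}"
      by (rule has_ac_derivative_on_spike[OF ext[OF ac(1) lim(1)]])
    have "AE x in lebesgue. x \<in> {a..b} \<longrightarrow> y'' x = (q x - \<mu>) * (y(e := l)) x"
      using ne ae
    proof eventually_elim
      case (elim x)
      show ?case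
      proof
        assume "x \<in> {a..b}"
        with elim S have "- y'' x + q x * y x = \<mu> * y x" by auto
        then show "y'' x = (q x - \<mu>) * (y(e := l)) x" using elim(1) by (simp add: algebra_simps)
      qed
    qed
    then show "has_ac_derivative_on (y'(e := l')) (\<lambda>x. (q x - \<mu>) * (y(e := l)) x) {a..b}"
      by (rule has_ac_derivative_on_spike[OF ext[OF ac(2) lim(2)]])
  qed
qed

lemma sol_imp_solves_on:
  assumes y: "sol (\<lambda>x. q x - \<mu>) a b y y'" and S: "S \<subseteq> {a..b}" "is_interval S" "S \<in> sets borel"
    and eq: "\<And>x. x \<in> S \<Longrightarrow> y x = z x" "\<And>x. x \<in> S \<Longrightarrow> y' x = z' x"
  shows "solves_on q \<mu> S z z'"
  unfolding solves_on_def
proof (intro conjI exI)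
  show "has_ac_derivative_on z z' S" by (rule has_ac_derivative_on_restrict[OF solD(1)[OF y] S eq])
  show "has_ac_derivative_on z' (\<lambda>x. (q x - \<mu>) * z x) S"
    by (rule has_ac_derivative_on_restrict[OF solD(2)[OF y] S]) (auto simp: eq)
qed (simp add: algebra_simps)

text \<open>\<open>phi_pair\<close> is a Hilbert choice, so its defining property becomes available
  only through a witness.\<close>

lemma is_phi_exists:
  assumes d: "0 < d" "d < pi" and q: "q absolutely_integrable_on {0..pi}"
  shows "\<exists>p. is_phi q h \<beta> \<gamma> d \<mu> p"
proof -
  note q1 = absolutely_integrable_diff_const[OF absolutely_integrable_on_subinterval[OF q], of 0 d \<mu>]
  note q2 = absolutely_integrable_diff_const[OF absolutely_integrable_on_subinterval[OF q], of d pi \<mu>]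
  obtain y1 p1 where s1: "sol (\<lambda>x. q x - \<mu>) 0 d y1 p1" "y1 0 = 1" "p1 0 = h"
    by (rule sol_exists_bounded[OF q1]) (use d in auto)
  obtain y2 p2 where s2: "sol (\<lambda>x. q x - \<mu>) d pi y2 p2" "y2 d = \<beta> * y1 d" "p2 d = of_real (inverse \<beta>) * p1 d + \<gamma> * y1 d"
    by (rule sol_exists_bounded[OF q2]) (use d in auto)
  define y where "y x = (if x < d then y1 x else y2 x)" for x
  define p where "p x = (if x < d then p1 x else p2 x)" for x
  have lim1: "((\<lambda>x. if x < d then f x else g x) \<longlongrightarrow> f d) (at_left d)" if "continuous_on {0..d} f" for f g :: "real \<Rightarrow> complex"
  proof -
    have "(f \<longlongrightarrow> f d) (at_left d)"
      using that d by (metis at_within_Icc_at_left atLeastAtMost_iff continuous_on_def less_imp_le order_refl)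
    moreover have "\<forall>\<^sub>F x in at_left d. f x = (if x < d then f x else g x)"
      using eventually_at_left_real[OF d(1)] by eventually_elim simp
    ultimately show ?thesis by (rule Lim_transform_eventually)
  qed
  have lim2: "((\<lambda>x. if x < d then f x else g x) \<longlongrightarrow> g d) (at_right d)" if "continuous_on {d..pi} g" for f g :: "real \<Rightarrow> complex"
  proof -
    have "(g \<longlongrightarrow> g d) (at_right d)"
      using that d by (metis at_within_Icc_at_right atLeastAtMost_iff continuous_on_def less_imp_le order_refl)
    moreover have "\<forall>\<^sub>F x in at_right d. g x = (if x < d then f x else g x)"
      using eventually_at_right_real[OF d(2)] by eventually_elim simp
    ultimately show ?thesis by (rule Lim_transform_eventually)
  qed
  have "is_phi q h \<beta> \<gamma> d \<mu> (y, p)"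
    unfolding is_phi_def prod.case
  proof (intro conjI)
    show "solves_on q \<mu> {0..<d} y p"
      by (rule sol_imp_solves_on[OF s1(1)]) (auto simp: y_def p_def is_interval_def)
    show "solves_on q \<mu> {d<..pi} y p"
      by (rule sol_imp_solves_on[OF s2(1)]) (auto simp: y_def p_def is_interval_def)
    show "jump_conditions \<beta> \<gamma> d y p"
      unfolding jump_conditions_def y_def[abs_def] p_def[abs_def]
      using lim1[OF sol_continuous(1)[OF s1(1)]] lim2[OF sol_continuous(1)[OF s2(1)]]
        lim1[OF sol_continuous(2)[OF s1(1)]] lim2[OF sol_continuous(2)[OF s2(1)]] s2(2,3) by blast
    show "y 0 = 1" "p 0 = h" using d s1 by (simp_all add: y_def p_def)
  qed
  then show ?thesis by blast
qed

text \<open>The value chosen at \<open>d\<close> is arbitrary; replacing it by the left and by the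
  right limit splits the chosen pair into two solutions on closed intervals that meet the jump
  conditions exactly.\<close>

lemma phi_jump_problem:
  assumes d: "0 < d" "d < pi" and q: "q absolutely_integrable_on {0..pi}" and \<beta>: "\<beta> > 0"
  obtains Y1 P1 Y2 P2 where "jump_problem q h \<gamma> \<beta> d pi Y1 P1 Y2 P2"
    "\<And>\<mu>. phi q h \<beta> \<gamma> d pi \<mu> = Y2 \<mu> pi" "\<And>\<mu>. dphi q h \<beta> \<gamma> d pi \<mu> = P2 \<mu> pi"
proof -
  define R where "R \<mu> f1 f2 \<longleftrightarrow> sol (\<lambda>x. q x - \<mu>) 0 d (fst f1) (snd f1) \<and> sol (\<lambda>x. q x - \<mu>) d pi (fst f2) (snd f2) \<and>
      fst f1 0 = 1 \<and> snd f1 0 = h \<and> fst f2 d = \<beta> * fst f1 d \<and> snd f2 d = snd f1 d / \<beta> + \<gamma> * fst f1 d \<and>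
      phi q h \<beta> \<gamma> d pi \<mu> = fst f2 pi \<and> dphi q h \<beta> \<gamma> d pi \<mu> = snd f2 pi" for \<mu> and f1 f2 :: "(real \<Rightarrow> complex) \<times> (real \<Rightarrow> complex)"
  have "\<exists>f1 f2. R \<mu> f1 f2" for \<mu>
  proof -
    define y where "y = fst (phi_pair q h \<beta> \<gamma> d \<mu>)"
    define p where "p = snd (phi_pair q h \<beta> \<gamma> d \<mu>)"
    have "is_phi q h \<beta> \<gamma> d \<mu> (phi_pair q h \<beta> \<gamma> d \<mu>)"
      unfolding phi_pair_def by (rule someI_ex[OF is_phi_exists[OF d q]])
    then have "is_phi q h \<beta> \<gamma> d \<mu> (y, p)" by (simp add: y_def p_def)
    then have s: "solves_on q \<mu> {0..<d} y p" "solves_on q \<mu> {d<..pi} y p" and j: "jump_conditions \<beta> \<gamma> d y p"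
      and i: "y 0 = 1" "p 0 = h"
      by (auto simp: is_phi_def)
    from j obtain yl yr dl dr where l: "(y \<longlongrightarrow> yl) (at_left d)" "(y \<longlongrightarrow> yr) (at_right d)"
      "(p \<longlongrightarrow> dl) (at_left d)" "(p \<longlongrightarrow> dr) (at_right d)"
      and e: "yr = of_real \<beta> * yl" "dr = of_real (inverse \<beta>) * dl + \<gamma> * yl"
      unfolding jump_conditions_def by blast
    have s1: "sol (\<lambda>x. q x - \<mu>) 0 d (y(d := yl)) (p(d := dl))"
      by (rule solves_on_imp_sol[OF s(1) _ _ l(1,3)]) (use d in \<open>auto intro: has_ac_derivative_on_close_right\<close>)
    have s2: "sol (\<lambda>x. q x - \<mu>) d pi (y(d := yr)) (p(d := dr))"
      by (rule solves_on_imp_sol[OF s(2) _ _ l(2,4)]) (use d in \<open>auto intro: has_ac_derivative_on_close_left\<close>)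
    show ?thesis
      by (rule exI[of _ "(y(d := yl), p(d := dl))"], rule exI[of _ "(y(d := yr), p(d := dr))"])
        (use s1 s2 d i e \<beta> in \<open>simp add: R_def phi_def dphi_def y_def p_def divide_inverse\<close>)
  qed
  then obtain f1 f2 where f: "\<And>\<mu>. R \<mu> (f1 \<mu>) (f2 \<mu>)" by metis
  show ?thesis
  proof (rule that)
    show "jump_problem q h \<gamma> \<beta> d pi (\<lambda>\<mu>. fst (f1 \<mu>)) (\<lambda>\<mu>. snd (f1 \<mu>)) (\<lambda>\<mu>. fst (f2 \<mu>)) (\<lambda>\<mu>. snd (f2 \<mu>))"
      by unfold_locales (use d q \<beta> f in \<open>simp_all add: R_def\<close>)
    show "phi q h \<beta> \<gamma> d pi \<mu> = fst (f2 \<mu>) pi" "dphi q h \<beta> \<gamma> d pi \<mu> = snd (f2 \<mu>) pi" for \<mu>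
      using f[of \<mu>] by (simp_all add: R_def)
  qed
qed

section \<open>Decay along the imaginary axis\<close>

lemma power_le_fact_exp: "0 \<le> (x::real) \<Longrightarrow> x ^ n \<le> fact n * exp x"
proof -
  assume x: "0 \<le> x"
  have "x ^ n / fact n = (\<Sum>k\<in>{n}. inverse (fact k) * x ^ k)" by (simp add: divide_inverse mult.commute)
  also have "\<dots> \<le> (\<Sum>k. inverse (fact k) * x ^ k)"
    using x summable_exp[of x] by (intro sum_le_suminf) auto
  also have "\<dots> = exp x" by (simp add: exp_def scaleR_conv_of_real divide_inverse)
  finally show ?thesis by (simp add: pos_divide_le_eq mult.commute)
qed

lemma power_exp_tendsto_0:
  fixes k :: real
  assumes k: "k > 0"
  shows "((\<lambda>\<tau>. \<tau> ^ n * exp (- (k * \<tau>))) \<longlongrightarrow> 0) at_top"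
proof -
  have "filterlim (\<lambda>\<tau>. k * \<tau>) at_top at_top"
    using k by (intro filterlim_tendsto_pos_mult_at_top[OF tendsto_const] filterlim_ident) auto
  from filterlim_compose[OF tendsto_power_div_exp_0[of n] this]
  have "((\<lambda>\<tau>. 1 / k ^ n * ((k * \<tau>) ^ n / exp (k * \<tau>))) \<longlongrightarrow> 1 / k ^ n * 0) at_top"
    by (intro tendsto_mult tendsto_const)
  moreover have "1 / k ^ n * ((k * \<tau>) ^ n / exp (k * \<tau>)) = \<tau> ^ n * exp (- (k * \<tau>))" for \<tau> :: real
    using k by (simp add: power_mult_distrib exp_minus divide_inverse)
  ultimately show ?thesis by simp
qed

lemma AE_eq_0_imp_eq_0:
  fixes g :: "real \<Rightarrow> complex"
  assumes "s < t" and g: "continuous_on {s..t} g" and ae: "AE x in lebesgue. x \<in> {s..t} \<longrightarrow> g x = 0" and x: "x \<in> {s..t}"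
  shows "g x = 0"
proof -
  have "has_ac_derivative_on (\<lambda>x. 0) g {s..t}"
  proof (rule has_ac_derivative_on_spike[OF has_ac_derivative_on_const])
    show "AE x in lebesgue. x \<in> {s..t} \<longrightarrow> 0 = g x" using ae by eventually_elim simp
  qed
  then show ?thesis by (rule has_ac_derivative_on_0_continuous[OF _ g assms(1) x])
qed

text \<open>The difference is \<open>m\<close> times continuously differentiable near
  \<open>b\<close> and vanishes to the right, so its derivatives up to order \<open>m\<close> vanish
  at \<open>b\<close>. The top derivative is small near \<open>b\<close> by continuity, and
  \<open>m\<close> integrations towards \<open>b\<close> contribute the power.\<close>

lemma C_near_diff_flat:
  assumes C: "C_near (int m) q b" "C_near (int m) qt b" and bc: "b < c"
    and ae: "AE x in lebesgue. x \<in> {b..c} \<longrightarrow> q x = qt x" and \<epsilon>: "\<epsilon> > 0"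
  shows "\<exists>\<delta>>0. AE x in lebesgue. x \<in> {b - \<delta>..b} \<longrightarrow> norm (qt x - q x) \<le> \<epsilon> * (b - x) ^ m"
proof -
  obtain e1 g1 D1 where e1: "e1 > 0" and g1: "AE x in lebesgue. x \<in> {b - e1<..<b + e1} \<longrightarrow> q x = g1 x"
    and D1: "\<forall>x\<in>{b - e1<..<b + e1}. D1 0 x = g1 x"
      "\<forall>k<m. \<forall>x\<in>{b - e1<..<b + e1}. (D1 k has_vector_derivative D1 (Suc k) x) (at x)"
      "\<forall>k\<le>m. continuous_on {b - e1<..<b + e1} (D1 k)"
    using C(1) unfolding C_near_def C_on_def by auto
  obtain e2 g2 D2 where e2: "e2 > 0" and g2: "AE x in lebesgue. x \<in> {b - e2<..<b + e2} \<longrightarrow> qt x = g2 x"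
    and D2: "\<forall>x\<in>{b - e2<..<b + e2}. D2 0 x = g2 x"
      "\<forall>k<m. \<forall>x\<in>{b - e2<..<b + e2}. (D2 k has_vector_derivative D2 (Suc k) x) (at x)"
      "\<forall>k\<le>m. continuous_on {b - e2<..<b + e2} (D2 k)"
    using C(2) unfolding C_near_def C_on_def by auto
  \<comment> \<open>The bound \<open>c - b\<close> keeps the right half of the neighbourhood where
    the potentials agree.\<close>
  define e where "e = min (min e1 e2) (c - b)"
  have e: "e > 0" using e1 e2 bc by (simp add: e_def)
  define U where "U = {b - e<..<b + e}"
  have U1: "U \<subseteq> {b - e1<..<b + e1}" and U2: "U \<subseteq> {b - e2<..<b + e2}" by (auto simp: U_def e_def)
  define D where "D k x = D2 k x - D1 k x" for k x
  have D0: "AE x in lebesgue. x \<in> U \<longrightarrow> qt x - q x = D 0 x"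
    using g1 g2
  proof eventually_elim
    case (elim x)
    show ?case
    proof
      assume x: "x \<in> U"
      then have "D1 0 x = g1 x" "D2 0 x = g2 x" using D1(1) D2(1) U1 U2 by blast+
      moreover have "q x = g1 x" "qt x = g2 x" using elim x U1 U2 by blast+
      ultimately show "qt x - q x = D 0 x" by (simp add: D_def)
    qed
  qed
  have Dd: "(D k has_vector_derivative D (Suc k) x) (at x)" if "k < m" "x \<in> U" for k x
    unfolding D_def using that D1(2) D2(2) U1 U2 by (intro has_vector_derivative_diff) blast+
  have Dc: "continuous_on U (D k)" if "k \<le> m" for k
    unfolding D_def using that D1(3) D2(3) U1 U2 by (intro continuous_on_diff) (blast intro: continuous_on_subset)+
  \<comment> \<open>For \<open>k = 0\<close> equality almost everywhere becomes equality everywhere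
    by continuity; the interval is open, so the derivatives vanish as well.\<close>
  have right: "D k x = 0" if "k \<le> m" "x \<in> {b<..<b + e}" for k x
    using that
  proof (induction k arbitrary: x)
    case 0
    define t where "t = (x + (b + e)) / 2"
    have t: "x < t" "t < b + e" using 0 by (auto simp: t_def)
    have sub: "{x..t} \<subseteq> U" using 0 t by (auto simp: U_def)
    show ?case
    proof (rule AE_eq_0_imp_eq_0[OF t(1)])
      show "continuous_on {x..t} (D 0)" by (rule continuous_on_subset[OF Dc sub]) simp
      show "AE x' in lebesgue. x' \<in> {x..t} \<longrightarrow> D 0 x' = 0"
        using D0 ae
      proof eventually_elim
        case (elim x')
        show ?case
        proof
          assume x': "x' \<in> {x..t}"
          then have "x' \<in> U" "x' \<in> {b..c}" using sub 0 t by (auto simp: e_def)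
          with elim show "D 0 x' = 0" by simp
        qed
      qed
    qed (use t in auto)
  next
    case (Suc k)
    have x: "x \<in> U" using Suc.prems by (auto simp: U_def)
    have "(D k has_vector_derivative D (Suc k) x) (at x)" using Suc.prems x by (intro Dd) auto
    moreover have "(D k has_vector_derivative 0) (at x)"
    proof (rule has_vector_derivative_transform_within_open[where f="\<lambda>x. 0" and S="{b<..<b + e}"])
      show "0 = D k y" if "y \<in> {b<..<b + e}" for y using Suc.IH[of y] Suc.prems that by simp
    qed (use Suc.prems in auto)
    ultimately show ?case by (rule vector_derivative_unique_at)
  qed
  have bU: "b \<in> U" using e by (simp add: U_def)
  have Db: "D k b = 0" if k: "k \<le> m" for k
  proof -
    have "isCont (D k) b" using Dc[OF k] bU by (simp add: U_def continuous_on_eq_continuous_at)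
    then have "(D k \<longlongrightarrow> D k b) (at_right b)" unfolding isCont_def by (rule filterlim_mono) (auto simp: at_le)
    moreover have "\<forall>\<^sub>F x in at_right b. D k x = 0"
      using eventually_at_right_real[of b "b + e"] e by (auto elim!: eventually_mono intro: right[OF k])
    then have "(D k \<longlongrightarrow> 0) (at_right b)" by (rule tendsto_eventually)
    ultimately show ?thesis using tendsto_unique trivial_limit_at_right_real by blast
  qed
  have "isCont (D m) b" using Dc[of m] bU by (simp add: U_def continuous_on_eq_continuous_at)
  then obtain d where d: "d > 0" "\<And>x. dist x b < d \<Longrightarrow> dist (D m x) (D m b) < \<epsilon>"
    using \<epsilon> unfolding continuous_at_eps_delta by metis
  define \<delta> where "\<delta> = min d e / 2"
  have \<delta>: "\<delta> > 0" "\<delta> < d" "\<delta> < e" using d e by (auto simp: \<delta>_def)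
  \<comment> \<open>Induction on the number \<open>j\<close> of integrations, starting from the top
    derivative \<open>D m\<close>.\<close>
  have bound: "norm (D (m - j) x) \<le> \<epsilon> * (b - x) ^ j" if "j \<le> m" "x \<in> {b - \<delta>..b}" for j x
    using that
  proof (induction j arbitrary: x)
    case 0
    then show ?case using d(2)[of x] \<delta> Db[of m] by (simp add: dist_norm less_imp_le)
  next
    case (Suc j)
    define k where "k = m - Suc j"
    have k: "Suc k = m - j" "k < m" using Suc.prems by (auto simp: k_def)
    have "((D (Suc k)) has_integral (D k b - D k x)) {x..b}"
    proof (rule fundamental_theorem_of_calculus)
      show "x \<le> b" using Suc.prems(2) by simp
      fix y assume "y \<in> {x..b}"
      then have "y \<in> U" using Suc.prems(2) \<delta>(1,3) by (simp add: U_def)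
      then show "(D k has_vector_derivative D (Suc k) y) (at y within {x..b})"
        by (rule has_vector_derivative_at_within[OF Dd[OF k(2)]])
    qed
    moreover have "norm (D (Suc k) y) \<le> \<epsilon> * (b - x) ^ j" if y: "y \<in> {x..b}" for y
    proof -
      have "norm (D (Suc k) y) \<le> \<epsilon> * (b - y) ^ j" unfolding k(1) using Suc.prems y by (intro Suc.IH) simp_all
      also have "\<dots> \<le> \<epsilon> * (b - x) ^ j" using y \<epsilon> by (intro mult_left_mono power_mono) auto
      finally show ?thesis .
    qed
    ultimately have "norm (D k b - D k x) \<le> (\<epsilon> * (b - x) ^ j) * measure lborel {x..b}"
      using \<epsilon> Suc.prems by (intro has_integral_bound_real) auto
    then show ?case using Db[of k] k Suc.prems by (simp add: k_def mult.assoc mult.commute)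
  qed
  have "AE x in lebesgue. x \<in> {b - \<delta>..b} \<longrightarrow> norm (qt x - q x) \<le> \<epsilon> * (b - x) ^ m"
    using D0
  proof eventually_elim
    case (elim x)
    show ?case
    proof
      assume x: "x \<in> {b - \<delta>..b}"
      then have "x \<in> U" using \<delta> e by (auto simp: U_def)
      with elim show "norm (qt x - q x) \<le> \<epsilon> * (b - x) ^ m" using bound[of m x] x by simp
    qed
  qed
  then show ?thesis using \<delta> by blast
qed

lemma exp_weight_integrable:
  fixes w :: "real \<Rightarrow> complex" and k :: real
  assumes "w absolutely_integrable_on {a..b}"
  shows "(\<lambda>x. norm (w x) * exp (k * (b - x))) integrable_on {a..b}"
proof -
  have "(\<lambda>x. of_real (exp (k * (b - x))) * w x) absolutely_integrable_on {a..b}"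
    by (intro absolutely_integrable_continuous_mult continuous_intros assms)
  from absolutely_integrable_norm_on[OF this] show ?thesis by (simp add: norm_mult mult.commute)
qed

text \<open>At a distance \<delta> from \<open>b\<close> the weight is at most
  \<open>exp (- 2 * \<delta> * \<tau>)\<close>, which beats any power of \<tau>; only an arbitrarily
  short piece next to \<open>b\<close> matters, and \<open>near\<close> controls it.\<close>

lemma weighted_integral_tendsto_0:
  fixes w :: "real \<Rightarrow> complex"
  assumes w: "w absolutely_integrable_on {a..b}" and ab: "a < b"
    and near: "\<And>\<epsilon>. \<epsilon> > 0 \<Longrightarrow> \<exists>\<delta>>0. \<delta> \<le> b - a \<and> (\<forall>\<tau>>0. \<tau> ^ n * integral {b - \<delta>..b} (\<lambda>x. norm (w x) * exp (- 2 * \<tau> * (b - x))) \<le> \<epsilon>)"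
  shows "((\<lambda>\<tau>. \<tau> ^ n * integral {a..b} (\<lambda>x. norm (w x) * exp (- 2 * \<tau> * (b - x)))) \<longlongrightarrow> 0) at_top"
proof (rule tendstoI)
  fix \<epsilon> :: real assume \<epsilon>: "\<epsilon> > 0"
  obtain \<delta> where \<delta>: "\<delta> > 0" "\<delta> \<le> b - a"
    and nr: "\<And>\<tau>. \<tau> > 0 \<Longrightarrow> \<tau> ^ n * integral {b - \<delta>..b} (\<lambda>x. norm (w x) * exp (- 2 * \<tau> * (b - x))) \<le> \<epsilon> / 2"
    using near[of "\<epsilon> / 2"] \<epsilon> by auto
  define I where "I = integral {a..b} (\<lambda>x. norm (w x))"
  note iw = absolutely_integrable_norm_on[OF w]
  have I: "I \<ge> 0" unfolding I_def by (intro Henstock_Kurzweil_Integration.integral_nonneg iw) auto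
  have far: "((\<lambda>\<tau>. \<tau> ^ n * exp (- 2 * \<delta> * \<tau>) * I) \<longlongrightarrow> 0) at_top"
  proof -
    have "((\<lambda>\<tau>. \<tau> ^ n * exp (- 2 * \<delta> * \<tau>)) \<longlongrightarrow> 0) at_top"
      using power_exp_tendsto_0[of "2 * \<delta>" n] \<delta>(1) by simp
    from tendsto_mult_right[OF this, of I] show ?thesis by (simp add: mult.commute)
  qed
  have "\<forall>\<^sub>F \<tau> in at_top. \<tau> ^ n * exp (- 2 * \<delta> * \<tau>) * I < \<epsilon> / 2"
    using order_tendstoD(2)[OF far, of "\<epsilon> / 2"] \<epsilon> by simp
  then show "\<forall>\<^sub>F \<tau> in at_top. dist (\<tau> ^ n * integral {a..b} (\<lambda>x. norm (w x) * exp (- 2 * \<tau> * (b - x)))) 0 < \<epsilon>"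
    using eventually_gt_at_top[of 0]
  proof eventually_elim
    case (elim \<tau>)
    define f where "f x = norm (w x) * exp (- 2 * \<tau> * (b - x))" for x
    have fi: "f integrable_on {a..b}" unfolding f_def using exp_weight_integrable[OF w, of "- 2 * \<tau>"] by simp
    have f0: "0 \<le> f x" for x by (simp add: f_def)
    have f1: "f integrable_on {a..b - \<delta>}" "f integrable_on {b - \<delta>..b}" "(\<lambda>x. norm (w x)) integrable_on {a..b - \<delta>}"
      using \<delta> by (auto intro!: integrable_subinterval_real[OF fi] integrable_subinterval_real[OF iw])
    have split: "integral {a..b} f = integral {a..b - \<delta>} f + integral {b - \<delta>..b} f"
      using \<delta> fi by (intro Henstock_Kurzweil_Integration.integral_combine[symmetric]) auto
    have "integral {a..b - \<delta>} f \<le> integral {a..b - \<delta>} (\<lambda>x. exp (- 2 * \<delta> * \<tau>) * norm (w x))"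
    proof (intro integral_le f1 integrable_on_mult_right)
      fix x assume x: "x \<in> {a..b - \<delta>}"
      have "\<tau> * \<delta> \<le> \<tau> * (b - x)" using x elim by (intro mult_left_mono) auto
      then have "exp (- 2 * \<tau> * (b - x)) \<le> exp (- 2 * \<delta> * \<tau>)" by (simp add: mult.commute)
      then show "f x \<le> exp (- 2 * \<delta> * \<tau>) * norm (w x)"
        unfolding f_def by (subst mult.commute) (intro mult_right_mono norm_ge_zero)
    qed
    also have "\<dots> = exp (- 2 * \<delta> * \<tau>) * integral {a..b - \<delta>} (\<lambda>x. norm (w x))" by simp
    also have "\<dots> \<le> exp (- 2 * \<delta> * \<tau>) * I"
      unfolding I_def using \<delta> by (intro mult_left_mono integral_subset_le f1 iw) auto
    finally have "\<tau> ^ n * integral {a..b - \<delta>} f \<le> \<tau> ^ n * (exp (- 2 * \<delta> * \<tau>) * I)"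
      using elim by (intro mult_left_mono) auto
    also have "\<dots> < \<epsilon> / 2" using elim(1) by (simp add: mult.assoc)
    finally have "\<tau> ^ n * integral {a..b} f < \<epsilon>"
      using nr[OF elim(2)] unfolding split f_def by (simp add: distrib_left)
    moreover have "0 \<le> \<tau> ^ n * integral {a..b} f"
      using elim f0 by (intro mult_nonneg_nonneg Henstock_Kurzweil_Integration.integral_nonneg fi) auto
    ultimately show ?case unfolding f_def by simp
  qed
qed

text \<open>Continuity of the indefinite integral makes the piece next to \<open>b\<close> small
  uniformly in \<tau>. This serves the case \<open>m = -1\<close> and the left interval in
  \<open>jump_coefficients_eq\<close>; \<open>\<tau> ^ 0\<close> matches the shape of
  \<open>weighted_integral_tendsto_0\<close>.\<close>

lemma near_endpoint_integrable:
  fixes w :: "real \<Rightarrow> complex"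
  assumes w: "w absolutely_integrable_on {a..b}" and ab: "a < b" and \<epsilon>: "\<epsilon> > 0"
  shows "\<exists>\<delta>>0. \<delta> \<le> b - a \<and> (\<forall>\<tau>>0. \<tau> ^ 0 * integral {b - \<delta>..b} (\<lambda>x. norm (w x) * exp (- 2 * \<tau> * (b - x))) \<le> \<epsilon>)"
proof -
  note iw = absolutely_integrable_norm_on[OF w]
  obtain d where d: "d > 0" "\<And>t. b - d < t \<Longrightarrow> t \<le> b \<Longrightarrow> norm (integral {a..b} (\<lambda>x. norm (w x)) - integral {a..t} (\<lambda>x. norm (w x))) < \<epsilon>"
    using indefinite_integral_continuous_left[OF iw ab order_refl \<epsilon>] by metis
  define \<delta> where "\<delta> = min (d / 2) (b - a)"
  have \<delta>: "\<delta> > 0" "\<delta> \<le> b - a" "\<delta> < d" using d ab by (auto simp: \<delta>_def)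
  have "integral {a..b - \<delta>} (\<lambda>x. norm (w x)) + integral {b - \<delta>..b} (\<lambda>x. norm (w x)) = integral {a..b} (\<lambda>x. norm (w x))"
    using \<delta> iw by (intro Henstock_Kurzweil_Integration.integral_combine) auto
  with d(2)[of "b - \<delta>"] \<delta> have small: "integral {b - \<delta>..b} (\<lambda>x. norm (w x)) \<le> \<epsilon>" by (simp add: abs_le_iff)
  have sub: "{b - \<delta>..b} \<subseteq> {a..b}" using \<delta> by auto
  have "integral {b - \<delta>..b} (\<lambda>x. norm (w x) * exp (- 2 * \<tau> * (b - x))) \<le> \<epsilon>" if \<tau>: "\<tau> > 0" for \<tau> :: real
  proof -
    have "integral {b - \<delta>..b} (\<lambda>x. norm (w x) * exp (- 2 * \<tau> * (b - x))) \<le> integral {b - \<delta>..b} (\<lambda>x. norm (w x))"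
    proof (rule integral_le)
      show "(\<lambda>x. norm (w x) * exp (- 2 * \<tau> * (b - x))) integrable_on {b - \<delta>..b}"
        by (rule integrable_subinterval_real[OF exp_weight_integrable[OF w] sub])
      show "(\<lambda>x. norm (w x)) integrable_on {b - \<delta>..b}" by (rule integrable_subinterval_real[OF iw sub])
      show "norm (w x) * exp (- 2 * \<tau> * (b - x)) \<le> norm (w x)" if "x \<in> {b - \<delta>..b}" for x
        using that \<tau> by (intro mult_left_le) auto
    qed
    with small show ?thesis by simp
  qed
  then show ?thesis using \<delta> by auto
qed

text \<open>With \<open>s = b - x\<close>, half of the weight \<open>exp (- 2 * \<tau> * s)\<close>
  absorbs \<open>(\<tau> * s) ^ n \<le> fact n * exp (\<tau> * s)\<close>, whence
  \<open>e = \<epsilon> / fact n\<close>; the other half has integral at most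
  \<open>1 / \<tau>\<close>, which yields one more power.\<close>

lemma near_endpoint_flat:
  fixes w :: "real \<Rightarrow> complex"
  assumes w: "w absolutely_integrable_on {a..b}" and ab: "a < b" and \<epsilon>: "\<epsilon> > 0"
    and flat: "\<And>\<epsilon>. \<epsilon> > 0 \<Longrightarrow> \<exists>\<delta>>0. AE x in lebesgue. x \<in> {b - \<delta>..b} \<longrightarrow> norm (w x) \<le> \<epsilon> * (b - x) ^ n"
  shows "\<exists>\<delta>>0. \<delta> \<le> b - a \<and> (\<forall>\<tau>>0. \<tau> ^ Suc n * integral {b - \<delta>..b} (\<lambda>x. norm (w x) * exp (- 2 * \<tau> * (b - x))) \<le> \<epsilon>)"
proof -
  define e where "e = \<epsilon> / fact n"
  have e: "e > 0" using \<epsilon> by (simp add: e_def)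
  from flat[OF e] obtain \<delta>' where \<delta>': "\<delta>' > 0" and ae': "AE x in lebesgue. x \<in> {b - \<delta>'..b} \<longrightarrow> norm (w x) \<le> e * (b - x) ^ n"
    by blast
  define \<delta> where "\<delta> = min \<delta>' (b - a)"
  have \<delta>: "\<delta> > 0" "\<delta> \<le> b - a" "\<delta> \<le> \<delta>'" using \<delta>' ab by (auto simp: \<delta>_def)
  have sub: "{b - \<delta>..b} \<subseteq> {a..b}" using \<delta> by auto
  have "AE x in lebesgue. x \<in> {b - \<delta>..b} \<longrightarrow> norm (w x) \<le> e * (b - x) ^ n"
    using ae' by eventually_elim (use \<delta> in auto)
  then obtain Z where Z: "negligible Z" "\<And>x. x \<notin> Z \<Longrightarrow> x \<in> {b - \<delta>..b} \<Longrightarrow> norm (w x) \<le> e * (b - x) ^ n"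
    unfolding eventually_ae_filter_negligible by blast
  have "\<tau> ^ Suc n * integral {b - \<delta>..b} (\<lambda>x. norm (w x) * exp (- 2 * \<tau> * (b - x))) \<le> \<epsilon>" if \<tau>: "\<tau> > 0" for \<tau> :: real
  proof -
    define f where "f x = norm (w x) * exp (- 2 * \<tau> * (b - x))" for x
    \<comment> \<open>Zero on the exceptional null set, so that the comparison holds at every
      point.\<close>
    define g where "g x = (if x \<in> Z then 0 else f x)" for x
    define F where "F x = exp (- \<tau> * (b - x)) / \<tau>" for x
    have fi: "f integrable_on {b - \<delta>..b}"
      unfolding f_def by (rule integrable_subinterval_real[OF exp_weight_integrable[OF w] sub])
    have gi: "g integrable_on {b - \<delta>..b}" by (rule integrable_spike[OF fi Z(1)]) (simp add: g_def)
    have eq: "integral {b - \<delta>..b} f = integral {b - \<delta>..b} g"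
      by (rule integral_spike[OF Z(1)]) (simp add: g_def)
    have hi: "((\<lambda>x. exp (- \<tau> * (b - x))) has_integral (F b - F (b - \<delta>))) {b - \<delta>..b}"
    proof (rule fundamental_theorem_of_calculus)
      fix x
      have "(F has_real_derivative exp (- \<tau> * (b - x))) (at x)"
        unfolding F_def using \<tau> by (auto intro!: derivative_eq_intros)
      then show "(F has_vector_derivative exp (- \<tau> * (b - x))) (at x within {b - \<delta>..b})"
        by (rule has_vector_derivative_at_within[OF has_real_derivative_iff_has_vector_derivative[THEN iffD1]])
    qed (use \<delta> in simp)
    have "integral {b - \<delta>..b} g \<le> integral {b - \<delta>..b} (\<lambda>x. (\<epsilon> / \<tau> ^ n) * exp (- \<tau> * (b - x)))"
    proof (intro integral_le gi integrable_on_mult_right)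
      show "(\<lambda>x. exp (- \<tau> * (b - x))) integrable_on {b - \<delta>..b}" using hi by blast
      fix x assume x: "x \<in> {b - \<delta>..b}"
      define s where "s = b - x"
      have s: "s \<ge> 0" using x by (simp add: s_def)
      have "(\<tau> * s) ^ n \<le> fact n * exp (\<tau> * s)" using s \<tau> by (intro power_le_fact_exp) auto
      then have "e * (\<tau> * s) ^ n \<le> e * (fact n * exp (\<tau> * s))" using e by (intro mult_left_mono) auto
      then have "e * s ^ n \<le> (\<epsilon> / \<tau> ^ n) * exp (\<tau> * s)"
        using \<tau> by (simp add: e_def power_mult_distrib field_simps)
      from mult_right_mono[OF this, of "exp (- 2 * \<tau> * s)"]
      have *: "e * s ^ n * exp (- 2 * \<tau> * s) \<le> (\<epsilon> / \<tau> ^ n) * exp (- \<tau> * s)"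
        by (simp add: mult.assoc flip: exp_add)
      show "g x \<le> (\<epsilon> / \<tau> ^ n) * exp (- \<tau> * (b - x))"
      proof (cases "x \<in> Z")
        case True then show ?thesis using \<epsilon> \<tau> by (simp add: g_def)
      next
        case False
        have "g x \<le> e * s ^ n * exp (- 2 * \<tau> * s)"
          using Z(2)[OF False x] False by (simp add: g_def f_def s_def mult_right_mono)
        with * show ?thesis by (simp add: s_def)
      qed
    qed
    also have "\<dots> = (\<epsilon> / \<tau> ^ n) * (F b - F (b - \<delta>))" using hi by (simp add: integral_unique)
    also have "\<dots> \<le> (\<epsilon> / \<tau> ^ n) * (1 / \<tau>)" using \<epsilon> \<tau> by (intro mult_left_mono) (auto simp: F_def)
    finally have "integral {b - \<delta>..b} f \<le> \<epsilon> / \<tau> ^ Suc n" using \<tau> by (simp add: eq field_simps)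
    then have "\<tau> ^ Suc n * integral {b - \<delta>..b} f \<le> \<tau> ^ Suc n * (\<epsilon> / \<tau> ^ Suc n)"
      using \<tau> by (intro mult_left_mono) auto
    also have "\<dots> = \<epsilon>" using \<tau> by simp
    finally show ?thesis unfolding f_def[abs_def] .
  qed
  then show ?thesis using \<delta> by blast
qed

text \<open>Lagrange's identity from \<open>a\<close> to \<open>b\<close>, with
  \<open>exp (2 * \<tau> * x)\<close> written as \<open>exp (2 * \<tau> * b)\<close> times a weight
  that decays away from \<open>b\<close>.\<close>

lemma wronskian_bound:
  fixes q qt :: "real \<Rightarrow> complex" and K \<tau> a b :: real
  assumes ab: "a \<le> b" and y: "sol (\<lambda>x. q x - \<mu>) a b y p" "sol (\<lambda>x. qt x - \<mu>) a b yt pt"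
    and w: "(\<lambda>x. qt x - q x) absolutely_integrable_on {a..b}"
    and bd: "\<And>x. x \<in> {a..b} \<Longrightarrow> norm (y x) \<le> K * exp (\<tau> * x)" "\<And>x. x \<in> {a..b} \<Longrightarrow> norm (yt x) \<le> K * exp (\<tau> * x)"
  shows "norm (y b * pt b - p b * yt b) \<le> norm (y a * pt a - p a * yt a) +
     K\<^sup>2 * exp (2 * \<tau> * b) * integral {a..b} (\<lambda>x. norm (qt x - q x) * exp (- 2 * \<tau> * (b - x)))"
proof -
  have bb: "b \<in> {a..b}" using ab by simp
  have "y b * pt b - p b * yt b = y a * pt a - p a * yt a + integral {a..b} (\<lambda>x. (qt x - q x) * (y x * yt x))"
    using wronskian_eq[OF y bb] by simp
  also have "norm \<dots> \<le> norm (y a * pt a - p a * yt a) + norm (integral {a..b} (\<lambda>x. (qt x - q x) * (y x * yt x)))"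
    by (rule norm_triangle_ineq)
  also have "norm (integral {a..b} (\<lambda>x. (qt x - q x) * (y x * yt x))) \<le>
     integral {a..b} (\<lambda>x. (K\<^sup>2 * exp (2 * \<tau> * b)) * (norm (qt x - q x) * exp (- 2 * \<tau> * (b - x))))"
  proof (rule norm_integral_le)
    have "(\<lambda>x. (y x * yt x) * (qt x - q x)) absolutely_integrable_on {a..b}"
      by (intro absolutely_integrable_continuous_mult continuous_intros sol_continuous(1)[OF y(1)] sol_continuous(1)[OF y(2)] w)
    then show "(\<lambda>x. (qt x - q x) * (y x * yt x)) absolutely_integrable_on {a..b}" by (simp add: mult.commute)
    show "(\<lambda>x. (K\<^sup>2 * exp (2 * \<tau> * b)) * (norm (qt x - q x) * exp (- 2 * \<tau> * (b - x)))) integrable_on {a..b}"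
      by (intro integrable_on_mult_right exp_weight_integrable[OF w])
    fix x assume x: "x \<in> {a..b}"
    have "norm (y x) * norm (yt x) \<le> (K * exp (\<tau> * x)) * (K * exp (\<tau> * x))"
      using bd[OF x] order_trans[OF norm_ge_zero bd(1)[OF x]] by (intro mult_mono) auto
    also have "\<dots> = K\<^sup>2 * (exp (2 * \<tau> * b) * exp (- 2 * \<tau> * (b - x)))"
      by (simp add: power2_eq_square algebra_simps flip: exp_add)
    finally have "norm (qt x - q x) * (norm (y x) * norm (yt x)) \<le>
       norm (qt x - q x) * (K\<^sup>2 * (exp (2 * \<tau> * b) * exp (- 2 * \<tau> * (b - x))))"
      by (rule mult_left_mono) simp
    then show "norm ((qt x - q x) * (y x * yt x)) \<le> (K\<^sup>2 * exp (2 * \<tau> * b)) * (norm (qt x - q x) * exp (- 2 * \<tau> * (b - x)))"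
      by (simp only: norm_mult mult.assoc mult.left_commute)
  qed
  finally show ?thesis by simp
qed

section \<open>Comparing powers of \<rho> until the quotient vanishes\<close>

lemma prod_quadratic_bound:
  fixes lam :: "nat \<Rightarrow> complex"
  assumes "finite L"
  obtains C where "C \<ge> 0" "\<And>\<rho>. norm \<rho> \<ge> 1 \<Longrightarrow> norm (\<Prod>n\<in>L. \<rho>\<^sup>2 - lam n) \<le> C * norm \<rho> ^ (2 * card L)"
proof -
  have "norm (\<Prod>n\<in>L. \<rho>\<^sup>2 - lam n) \<le> (\<Prod>n\<in>L. 1 + norm (lam n)) * norm \<rho> ^ (2 * card L)" if \<rho>: "norm \<rho> \<ge> 1" for \<rho>
  proof -
    have "norm (\<Prod>n\<in>L. \<rho>\<^sup>2 - lam n) = (\<Prod>n\<in>L. norm (\<rho>\<^sup>2 - lam n))" by (simp add: prod_norm)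
    also have "\<dots> \<le> (\<Prod>n\<in>L. (1 + norm (lam n)) * (norm \<rho>)\<^sup>2)"
    proof (intro prod_mono conjI norm_ge_zero)
      fix n assume "n \<in> L"
      have "norm (\<rho>\<^sup>2 - lam n) \<le> (norm \<rho>)\<^sup>2 + norm (lam n) * 1"
        using norm_triangle_ineq4[of "\<rho>\<^sup>2" "lam n"] by (simp add: norm_power)
      also have "\<dots> \<le> (norm \<rho>)\<^sup>2 + norm (lam n) * (norm \<rho>)\<^sup>2"
        using \<rho> by (intro add_left_mono mult_left_mono) auto
      finally show "norm (\<rho>\<^sup>2 - lam n) \<le> (1 + norm (lam n)) * (norm \<rho>)\<^sup>2" by (simp add: algebra_simps)
    qed
    also have "\<dots> = (\<Prod>n\<in>L. 1 + norm (lam n)) * norm \<rho> ^ (2 * card L)"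
      by (simp add: prod.distrib power_mult)
    finally show ?thesis .
  qed
  moreover have "0 \<le> (\<Prod>n\<in>L. 1 + norm (lam n))" by (intro prod_nonneg) auto
  ultimately show ?thesis using that by blast
qed

lemma holomorphic_eq_0_if_eventually:
  assumes f: "f holomorphic_on UNIV" and S: "open S" "S \<noteq> {}" and 0: "\<And>z. z \<in> S \<Longrightarrow> f z = 0"
  shows "f z = 0"
  by (rule analytic_continuation_open[OF S(1) open_UNIV S(2) connected_UNIV _ f holomorphic_on_const]) (use 0 in auto)

text \<open>In \<open>Q = F * P / D\<close> the exponentials cancel, which leaves a power of
  \<open>norm \<rho>\<close> on the squares. On the imaginary axis the decay of \<open>F\<close>
  leaves a null function times the power \<open>2 * card L - M - j\<close> of \<tau>, and
  \<open>card\<close> says that this exponent is not positive.\<close>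

lemma quotient_vanishes:
  fixes F D Q :: "complex \<Rightarrow> complex" and s \<kappa> k0 K c :: real and L :: "nat set" and lam :: "nat \<Rightarrow> complex"
  defines "r \<equiv> \<lambda>N::nat. (real N + s) * \<kappa>"
  assumes hol: "Q holomorphic_on UNIV" "F holomorphic_on UNIV" "D holomorphic_on UNIV" and L: "finite L"
    and Q: "\<And>z. D z \<noteq> 0 \<Longrightarrow> Q z = F z * (\<Prod>n\<in>L. z - lam n) / D z"
    and pos: "s \<ge> 0" "\<kappa> > 0" "k0 > 0"
    and r1: "\<And>N. N \<ge> N0 \<Longrightarrow> r N \<ge> 1"
    and lower: "\<And>N \<rho>. N \<ge> N0 \<Longrightarrow> on_square (r N) \<rho> \<Longrightarrow> k0 * (norm \<rho> ^ j * exp (\<bar>Im \<rho>\<bar> * c)) \<le> norm (D (\<rho>\<^sup>2))"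
    and upper: "\<And>N \<rho>. N \<ge> N0 \<Longrightarrow> on_square (r N) \<rho> \<Longrightarrow> norm (F (\<rho>\<^sup>2)) \<le> K * norm \<rho> * exp (\<bar>Im \<rho>\<bar> * c)"
    and decay: "((\<lambda>\<tau>. \<tau> ^ M * norm (F ((\<i> * of_real \<tau>)\<^sup>2)) * exp (- \<tau> * c)) \<longlongrightarrow> 0) at_top"
    and card: "2 * card L \<le> M + j"
  shows "F z = 0"
proof -
  obtain C where C: "C \<ge> 0" "\<And>\<rho>. norm \<rho> \<ge> 1 \<Longrightarrow> norm (\<Prod>n\<in>L. \<rho>\<^sup>2 - lam n) \<le> C * norm \<rho> ^ (2 * card L)"
    by (rule prod_quadratic_bound[OF L]) (rule that)
  have n1: "norm \<rho> \<ge> 1" if "N \<ge> N0" "on_square (r N) \<rho>" for N \<rho>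
    using r1[OF that(1)] norm_ge_on_square[OF that(2)] by simp
  have D0: "D (\<rho>\<^sup>2) \<noteq> 0" if "N \<ge> N0" "on_square (r N) \<rho>" for N \<rho>
  proof -
    have "0 < norm \<rho>" using n1[OF that] by linarith
    then have "0 < k0 * (norm \<rho> ^ j * exp (\<bar>Im \<rho>\<bar> * c))" using pos by (intro mult_pos_pos zero_less_power) auto
    with lower[OF that] show ?thesis by auto
  qed
  have Qb: "norm (Q (\<rho>\<^sup>2)) \<le> C / k0 * (norm (F (\<rho>\<^sup>2)) * exp (- (\<bar>Im \<rho>\<bar> * c)) * (norm \<rho> ^ (2 * card L) / norm \<rho> ^ j))"
    if N: "N \<ge> N0" "on_square (r N) \<rho>" for N \<rho>
  proof -
    have r0: "norm \<rho> > 0" using n1[OF N] by linarith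
    have "norm (Q (\<rho>\<^sup>2)) = norm (F (\<rho>\<^sup>2)) * norm (\<Prod>n\<in>L. \<rho>\<^sup>2 - lam n) / norm (D (\<rho>\<^sup>2))"
      using Q[OF D0[OF N]] by (simp add: norm_mult norm_divide)
    also have "\<dots> \<le> norm (F (\<rho>\<^sup>2)) * (C * norm \<rho> ^ (2 * card L)) / (k0 * (norm \<rho> ^ j * exp (\<bar>Im \<rho>\<bar> * c)))"
      using pos r0 C n1[OF N] lower[OF N] by (intro frac_le mult_left_mono mult_nonneg_nonneg mult_pos_pos zero_less_power) auto
    also have "\<dots> = C / k0 * (norm (F (\<rho>\<^sup>2)) * exp (- (\<bar>Im \<rho>\<bar> * c)) * (norm \<rho> ^ (2 * card L) / norm \<rho> ^ j))"
      by (simp add: exp_minus divide_inverse)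
    finally show ?thesis .
  qed
  \<comment> \<open>The exponent \<open>2 * card L + 1\<close> comes from the product and the factor
    \<open>norm \<rho>\<close> in \<open>upper\<close>. Here \<open>norm \<rho> ^ j \<ge> 1\<close>
    is estimated crudely, since any polynomial bound will do; the exact power counts only on the
    imaginary axis. The powers of 2 come from \<open>norm \<rho> \<le> 2 * r N\<close>.\<close>
  have Q0: "Q (z\<^sup>2) = 0" for z
  proof (rule entire_eq_0_by_squares[where g="\<lambda>z. Q (z\<^sup>2)" and s=s and \<kappa>=\<kappa> and ?N0.0=N0 and n="2 * card L + 1"
        and C="C / k0 * (K * 2 ^ (2 * card L + 1))"])
    have "Q \<circ> (\<lambda>z. z\<^sup>2) holomorphic_on UNIV"
      by (rule holomorphic_on_compose_gen[OF _ hol(1)]) (intro holomorphic_intros, simp)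
    then show "(\<lambda>z. Q (z\<^sup>2)) holomorphic_on UNIV" by (simp add: o_def)
    fix N \<rho> assume N: "N \<ge> N0" and sq: "on_square ((real N + s) * \<kappa>) \<rho>"
    have sq': "on_square (r N) \<rho>" using sq by (simp add: r_def)
    note n = n1[OF N sq']
    have Fe: "norm (F (\<rho>\<^sup>2)) * exp (- (\<bar>Im \<rho>\<bar> * c)) \<le> K * norm \<rho>"
      using mult_right_mono[OF upper[OF N sq'], of "exp (- (\<bar>Im \<rho>\<bar> * c))"] by (simp add: mult.assoc flip: exp_add)
    then have K0: "K \<ge> 0" using n by (metis exp_ge_zero mult_nonneg_nonneg norm_ge_zero order_trans zero_le_mult_iff less_le_trans not_le zero_less_one)
    have "norm (Q (\<rho>\<^sup>2)) \<le> C / k0 * (norm (F (\<rho>\<^sup>2)) * exp (- (\<bar>Im \<rho>\<bar> * c)) * (norm \<rho> ^ (2 * card L) / norm \<rho> ^ j))"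
      by (rule Qb[OF N sq'])
    also have "\<dots> \<le> C / k0 * ((K * norm \<rho>) * (norm \<rho> ^ (2 * card L) / 1))"
    proof -
      have "norm \<rho> ^ j \<ge> 1" using n by (rule one_le_power)
      then have B: "norm \<rho> ^ (2 * card L) / norm \<rho> ^ j \<le> norm \<rho> ^ (2 * card L) / 1"
        by (intro divide_left_mono) auto
      show ?thesis using C(1) pos(3) K0 by (intro mult_left_mono mult_mono[OF Fe B]) auto
    qed
    also have "\<dots> = C / k0 * (K * norm \<rho> ^ (2 * card L + 1))" by simp
    also have "\<dots> \<le> C / k0 * (K * (2 * r N) ^ (2 * card L + 1))"
      using C pos K0 norm_le_on_square[OF sq'] by (intro mult_left_mono power_mono) auto
    also have "\<dots> = C / k0 * (K * 2 ^ (2 * card L + 1)) * r N ^ (2 * card L + 1)"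
      unfolding power_mult_distrib by simp
    finally show "norm (Q (\<rho>\<^sup>2)) \<le> C / k0 * (K * 2 ^ (2 * card L + 1)) * ((real N + s) * \<kappa>) ^ (2 * card L + 1)"
      by (simp only: r_def)
  next
    have rt: "filterlim r at_top sequentially" unfolding r_def by (rule filterlim_arith_at_top[OF pos(2,1)])
    from tendsto_mult[OF tendsto_const[of "C / k0"] filterlim_compose[OF decay rt]]
    have lim: "(\<lambda>N. C / k0 * (r N ^ M * norm (F ((\<i> * of_real (r N))\<^sup>2)) * exp (- r N * c))) \<longlonglongrightarrow> 0" by simp
    show "(\<lambda>N. Q ((\<i> * of_real ((real N + s) * \<kappa>))\<^sup>2)) \<longlonglongrightarrow> 0"
    proof (rule Lim_null_comparison[OF _ lim], rule eventually_sequentiallyI)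
      fix N assume N: "N \<ge> N0"
      define \<rho> where "\<rho> = \<i> * complex_of_real (r N)"
      have r: "r N \<ge> 1" by (rule r1[OF N])
      have sq: "on_square (r N) \<rho>" using r by (simp add: \<rho>_def on_square_def)
      have n: "norm \<rho> = r N" "\<bar>Im \<rho>\<bar> = r N" using r by (simp_all add: \<rho>_def norm_mult)
      have "norm (Q (\<rho>\<^sup>2)) \<le> C / k0 * (norm (F (\<rho>\<^sup>2)) * exp (- (r N * c)) * (r N ^ (2 * card L) / r N ^ j))"
        using Qb[OF N sq] unfolding n .
      also have "\<dots> \<le> C / k0 * (norm (F (\<rho>\<^sup>2)) * exp (- (r N * c)) * r N ^ M)"
      proof (intro mult_left_mono)
        have "r N ^ (2 * card L) \<le> r N ^ (M + j)" using r card by (intro power_increasing) auto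
        then show "r N ^ (2 * card L) / r N ^ j \<le> r N ^ M" using r by (simp add: pos_divide_le_eq power_add)
      qed (use C pos in auto)
      finally have "norm (Q (\<rho>\<^sup>2)) \<le> C / k0 * (r N ^ M * norm (F (\<rho>\<^sup>2)) * exp (- r N * c))"
        by (simp add: mult.commute mult.left_commute)
      then show "norm (Q ((\<i> * of_real ((real N + s) * \<kappa>))\<^sup>2)) \<le> C / k0 * (r N ^ M * norm (F ((\<i> * of_real (r N))\<^sup>2)) * exp (- r N * c))"
        unfolding \<rho>_def r_def .
    qed
  qed (use pos in auto)
  \<comment> \<open>Every complex number is a square, so vanishing in the variable \<rho> is
    vanishing everywhere.\<close>
  have Qz: "Q z = 0" for z using Q0[of "csqrt z"] by simp
  define P where "P z = (\<Prod>n\<in>L. z - lam n)" for z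
  have P: "P holomorphic_on UNIV" unfolding P_def by (intro holomorphic_intros)
  \<comment> \<open>\<open>F * P\<close> vanishes on the nonempty open set where \<open>D\<close>
    does not, hence everywhere; the finitely many zeros of \<open>P\<close> are then removed in the
    same way.\<close>
  have FP0: "F z * P z = 0" for z
  proof (rule holomorphic_eq_0_if_eventually[of "\<lambda>z. F z * P z"])
    show "(\<lambda>z. F z * P z) holomorphic_on UNIV" by (intro holomorphic_intros hol P)
    show "open {z. D z \<noteq> 0}"
      using hol(3) by (intro open_Collect_neq holomorphic_on_imp_continuous_on) (auto intro: holomorphic_intros)
    have "on_square (r N0) (of_real (r N0))" using r1[of N0] by (simp add: on_square_def)
    from D0[OF order_refl this] show "{z. D z \<noteq> 0} \<noteq> {}" by blast
    show "F z * P z = 0" if "z \<in> {z. D z \<noteq> 0}" for z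
      using Q[of z] Qz[of z] that by (simp add: P_def)
  qed
  show "F z = 0"
  proof (rule holomorphic_eq_0_if_eventually[OF hol(2)])
    show "open (- (lam ` L))" using L by (simp add: finite_imp_closed open_Compl)
    show "- (lam ` L) \<noteq> {}" using L by (metis Compl_empty_eq double_complement finite_imageI infinite_UNIV_char_0)
    fix z assume "z \<in> - (lam ` L)"
    then have "P z \<noteq> 0" using L by (auto simp: P_def)
    then show "F z = 0" using FP0[of z] by simp
  qed
qed

section \<open>Relative growth on the squares and limits on the imaginary axis\<close>

context jump_problem
begin

text \<open>The upper bound at \<open>x\<close> divided by the lower bound at \<open>X\<close>; this
  is the growth hypothesis of \<open>borg_marchenko\<close> with base point
  \<open>X\<close>.\<close>

lemma comparison_Y2:
  assumes X: "X \<in> {d..c}"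
  obtains K R where "R \<ge> 1" "K \<ge> 0"
    "\<And>\<rho> r x. on_square r \<rho> \<Longrightarrow> r \<ge> R \<Longrightarrow> (cos (r * X))\<^sup>2 = 1 \<Longrightarrow> x \<in> {d..X} \<Longrightarrow>
       Y2 (\<rho>\<^sup>2) X \<noteq> 0 \<and> norm (Y2 (\<rho>\<^sup>2) x) \<le> K * exp (- (\<bar>Im \<rho>\<bar> * (X - x))) * norm (Y2 (\<rho>\<^sup>2) X)"
proof -
  obtain K R where R: "R \<ge> 1" and K: "K \<ge> 0"
    and U: "\<And>(\<rho>::complex) (x::real). norm \<rho> \<ge> R \<Longrightarrow> x \<in> {d..c} \<Longrightarrow> norm (Y2 (\<rho>\<^sup>2) x) \<le> K * exp (\<bar>Im \<rho>\<bar> * x)"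
    using upper_bounds by metis
  obtain k R' where k: "k > 0" "R' \<ge> 1" and Lo:
    "\<And>\<rho> r. on_square r \<rho> \<Longrightarrow> r \<ge> R' \<Longrightarrow> (cos (r * X))\<^sup>2 = 1 \<Longrightarrow> k * exp (\<bar>Im \<rho>\<bar> * X) \<le> norm (Y2 (\<rho>\<^sup>2) X)"
    using lower_bound_Y2[OF X] by metis
  show ?thesis
  proof (rule that[of "max R R'" "K / k"])
    fix \<rho> r x assume sq: "on_square r \<rho>" and r: "r \<ge> max R R'" and c: "(cos (r * X))\<^sup>2 = 1" and x: "x \<in> {d..X}"
    have l: "k * exp (\<bar>Im \<rho>\<bar> * X) \<le> norm (Y2 (\<rho>\<^sup>2) X)" using r by (intro Lo[OF sq _ c]) simp
    moreover have "k * exp (\<bar>Im \<rho>\<bar> * X) > 0" using k by simp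
    ultimately have "Y2 (\<rho>\<^sup>2) X \<noteq> 0" by auto
    have "norm (Y2 (\<rho>\<^sup>2) x) \<le> K * exp (\<bar>Im \<rho>\<bar> * x)"
      using r norm_ge_on_square[OF sq] x X by (intro U) auto
    also have "\<dots> = K / k * exp (- (\<bar>Im \<rho>\<bar> * (X - x))) * (k * exp (\<bar>Im \<rho>\<bar> * X))"
      using k by (simp add: algebra_simps flip: exp_add)
    also have "\<dots> \<le> K / k * exp (- (\<bar>Im \<rho>\<bar> * (X - x))) * norm (Y2 (\<rho>\<^sup>2) X)"
      using l K k by (intro mult_left_mono) auto
    finally show "Y2 (\<rho>\<^sup>2) X \<noteq> 0 \<and> norm (Y2 (\<rho>\<^sup>2) x) \<le> K / k * exp (- (\<bar>Im \<rho>\<bar> * (X - x))) * norm (Y2 (\<rho>\<^sup>2) X)"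
      using \<open>Y2 (\<rho>\<^sup>2) X \<noteq> 0\<close> by blast
  qed (use R K k in auto)
qed

lemma comparison_Y1:
  obtains K R where "R \<ge> 1" "K \<ge> 0"
    "\<And>\<rho> r x. on_square r \<rho> \<Longrightarrow> r \<ge> R \<Longrightarrow> (cos (r * d))\<^sup>2 = 1 \<Longrightarrow> x \<in> {0..d} \<Longrightarrow>
       Y1 (\<rho>\<^sup>2) d \<noteq> 0 \<and> norm (Y1 (\<rho>\<^sup>2) x) \<le> K * exp (- (\<bar>Im \<rho>\<bar> * (d - x))) * norm (Y1 (\<rho>\<^sup>2) d)"
proof -
  obtain K R where R: "R \<ge> 1" and K: "K \<ge> 0"
    and U: "\<And>(\<rho>::complex) (x::real). norm \<rho> \<ge> R \<Longrightarrow> x \<in> {0..d} \<Longrightarrow> norm (Y1 (\<rho>\<^sup>2) x) \<le> K * exp (\<bar>Im \<rho>\<bar> * x)"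
    using upper_bounds by metis
  obtain k R' where k: "k > 0" "R' \<ge> 1" and Lo:
    "\<And>\<rho> r. on_square r \<rho> \<Longrightarrow> r \<ge> R' \<Longrightarrow> (cos (r * d))\<^sup>2 = 1 \<Longrightarrow> k * exp (\<bar>Im \<rho>\<bar> * d) \<le> norm (Y1 (\<rho>\<^sup>2) d)"
    using lower_bound_Y1 by metis
  show ?thesis
  proof (rule that[of "max R R'" "K / k"])
    fix \<rho> r x assume sq: "on_square r \<rho>" and r: "r \<ge> max R R'" and c: "(cos (r * d))\<^sup>2 = 1" and x: "x \<in> {0..d}"
    have l: "k * exp (\<bar>Im \<rho>\<bar> * d) \<le> norm (Y1 (\<rho>\<^sup>2) d)" using r by (intro Lo[OF sq _ c]) simp
    moreover have "k * exp (\<bar>Im \<rho>\<bar> * d) > 0" using k by simp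
    ultimately have "Y1 (\<rho>\<^sup>2) d \<noteq> 0" by auto
    have "norm (Y1 (\<rho>\<^sup>2) x) \<le> K * exp (\<bar>Im \<rho>\<bar> * x)"
      using r norm_ge_on_square[OF sq] x by (intro U) auto
    also have "\<dots> = K / k * exp (- (\<bar>Im \<rho>\<bar> * (d - x))) * (k * exp (\<bar>Im \<rho>\<bar> * d))"
      using k by (simp add: algebra_simps flip: exp_add)
    also have "\<dots> \<le> K / k * exp (- (\<bar>Im \<rho>\<bar> * (d - x))) * norm (Y1 (\<rho>\<^sup>2) d)"
      using l K k by (intro mult_left_mono) auto
    finally show "Y1 (\<rho>\<^sup>2) d \<noteq> 0 \<and> norm (Y1 (\<rho>\<^sup>2) x) \<le> K / k * exp (- (\<bar>Im \<rho>\<bar> * (d - x))) * norm (Y1 (\<rho>\<^sup>2) d)"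
      using \<open>Y1 (\<rho>\<^sup>2) d \<noteq> 0\<close> by blast
  qed (use R K k in auto)
qed

text \<open>At \<rho> = \<open>\<i> * \<tau>\<close> the leading terms
  \<open>cos (\<rho> * d)\<close> and \<open>- \<rho> * sin (\<rho> * d)\<close> are
  \<open>cosh (\<tau> * d)\<close> and \<open>\<tau> * sinh (\<tau> * d)\<close>, which explains the
  two normalisations and the common limit.\<close>

lemma limits_imaginary_axis:
  "((\<lambda>\<tau>. Y1 ((\<i> * of_real \<tau>)\<^sup>2) d * of_real (exp (- \<tau> * d))) \<longlongrightarrow> 1 / 2) at_top"
  "((\<lambda>\<tau>. P1 ((\<i> * of_real \<tau>)\<^sup>2) d * of_real (exp (- \<tau> * d) / \<tau>)) \<longlongrightarrow> 1 / 2) at_top"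
proof -
  obtain K R where R: "R \<ge> 1" and K: "K \<ge> 0" and A1:
    "\<And>(\<rho>::complex) (x::real). norm \<rho> \<ge> R \<Longrightarrow> x \<in> {0..d} \<Longrightarrow>
       norm (Y1 (\<rho>\<^sup>2) x - cos (\<rho> * of_real x)) \<le> K * exp (\<bar>Im \<rho>\<bar> * x) / norm \<rho>" and A2:
    "\<And>(\<rho>::complex) (x::real). norm \<rho> \<ge> R \<Longrightarrow> x \<in> {0..d} \<Longrightarrow>
       norm (P1 (\<rho>\<^sup>2) x + \<rho> * sin (\<rho> * of_real x)) \<le> K * exp (\<bar>Im \<rho>\<bar> * x)"
    using asymptotics by metis
  have dd: "d \<in> {0..d}" using d by simp
  have e0: "((\<lambda>\<tau>. exp (- 2 * \<tau> * d)) \<longlongrightarrow> 0) at_top"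
    using power_exp_tendsto_0[of "2 * d" 0] d by (simp add: mult.commute mult.left_commute)
  have k0: "((\<lambda>\<tau>. K / \<tau>) \<longlongrightarrow> 0) at_top"
    by (rule real_tendsto_divide_at_top[OF tendsto_const filterlim_ident])
  have cosi: "cos (\<i> * of_real \<tau> * of_real d) * of_real (exp (- \<tau> * d)) = complex_of_real ((1 + exp (- 2 * \<tau> * d)) / 2)"
    and sini: "- (\<i> * of_real \<tau> * sin (\<i> * of_real \<tau> * of_real d)) * of_real (exp (- \<tau> * d)) = complex_of_real (\<tau> * ((1 - exp (- 2 * \<tau> * d)) / 2))" for \<tau>
  proof -
    define u where "u = exp (\<tau> * d)"
    define v where "v = exp (- \<tau> * d)"
    have uv: "u * v = 1" "v * v = exp (- 2 * \<tau> * d)" by (simp_all add: u_def v_def flip: exp_add)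
    have ex: "exp (\<i> * (\<i> * of_real \<tau> * of_real d)) = complex_of_real v" "exp (- (\<i> * (\<i> * of_real \<tau> * of_real d))) = complex_of_real u"
      by (simp_all add: u_def v_def mult.assoc[symmetric] flip: exp_of_real)
    have "cos (\<i> * of_real \<tau> * of_real d) = complex_of_real ((v + u) / 2)"
      unfolding cos_exp_eq ex by simp
    then have "cos (\<i> * of_real \<tau> * of_real d) * of_real v = complex_of_real ((v * v + u * v) / 2)"
      by (simp add: algebra_simps)
    then show "cos (\<i> * of_real \<tau> * of_real d) * of_real (exp (- \<tau> * d)) = complex_of_real ((1 + exp (- 2 * \<tau> * d)) / 2)"
      unfolding uv by (simp add: v_def add.commute)
    have "\<i> * sin (\<i> * of_real \<tau> * of_real d) = complex_of_real ((v - u) / 2)"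
      unfolding sin_exp_eq ex by (simp add: field_simps)
    then have "- (\<i> * of_real \<tau> * sin (\<i> * of_real \<tau> * of_real d)) * of_real v = - of_real \<tau> * complex_of_real ((v - u) / 2) * of_real v"
      by (simp add: mult.commute mult.left_commute)
    also have "\<dots> = complex_of_real (\<tau> * ((u * v - v * v) / 2))" by (simp add: algebra_simps)
    finally show "- (\<i> * of_real \<tau> * sin (\<i> * of_real \<tau> * of_real d)) * of_real (exp (- \<tau> * d)) = complex_of_real (\<tau> * ((1 - exp (- 2 * \<tau> * d)) / 2))"
      unfolding uv by (simp add: v_def)
  qed
  have nv: "norm (complex_of_real (exp (- \<tau> * d))) = exp (- \<tau> * d)" and ee: "exp (\<tau> * d) * exp (- \<tau> * d) = 1" for \<tau>
    by (simp_all only: norm_of_real abs_exp_cancel, simp flip: exp_add)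
  have ev: "\<forall>\<^sub>F \<tau> in at_top. \<tau> \<ge> R \<and> \<tau> > 0"
    using eventually_ge_at_top[of R] by eventually_elim (use R in auto)
  have main: "((\<lambda>\<tau>. complex_of_real ((1 + exp (- 2 * \<tau> * d)) / 2)) \<longlongrightarrow> of_real ((1 + 0) / 2)) at_top"
    "((\<lambda>\<tau>. complex_of_real ((1 - exp (- 2 * \<tau> * d)) / 2)) \<longlongrightarrow> of_real ((1 - 0) / 2)) at_top"
    by (intro tendsto_intros e0; simp)+
  have "((\<lambda>\<tau>. Y1 ((\<i> * of_real \<tau>)\<^sup>2) d * of_real (exp (- \<tau> * d)) - complex_of_real ((1 + exp (- 2 * \<tau> * d)) / 2)) \<longlongrightarrow> 0) at_top"
  proof (rule Lim_null_comparison[OF _ k0])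
    show "\<forall>\<^sub>F \<tau> in at_top. norm (Y1 ((\<i> * of_real \<tau>)\<^sup>2) d * of_real (exp (- \<tau> * d)) - complex_of_real ((1 + exp (- 2 * \<tau> * d)) / 2)) \<le> K / \<tau>"
      using ev
    proof eventually_elim
      case (elim \<tau>)
      have n: "norm (\<i> * complex_of_real \<tau>) = \<tau>" "\<bar>Im (\<i> * complex_of_real \<tau>)\<bar> = \<tau>" using elim by (simp_all add: norm_mult)
      have "norm (Y1 ((\<i> * of_real \<tau>)\<^sup>2) d - cos (\<i> * of_real \<tau> * of_real d)) \<le> K * exp (\<tau> * d) / \<tau>"
        using A1[of "\<i> * of_real \<tau>", OF _ dd] elim unfolding n by simp
      from mult_right_mono[OF this, of "exp (- \<tau> * d)"]
      have "norm (Y1 ((\<i> * of_real \<tau>)\<^sup>2) d - cos (\<i> * of_real \<tau> * of_real d)) * norm (complex_of_real (exp (- \<tau> * d))) \<le> K / \<tau> * (exp (\<tau> * d) * exp (- \<tau> * d))"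
        unfolding nv by simp
      then show ?case unfolding norm_mult[symmetric] left_diff_distrib cosi ee by simp
    qed
  qed
  from tendsto_add[OF this main(1)]
  show "((\<lambda>\<tau>. Y1 ((\<i> * of_real \<tau>)\<^sup>2) d * of_real (exp (- \<tau> * d))) \<longlongrightarrow> 1 / 2) at_top" by simp
  have "((\<lambda>\<tau>. P1 ((\<i> * of_real \<tau>)\<^sup>2) d * of_real (exp (- \<tau> * d) / \<tau>) - complex_of_real ((1 - exp (- 2 * \<tau> * d)) / 2)) \<longlongrightarrow> 0) at_top"
  proof (rule Lim_null_comparison[OF _ k0])
    show "\<forall>\<^sub>F \<tau> in at_top. norm (P1 ((\<i> * of_real \<tau>)\<^sup>2) d * of_real (exp (- \<tau> * d) / \<tau>) - complex_of_real ((1 - exp (- 2 * \<tau> * d)) / 2)) \<le> K / \<tau>"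
      using ev
    proof eventually_elim
      case (elim \<tau>)
      have n: "norm (\<i> * complex_of_real \<tau>) = \<tau>" "\<bar>Im (\<i> * complex_of_real \<tau>)\<bar> = \<tau>" using elim by (simp_all add: norm_mult)
      have "norm (P1 ((\<i> * of_real \<tau>)\<^sup>2) d + \<i> * of_real \<tau> * sin (\<i> * of_real \<tau> * of_real d)) \<le> K * exp (\<tau> * d)"
        using A2[of "\<i> * of_real \<tau>", OF _ dd] elim unfolding n by simp
      from mult_right_mono[OF this, of "exp (- \<tau> * d)"]
      have "norm (P1 ((\<i> * of_real \<tau>)\<^sup>2) d - - (\<i> * of_real \<tau> * sin (\<i> * of_real \<tau> * of_real d))) * norm (complex_of_real (exp (- \<tau> * d))) \<le> K * (exp (\<tau> * d) * exp (- \<tau> * d))"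
        unfolding nv by simp
      then have "norm (P1 ((\<i> * of_real \<tau>)\<^sup>2) d * of_real (exp (- \<tau> * d)) - complex_of_real (\<tau> * ((1 - exp (- 2 * \<tau> * d)) / 2))) \<le> K"
        unfolding norm_mult[symmetric] left_diff_distrib sini ee by simp
      moreover have "P1 ((\<i> * of_real \<tau>)\<^sup>2) d * of_real (exp (- \<tau> * d)) - complex_of_real (\<tau> * ((1 - exp (- 2 * \<tau> * d)) / 2)) =
        of_real \<tau> * (P1 ((\<i> * of_real \<tau>)\<^sup>2) d * of_real (exp (- \<tau> * d) / \<tau>) - complex_of_real ((1 - exp (- 2 * \<tau> * d)) / 2))"
        using elim by (simp add: right_diff_distrib)
      ultimately show ?case using elim by (simp add: norm_mult pos_le_divide_eq mult.commute)
    qed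
  qed
  from tendsto_add[OF this main(2)]
  show "((\<lambda>\<tau>. P1 ((\<i> * of_real \<tau>)\<^sup>2) d * of_real (exp (- \<tau> * d) / \<tau>)) \<longlongrightarrow> 1 / 2) at_top" by simp
qed

end

section \<open>Two problems with the same potential near the right end point\<close>

locale jump_problem_pair =
  J: jump_problem q h \<gamma> \<beta> d c Y1 P1 Y2 P2 + T: jump_problem qt ht \<gamma>t \<beta>t d c Y1t P1t Y2t P2t
  for q qt :: "real \<Rightarrow> complex" and h ht \<gamma> \<gamma>t :: complex and \<beta> \<beta>t d c :: real
    and Y1 P1 Y2 P2 Y1t P1t Y2t P2t :: "complex \<Rightarrow> real \<Rightarrow> complex" +
  fixes b :: real
  assumes b: "d < b" "b < c"
    and ae_right: "AE x in lebesgue. x \<in> {b..c} \<longrightarrow> q x = qt x"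
begin

definition F :: "complex \<Rightarrow> complex" where
  "F \<mu> = Y2 \<mu> b * P2t \<mu> b - P2 \<mu> b * Y2t \<mu> b"

lemma w: "(\<lambda>x. qt x - q x) absolutely_integrable_on {0..c}"
  by (intro set_integral_diff(1) J.q T.q)

lemma w1: "(\<lambda>x. qt x - q x) absolutely_integrable_on {0..d}" and w2: "(\<lambda>x. qt x - q x) absolutely_integrable_on {d..b}"
  using J.d b by (auto intro!: absolutely_integrable_on_subinterval[OF w])

lemma bc: "b \<in> {d..c}" "d \<in> {d..c}" "c \<in> {d..c}"
  using J.d b by auto

lemma sol2b: "sol (\<lambda>x. q x - \<mu>) d b (Y2 \<mu>) (P2 \<mu>)" "sol (\<lambda>x. qt x - \<mu>) d b (Y2t \<mu>) (P2t \<mu>)"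
  using b by (auto intro: sol_subset[OF J.sol2] sol_subset[OF T.sol2])

lemma F_holomorphic: "F holomorphic_on UNIV"
  unfolding F_def by (intro holomorphic_intros J.f2.holomorphic T.f2.holomorphic bc)

lemma common_upper_bounds:
  obtains K R where "R \<ge> 1" "K \<ge> 0"
    "\<And>(\<rho>::complex) x. norm \<rho> \<ge> R \<Longrightarrow> x \<in> {0..d} \<Longrightarrow> norm (Y1 (\<rho>\<^sup>2) x) \<le> K * exp (\<bar>Im \<rho>\<bar> * x)"
    "\<And>(\<rho>::complex) x. norm \<rho> \<ge> R \<Longrightarrow> x \<in> {0..d} \<Longrightarrow> norm (Y1t (\<rho>\<^sup>2) x) \<le> K * exp (\<bar>Im \<rho>\<bar> * x)"
    "\<And>(\<rho>::complex) x. norm \<rho> \<ge> R \<Longrightarrow> x \<in> {d..c} \<Longrightarrow> norm (Y2 (\<rho>\<^sup>2) x) \<le> K * exp (\<bar>Im \<rho>\<bar> * x)"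
    "\<And>(\<rho>::complex) x. norm \<rho> \<ge> R \<Longrightarrow> x \<in> {d..c} \<Longrightarrow> norm (Y2t (\<rho>\<^sup>2) x) \<le> K * exp (\<bar>Im \<rho>\<bar> * x)"
    "\<And>(\<rho>::complex) x. norm \<rho> \<ge> R \<Longrightarrow> x \<in> {d..c} \<Longrightarrow>
       norm (Y2 (\<rho>\<^sup>2) x * P2t (\<rho>\<^sup>2) x - P2 (\<rho>\<^sup>2) x * Y2t (\<rho>\<^sup>2) x) \<le> K * norm \<rho> * exp (\<bar>Im \<rho>\<bar> * (2 * x))"
proof -
  obtain K1 R1 where 1: "R1 \<ge> 1" "K1 \<ge> 0"
    "\<And>(\<rho>::complex) x. norm \<rho> \<ge> R1 \<Longrightarrow> x \<in> {0..d} \<Longrightarrow> norm (Y1 (\<rho>\<^sup>2) x) \<le> K1 * exp (\<bar>Im \<rho>\<bar> * x)"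
    "\<And>(\<rho>::complex) x. norm \<rho> \<ge> R1 \<Longrightarrow> x \<in> {d..c} \<Longrightarrow> norm (Y2 (\<rho>\<^sup>2) x) \<le> K1 * exp (\<bar>Im \<rho>\<bar> * x)"
    "\<And>(\<rho>::complex) x. norm \<rho> \<ge> R1 \<Longrightarrow> x \<in> {d..c} \<Longrightarrow> norm (P2 (\<rho>\<^sup>2) x) \<le> K1 * norm \<rho> * exp (\<bar>Im \<rho>\<bar> * x)"
    by (rule J.upper_bounds) (rule that)
  obtain K2 R2 where 2: "R2 \<ge> 1" "K2 \<ge> 0"
    "\<And>(\<rho>::complex) x. norm \<rho> \<ge> R2 \<Longrightarrow> x \<in> {0..d} \<Longrightarrow> norm (Y1t (\<rho>\<^sup>2) x) \<le> K2 * exp (\<bar>Im \<rho>\<bar> * x)"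
    "\<And>(\<rho>::complex) x. norm \<rho> \<ge> R2 \<Longrightarrow> x \<in> {d..c} \<Longrightarrow> norm (Y2t (\<rho>\<^sup>2) x) \<le> K2 * exp (\<bar>Im \<rho>\<bar> * x)"
    "\<And>(\<rho>::complex) x. norm \<rho> \<ge> R2 \<Longrightarrow> x \<in> {d..c} \<Longrightarrow> norm (P2t (\<rho>\<^sup>2) x) \<le> K2 * norm \<rho> * exp (\<bar>Im \<rho>\<bar> * x)"
    by (rule T.upper_bounds) (rule that)
  define K where "K = max (max K1 K2) (2 * (K1 * K2))"
  define R where "R = max R1 R2"
  have le: "K1 * exp t \<le> K * exp t" "K2 * exp t \<le> K * exp t" for t :: real by (auto simp: K_def)
  have R: "norm \<rho> \<ge> R1" "norm \<rho> \<ge> R2" if "norm \<rho> \<ge> R" for \<rho> :: complex using that by (auto simp: R_def)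
  show ?thesis
  proof (rule that[of R K])
    show "R \<ge> 1" "K \<ge> 0" using 1(1,2) by (auto simp: R_def K_def)
    fix \<rho> :: complex and x assume \<rho>: "norm \<rho> \<ge> R"
    show "norm (Y1 (\<rho>\<^sup>2) x) \<le> K * exp (\<bar>Im \<rho>\<bar> * x)" if "x \<in> {0..d}"
      using order_trans[OF 1(3)[OF R(1)[OF \<rho>] that] le(1)] .
    show "norm (Y1t (\<rho>\<^sup>2) x) \<le> K * exp (\<bar>Im \<rho>\<bar> * x)" if "x \<in> {0..d}"
      using order_trans[OF 2(3)[OF R(2)[OF \<rho>] that] le(2)] .
    show "norm (Y2 (\<rho>\<^sup>2) x) \<le> K * exp (\<bar>Im \<rho>\<bar> * x)" if "x \<in> {d..c}"
      using order_trans[OF 1(4)[OF R(1)[OF \<rho>] that] le(1)] .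
    show "norm (Y2t (\<rho>\<^sup>2) x) \<le> K * exp (\<bar>Im \<rho>\<bar> * x)" if "x \<in> {d..c}"
      using order_trans[OF 2(4)[OF R(2)[OF \<rho>] that] le(2)] .
    assume x: "x \<in> {d..c}"
    define e where "e = exp (\<bar>Im \<rho>\<bar> * x)"
    have ee: "e * e = exp (\<bar>Im \<rho>\<bar> * (2 * x))" by (simp add: e_def flip: exp_add)
    have "norm (Y2 (\<rho>\<^sup>2) x * P2t (\<rho>\<^sup>2) x - P2 (\<rho>\<^sup>2) x * Y2t (\<rho>\<^sup>2) x) \<le>
        norm (Y2 (\<rho>\<^sup>2) x) * norm (P2t (\<rho>\<^sup>2) x) + norm (P2 (\<rho>\<^sup>2) x) * norm (Y2t (\<rho>\<^sup>2) x)"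
      using norm_triangle_ineq4 by (simp flip: norm_mult)
    also have "\<dots> \<le> (K1 * e) * (K2 * norm \<rho> * e) + (K1 * norm \<rho> * e) * (K2 * e)"
      unfolding e_def using 1(2) 2(2)
      by (intro add_mono mult_mono 1(4,5)[OF R(1)[OF \<rho>] x] 2(4,5)[OF R(2)[OF \<rho>] x]) auto
    also have "\<dots> = 2 * (K1 * K2) * norm \<rho> * (e * e)" by (simp add: algebra_simps)
    also have "\<dots> \<le> K * norm \<rho> * (e * e)" by (intro mult_right_mono) (auto simp: K_def e_def)
    finally show "norm (Y2 (\<rho>\<^sup>2) x * P2t (\<rho>\<^sup>2) x - P2 (\<rho>\<^sup>2) x * Y2t (\<rho>\<^sup>2) x) \<le> K * norm \<rho> * exp (\<bar>Im \<rho>\<bar> * (2 * x))"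
      by (simp only: ee)
  qed
qed

text \<open>Lagrange's identity from \<open>d\<close> to \<open>b\<close>. The Wronskian at
  \<open>d\<close> is at most of order \<open>\<tau> * exp (2 * \<tau> * d)\<close>, hence the power
  \<open>Suc M\<close> in \<open>l1\<close>, and is exponentially negligible because
  \<open>d < b\<close>; the integral term is what \<open>near\<close> controls.\<close>

lemma F_decay:
  assumes near: "\<And>\<epsilon>. \<epsilon> > 0 \<Longrightarrow> \<exists>\<delta>>0. \<delta> \<le> b - d \<and>
     (\<forall>\<tau>>0. \<tau> ^ M * integral {b - \<delta>..b} (\<lambda>x. norm (qt x - q x) * exp (- 2 * \<tau> * (b - x))) \<le> \<epsilon>)"
  shows "((\<lambda>\<tau>. \<tau> ^ M * norm (F ((\<i> * of_real \<tau>)\<^sup>2)) * exp (- \<tau> * (2 * b))) \<longlongrightarrow> 0) at_top"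
proof -
  obtain K R where R: "R \<ge> 1" and K: "K \<ge> 0" and
    U: "\<And>(\<rho>::complex) x. norm \<rho> \<ge> R \<Longrightarrow> x \<in> {d..c} \<Longrightarrow> norm (Y2 (\<rho>\<^sup>2) x) \<le> K * exp (\<bar>Im \<rho>\<bar> * x)"
    "\<And>(\<rho>::complex) x. norm \<rho> \<ge> R \<Longrightarrow> x \<in> {d..c} \<Longrightarrow> norm (Y2t (\<rho>\<^sup>2) x) \<le> K * exp (\<bar>Im \<rho>\<bar> * x)"
    "\<And>(\<rho>::complex) x. norm \<rho> \<ge> R \<Longrightarrow> x \<in> {d..c} \<Longrightarrow>
       norm (Y2 (\<rho>\<^sup>2) x * P2t (\<rho>\<^sup>2) x - P2 (\<rho>\<^sup>2) x * Y2t (\<rho>\<^sup>2) x) \<le> K * norm \<rho> * exp (\<bar>Im \<rho>\<bar> * (2 * x))"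
    using common_upper_bounds by metis
  define I where "I \<tau> = integral {d..b} (\<lambda>x. norm (qt x - q x) * exp (- 2 * \<tau> * (b - x)))" for \<tau>
  have l1: "((\<lambda>\<tau>. \<tau> ^ Suc M * exp (- (2 * (b - d) * \<tau>))) \<longlongrightarrow> 0) at_top"
    using b by (intro power_exp_tendsto_0) auto
  have l2: "((\<lambda>\<tau>. \<tau> ^ M * I \<tau>) \<longlongrightarrow> 0) at_top"
    unfolding I_def by (rule weighted_integral_tendsto_0[OF w2 b(1) near])
  have "((\<lambda>\<tau>. K * (\<tau> ^ Suc M * exp (- (2 * (b - d) * \<tau>))) + K\<^sup>2 * (\<tau> ^ M * I \<tau>)) \<longlongrightarrow> K * 0 + K\<^sup>2 * 0) at_top"
    by (intro tendsto_intros l1 l2)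
  then have lim: "((\<lambda>\<tau>. K * (\<tau> ^ Suc M * exp (- (2 * (b - d) * \<tau>))) + K\<^sup>2 * (\<tau> ^ M * I \<tau>)) \<longlongrightarrow> 0) at_top" by simp
  show ?thesis
  proof (rule Lim_null_comparison[OF _ lim])
    show "\<forall>\<^sub>F \<tau> in at_top. norm (\<tau> ^ M * norm (F ((\<i> * of_real \<tau>)\<^sup>2)) * exp (- \<tau> * (2 * b))) \<le>
        K * (\<tau> ^ Suc M * exp (- (2 * (b - d) * \<tau>))) + K\<^sup>2 * (\<tau> ^ M * I \<tau>)"
      using eventually_ge_at_top[of R]
    proof eventually_elim
      case (elim \<tau>)
      have \<tau>: "\<tau> > 0" using elim R by linarith
      define \<rho> where "\<rho> = \<i> * complex_of_real \<tau>"
      have n: "norm \<rho> = \<tau>" "\<bar>Im \<rho>\<bar> = \<tau>" using \<tau> by (simp_all add: \<rho>_def norm_mult)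
      have ge: "norm \<rho> \<ge> R" using elim n by simp
      have "norm (F (\<rho>\<^sup>2)) \<le> norm (Y2 (\<rho>\<^sup>2) d * P2t (\<rho>\<^sup>2) d - P2 (\<rho>\<^sup>2) d * Y2t (\<rho>\<^sup>2) d) + K\<^sup>2 * exp (2 * \<tau> * b) * I \<tau>"
        unfolding F_def I_def
      proof (rule wronskian_bound[OF _ sol2b w2])
        show "norm (Y2 (\<rho>\<^sup>2) x) \<le> K * exp (\<tau> * x)" "norm (Y2t (\<rho>\<^sup>2) x) \<le> K * exp (\<tau> * x)" if "x \<in> {d..b}" for x
          using U(1,2)[OF ge, of x] that b unfolding n by auto
      qed (use b in simp)
      also have "norm (Y2 (\<rho>\<^sup>2) d * P2t (\<rho>\<^sup>2) d - P2 (\<rho>\<^sup>2) d * Y2t (\<rho>\<^sup>2) d) \<le> K * \<tau> * exp (\<tau> * (2 * d))"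
        using U(3)[OF ge bc(2)] unfolding n .
      finally have "norm (F (\<rho>\<^sup>2)) \<le> K * \<tau> * exp (\<tau> * (2 * d)) + K\<^sup>2 * exp (2 * \<tau> * b) * I \<tau>" by simp
      then have "(\<tau> ^ M * exp (- \<tau> * (2 * b))) * norm (F (\<rho>\<^sup>2)) \<le>
          (\<tau> ^ M * exp (- \<tau> * (2 * b))) * (K * \<tau> * exp (\<tau> * (2 * d)) + K\<^sup>2 * exp (2 * \<tau> * b) * I \<tau>)"
        using \<tau> by (intro mult_left_mono) auto
      also have "\<dots> = K * (\<tau> ^ Suc M * (exp (\<tau> * (2 * d)) * exp (- \<tau> * (2 * b)))) +
          K\<^sup>2 * (\<tau> ^ M * I \<tau>) * (exp (2 * \<tau> * b) * exp (- \<tau> * (2 * b)))"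
        by (simp only: distrib_left power_Suc mult.commute mult.left_commute mult.assoc)
      also have "exp (\<tau> * (2 * d)) * exp (- \<tau> * (2 * b)) = exp (- (2 * (b - d) * \<tau>))"
        unfolding exp_add[symmetric] by (simp add: algebra_simps)
      also have "exp (2 * \<tau> * b) * exp (- \<tau> * (2 * b)) = 1"
        unfolding exp_add[symmetric] by simp
      finally show ?case using \<tau> by (simp add: \<rho>_def[symmetric] mult.commute mult.left_commute abs_mult)
    qed
  qed
qed

text \<open>The coefficients \<open>(a1, a2)\<close> cover both problems: \<open>(H, 1)\<close> for
  the Robin and \<open>(-1, 0)\<close> for the Dirichlet condition. The equation
  \<open>2 * b = c\<close> matches the growth \<open>exp (2 * \<tau> * b)\<close> of
  \<open>F\<close> with the growth of \<open>D\<close>.\<close>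

lemma F_eq_0:
  fixes a1 a2 :: complex and s \<kappa> k0 :: real and N0 j k M :: nat
  defines "D \<equiv> \<lambda>\<mu>. a1 * Y2 \<mu> c + a2 * P2 \<mu> c" and "Dt \<equiv> \<lambda>\<mu>. a1 * Y2t \<mu> c + a2 * P2t \<mu> c"
  assumes a: "a1 \<noteq> 0 \<or> a2 \<noteq> 0" and sp: "spectra_coincide_except k D Dt" and bb: "2 * b = c"
    and pos: "s \<ge> 0" "\<kappa> > 0" "k0 > 0"
    and lower: "\<And>N \<rho>. N \<ge> N0 \<Longrightarrow> on_square ((real N + s) * \<kappa>) \<rho> \<Longrightarrow> k0 * (norm \<rho> ^ j * exp (\<bar>Im \<rho>\<bar> * c)) \<le> norm (D (\<rho>\<^sup>2))"
    and Dt0: "Dt z1 \<noteq> 0"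
    and near: "\<And>\<epsilon>. \<epsilon> > 0 \<Longrightarrow> \<exists>\<delta>>0. \<delta> \<le> b - d \<and>
     (\<forall>\<tau>>0. \<tau> ^ M * integral {b - \<delta>..b} (\<lambda>x. norm (qt x - q x) * exp (- 2 * \<tau> * (b - x))) \<le> \<epsilon>)"
    and card: "2 * k \<le> M + j"
  shows "F z = 0"
proof -
  have qb: "q absolutely_integrable_on {b..c}" using J.d b by (intro absolutely_integrable_on_subinterval[OF J.q]) auto
  note Q = absolutely_integrable_diff_const[OF qb]
  have "\<exists>f. sol (\<lambda>x. q x - \<mu>) b c (fst f) (snd f) \<and> fst f b = u \<and> snd f b = v" for \<mu> u v
    using sol_exists_bounded[OF Q[of \<mu>], of u v] b by (metis fst_conv snd_conv less_imp_le)
  then obtain f where f: "\<And>\<mu> u v. sol (\<lambda>x. q x - \<mu>) b c (fst (f \<mu> u v)) (snd (f \<mu> u v))"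
    "\<And>\<mu> u v. fst (f \<mu> u v) b = u" "\<And>\<mu> u v. snd (f \<mu> u v) b = v" by metis
  interpret fc: sol_family q b c "\<lambda>\<mu>. fst (f \<mu> 1 0)" "\<lambda>\<mu>. snd (f \<mu> 1 0)"
    by unfold_locales (use b qb f in auto)
  interpret fs: sol_family q b c "\<lambda>\<mu>. fst (f \<mu> 0 1)" "\<lambda>\<mu>. snd (f \<mu> 0 1)"
    by unfold_locales (use b qb f in auto)
  have cc: "c \<in> {b..c}" and sub: "{b..c} \<subseteq> {d..c}" using b by auto
  define A where "A \<mu> = a1 * fst (f \<mu> 1 0) c + a2 * snd (f \<mu> 1 0) c" for \<mu>
  define B where "B \<mu> = a1 * fst (f \<mu> 0 1) c + a2 * snd (f \<mu> 0 1) c" for \<mu>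
  have W: "fst (f \<mu> 1 0) c * snd (f \<mu> 0 1) c - snd (f \<mu> 1 0) c * fst (f \<mu> 0 1) c = 1" for \<mu>
    using wronskian_const[OF f(1) f(1) cc, of \<mu> 1 0 0 1] by (simp add: f)
  \<comment> \<open>The boundary condition is transported from \<open>c\<close> back to
    \<open>b\<close> by a matrix of determinant 1, so a nonzero condition stays nonzero.\<close>
  have AB: "A \<mu> \<noteq> 0 \<or> B \<mu> \<noteq> 0" for \<mu>
  proof (rule ccontr)
    assume "\<not> (A \<mu> \<noteq> 0 \<or> B \<mu> \<noteq> 0)"
    then have AB0: "A \<mu> = 0" "B \<mu> = 0" by auto
    have "A \<mu> * snd (f \<mu> 0 1) c - B \<mu> * snd (f \<mu> 1 0) c = a1 * (fst (f \<mu> 1 0) c * snd (f \<mu> 0 1) c - snd (f \<mu> 1 0) c * fst (f \<mu> 0 1) c)"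
      "B \<mu> * fst (f \<mu> 1 0) c - A \<mu> * fst (f \<mu> 0 1) c = a2 * (fst (f \<mu> 1 0) c * snd (f \<mu> 0 1) c - snd (f \<mu> 1 0) c * fst (f \<mu> 0 1) c)"
      by (simp_all add: A_def B_def algebra_simps)
    with a show False by (simp add: AB0 W)
  qed
  have rep: "a1 * y c + a2 * p c = A \<mu> * y b + B \<mu> * p b" if y: "sol (\<lambda>x. q x - \<mu>) b c y p" for y p \<mu>
    using sol_eq_fundamental[OF y f(1) f(1) f(2,3) f(2,3) cc] by (simp add: A_def B_def algebra_simps)
  have D: "D \<mu> = A \<mu> * Y2 \<mu> b + B \<mu> * P2 \<mu> b" for \<mu>
    unfolding D_def by (rule rep[OF sol_subset[OF J.sol2 sub]])
  \<comment> \<open>On \<open>[b, c]\<close> the second solution also satisfies the equation with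
    potential \<open>q\<close>, so \<open>Dt\<close> has the same coefficients \<open>A\<close> and
    \<open>B\<close> as \<open>D\<close>.\<close>
  have "sol (\<lambda>x. q x - \<mu>) b c (Y2t \<mu>) (P2t \<mu>)" for \<mu>
  proof (rule sol_spike[OF sol_subset[OF T.sol2 sub]])
    show "AE x in lebesgue. x \<in> {b..c} \<longrightarrow> qt x - \<mu> = q x - \<mu>" using ae_right by eventually_elim simp
  qed
  from rep[OF this] have Dt: "Dt \<mu> = A \<mu> * Y2t \<mu> b + B \<mu> * P2t \<mu> b" for \<mu> by (simp add: Dt_def)
  obtain K R where R: "R \<ge> 1" and K: "K \<ge> 0" and
    U: "\<And>(\<rho>::complex) x. norm \<rho> \<ge> R \<Longrightarrow> x \<in> {d..c} \<Longrightarrow>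
       norm (Y2 (\<rho>\<^sup>2) x * P2t (\<rho>\<^sup>2) x - P2 (\<rho>\<^sup>2) x * Y2t (\<rho>\<^sup>2) x) \<le> K * norm \<rho> * exp (\<bar>Im \<rho>\<bar> * (2 * x))"
    using common_upper_bounds by metis
  define r where "r N = (real N + s) * \<kappa>" for N
  have "\<forall>\<^sub>F N in sequentially. r N \<ge> R"
    using filterlim_arith_at_top[OF pos(2,1)] unfolding filterlim_at_top r_def by blast
  then obtain N1 where N1: "\<And>N. N \<ge> N1 \<Longrightarrow> r N \<ge> R" unfolding eventually_sequentially by blast
  define N2 where "N2 = max N0 N1"
  have D0: "D ((of_real (r N2))\<^sup>2) \<noteq> 0"
  proof -
    have "r N2 \<ge> 1" using N1[of N2] R by (simp add: N2_def)
    then have "on_square (r N2) (of_real (r N2))" by (simp add: on_square_def)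
    then have "k0 * (norm (complex_of_real (r N2)) ^ j * exp (\<bar>Im (complex_of_real (r N2))\<bar> * c)) \<le> norm (D ((of_real (r N2))\<^sup>2))"
      unfolding r_def by (intro lower) (auto simp: N2_def)
    moreover have "0 < k0 * (norm (complex_of_real (r N2)) ^ j * exp (\<bar>Im (complex_of_real (r N2))\<bar> * c))"
      using pos \<open>r N2 \<ge> 1\<close> by (intro mult_pos_pos zero_less_power) auto
    ultimately show ?thesis by auto
  qed
  have hol: "D holomorphic_on UNIV" "Dt holomorphic_on UNIV" "A holomorphic_on UNIV" "B holomorphic_on UNIV"
    unfolding D_def Dt_def A_def B_def
    by (intro holomorphic_intros J.f2.holomorphic T.f2.holomorphic fc.holomorphic fs.holomorphic cc bc)+
  obtain Q lam and L :: "nat set" where Q: "Q holomorphic_on UNIV" "finite L" "card L = k"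
    "\<And>z. D z \<noteq> 0 \<Longrightarrow> Q z = F z * (\<Prod>n\<in>L. z - lam n) / D z"
    by (rule common_spectrum_quotient[OF hol(1,2) F_holomorphic hol(3,4)
          J.f2.holomorphic[OF bc(1)] T.f2.holomorphic[OF bc(1)] D Dt F_def AB D0 Dt0 sp]) (rule that)
  show ?thesis
  proof (rule quotient_vanishes[OF Q(1) F_holomorphic hol(1) Q(2,4) pos, where K=K and M=M and c=c and j=j and ?N0.0=N2])
    show "(real N + s) * \<kappa> \<ge> 1" if "N \<ge> N2" for N using N1[of N] R that by (simp add: N2_def r_def)
    show "k0 * (norm \<rho> ^ j * exp (\<bar>Im \<rho>\<bar> * c)) \<le> norm (D (\<rho>\<^sup>2))" if "N \<ge> N2" "on_square ((real N + s) * \<kappa>) \<rho>" for N \<rho>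
      using lower[OF _ that(2)] that(1) by (simp add: N2_def)
    show "norm (F (\<rho>\<^sup>2)) \<le> K * norm \<rho> * exp (\<bar>Im \<rho>\<bar> * c)" if "N \<ge> N2" "on_square ((real N + s) * \<kappa>) \<rho>" for N \<rho>
    proof -
      have "norm \<rho> \<ge> R" using N1[of N] that norm_ge_on_square[OF that(2)] by (simp add: N2_def r_def)
      from U[OF this bc(1)] show ?thesis unfolding F_def bb .
    qed
    show "((\<lambda>\<tau>. \<tau> ^ M * norm (F ((\<i> * of_real \<tau>)\<^sup>2)) * exp (- \<tau> * c)) \<longlongrightarrow> 0) at_top"
      using F_decay[OF near] unfolding bb .
    show "2 * card L \<le> M + j" using card by (simp add: Q(3))
  qed
qed

end

section \<open>Recovering the coefficients from the vanishing of the Wronskian at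
  \<open>b\<close>\<close>

context jump_problem_pair
begin

lemma potential_eq_right_of_jump:
  assumes F0: "\<And>\<mu>. F \<mu> = 0"
  shows "AE x in lebesgue. x \<in> {d..b} \<longrightarrow> q x = qt x"
proof -
  obtain K1 R1 where 1: "R1 \<ge> 1" "K1 \<ge> 0"
    "\<And>\<rho> r x. on_square r \<rho> \<Longrightarrow> r \<ge> R1 \<Longrightarrow> (cos (r * b))\<^sup>2 = 1 \<Longrightarrow> x \<in> {d..b} \<Longrightarrow>
       Y2 (\<rho>\<^sup>2) b \<noteq> 0 \<and> norm (Y2 (\<rho>\<^sup>2) x) \<le> K1 * exp (- (\<bar>Im \<rho>\<bar> * (b - x))) * norm (Y2 (\<rho>\<^sup>2) b)"
    by (rule J.comparison_Y2[OF bc(1)]) (rule that)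
  obtain K2 R2 where 2: "R2 \<ge> 1" "K2 \<ge> 0"
    "\<And>\<rho> r x. on_square r \<rho> \<Longrightarrow> r \<ge> R2 \<Longrightarrow> (cos (r * b))\<^sup>2 = 1 \<Longrightarrow> x \<in> {d..b} \<Longrightarrow>
       Y2t (\<rho>\<^sup>2) b \<noteq> 0 \<and> norm (Y2t (\<rho>\<^sup>2) x) \<le> K2 * exp (- (\<bar>Im \<rho>\<bar> * (b - x))) * norm (Y2t (\<rho>\<^sup>2) b)"
    by (rule T.comparison_Y2[OF bc(1)]) (rule that)
  have b0: "b > 0" using b J.d by simp
  \<comment> \<open>The half sides are the multiples of \<open>pi / b\<close>, where the cosine of
    \<open>r * b\<close> is 1 or -1.\<close>
  define \<kappa> where "\<kappa> = pi / b"
  have \<kappa>: "\<kappa> > 0" using b0 by (simp add: \<kappa>_def)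
  have "\<forall>\<^sub>F N in sequentially. (real N + 0) * \<kappa> \<ge> max R1 R2"
    using filterlim_arith_at_top[OF \<kappa> order_refl] unfolding filterlim_at_top by blast
  then obtain N0 where N0: "\<And>N. N \<ge> N0 \<Longrightarrow> (real N + 0) * \<kappa> \<ge> max R1 R2" unfolding eventually_sequentially by blast
  have c1: "(cos ((real N + 0) * \<kappa> * b))\<^sup>2 = 1" for N
    using b0 by (simp add: \<kappa>_def mult.commute[of _ pi] flip: power_mult)
  have le: "y \<noteq> 0 \<and> norm z \<le> max K1 K2 * e * norm y" if "y \<noteq> 0 \<and> norm z \<le> k * e * norm y" "k \<le> max K1 K2" "e \<ge> 0"
    for y z :: complex and k e
  proof -
    have "k * e * norm y \<le> max K1 K2 * e * norm y" using that by (intro mult_right_mono) auto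
    with that show ?thesis by linarith
  qed
  show ?thesis
  proof (rule borg_marchenko[OF b(1) _ _ sol2b(1) sol2b(2) _ order_refl \<kappa>, where K="max K1 K2" and ?N0.0=N0])
    show "q absolutely_integrable_on {d..b}" "qt absolutely_integrable_on {d..b}"
      using J.d b by (auto intro!: absolutely_integrable_on_subinterval[OF J.q] absolutely_integrable_on_subinterval[OF T.q])
    show "Y2 \<mu> b * P2t \<mu> b = P2 \<mu> b * Y2t \<mu> b" for \<mu> using F0[of \<mu>] by (simp add: F_def)
    fix N \<rho> x assume N: "N \<ge> N0" and sq: "on_square ((real N + 0) * \<kappa>) \<rho>" and x: "x \<in> {d..b}"
    show "Y2 (\<rho>\<^sup>2) b \<noteq> 0 \<and> norm (Y2 (\<rho>\<^sup>2) x) \<le> max K1 K2 * exp (- (\<bar>Im \<rho>\<bar> * (b - x))) * norm (Y2 (\<rho>\<^sup>2) b)"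
      by (rule le[OF 1(3)[OF sq _ c1 x]]) (use N0[OF N] in auto)
    show "Y2t (\<rho>\<^sup>2) b \<noteq> 0 \<and> norm (Y2t (\<rho>\<^sup>2) x) \<le> max K1 K2 * exp (- (\<bar>Im \<rho>\<bar> * (b - x))) * norm (Y2t (\<rho>\<^sup>2) b)"
      by (rule le[OF 2(3)[OF sq _ c1 x]]) (use N0[OF N] in auto)
  qed
qed

text \<open>The potentials now agree on \<open>[d, b]\<close>, so the Wronskian is constant there;
  its vanishing is rewritten through the jump conditions at \<open>d\<close>.\<close>

lemma jump_relation:
  assumes F0: "\<And>\<mu>. F \<mu> = 0"
  shows "\<beta> * Y1 \<mu> d * (P1t \<mu> d / \<beta>t + \<gamma>t * Y1t \<mu> d) = (P1 \<mu> d / \<beta> + \<gamma> * Y1 \<mu> d) * (\<beta>t * Y1t \<mu> d)"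
proof -
  have ae: "AE x in lebesgue. x \<in> {d..b} \<longrightarrow> qt x - \<mu> = q x - \<mu>"
    using potential_eq_right_of_jump[OF F0] by eventually_elim simp
  have bb: "b \<in> {d..b}" using b by simp
  have "Y2 \<mu> b * P2t \<mu> b - P2 \<mu> b * Y2t \<mu> b = Y2 \<mu> d * P2t \<mu> d - P2 \<mu> d * Y2t \<mu> d"
    by (rule wronskian_const[OF sol2b(1) sol_spike[OF sol2b(2) ae] bb])
  then show ?thesis using F0[of \<mu>] by (simp add: F_def J.init2 T.init2)
qed

text \<open>Multiplied by \<open>exp (- 2 * \<tau> * d) / \<tau>\<close> the two sides of the jump
  relation tend to \<open>\<beta> / (4 * \<beta>t)\<close> and
  \<open>\<beta>t / (4 * \<beta>)\<close>, so the squares agree and positivity settles the sign.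
  Then the Wronskian of the left parts at \<open>d\<close> is
  \<open>\<beta> * (\<gamma> - \<gamma>t)\<close> times their product, which grows like
  \<open>exp (2 * \<tau> * d) / 4\<close>, whereas Lagrange's identity from 0 makes this Wronskian
  of smaller order; hence the coefficient is 0.\<close>

lemma jump_coefficients_eq:
  assumes F0: "\<And>\<mu>. F \<mu> = 0"
  shows "\<beta> = \<beta>t" "\<gamma> = \<gamma>t"
proof -
  define u where "u \<tau> = Y1 ((\<i> * of_real \<tau>)\<^sup>2) d * of_real (exp (- \<tau> * d))" for \<tau>
  define ut where "ut \<tau> = Y1t ((\<i> * of_real \<tau>)\<^sup>2) d * of_real (exp (- \<tau> * d))" for \<tau>
  define v where "v \<tau> = P1 ((\<i> * of_real \<tau>)\<^sup>2) d * of_real (exp (- \<tau> * d) / \<tau>)" for \<tau>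
  define vt where "vt \<tau> = P1t ((\<i> * of_real \<tau>)\<^sup>2) d * of_real (exp (- \<tau> * d) / \<tau>)" for \<tau>
  have lim: "(u \<longlongrightarrow> 1 / 2) at_top" "(ut \<longlongrightarrow> 1 / 2) at_top" "(v \<longlongrightarrow> 1 / 2) at_top" "(vt \<longlongrightarrow> 1 / 2) at_top"
    unfolding u_def ut_def v_def vt_def by (rule J.limits_imaginary_axis T.limits_imaginary_axis)+
  have inv0: "((\<lambda>\<tau>. complex_of_real (1 / \<tau>)) \<longlongrightarrow> 0) at_top"
    using tendsto_of_real[OF real_tendsto_divide_at_top[OF tendsto_const filterlim_ident, of "1::real"], where 'a=complex] by simp
  have rel: "\<beta> * u \<tau> * (vt \<tau> / \<beta>t + \<gamma>t * (ut \<tau> * of_real (1 / \<tau>))) = (v \<tau> / \<beta> + \<gamma> * (u \<tau> * of_real (1 / \<tau>))) * (\<beta>t * ut \<tau>)"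
    for \<tau>
  proof -
    define e where "e = complex_of_real (exp (- \<tau> * d))"
    define i where "i = complex_of_real (1 / \<tau>)"
    have ei: "complex_of_real (exp (- \<tau> * d) / \<tau>) = e * i" by (simp add: e_def i_def)
    have "(\<beta> * Y1 ((\<i> * of_real \<tau>)\<^sup>2) d * (P1t ((\<i> * of_real \<tau>)\<^sup>2) d / \<beta>t + \<gamma>t * Y1t ((\<i> * of_real \<tau>)\<^sup>2) d)) * (e * e * i) =
       ((P1 ((\<i> * of_real \<tau>)\<^sup>2) d / \<beta> + \<gamma> * Y1 ((\<i> * of_real \<tau>)\<^sup>2) d) * (\<beta>t * Y1t ((\<i> * of_real \<tau>)\<^sup>2) d)) * (e * e * i)"
      by (simp only: jump_relation[OF F0])
    then show ?thesis unfolding u_def ut_def v_def vt_def ei e_def[symmetric] i_def[symmetric]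
      by (simp add: algebra_simps)
  qed
  have l1: "((\<lambda>\<tau>. \<beta> * u \<tau> * (vt \<tau> / \<beta>t + \<gamma>t * (ut \<tau> * of_real (1 / \<tau>)))) \<longlongrightarrow>
      of_real \<beta> * (1 / 2) * ((1 / 2) / of_real \<beta>t + \<gamma>t * ((1 / 2) * 0))) at_top"
    using T.\<beta> by (intro tendsto_mult tendsto_divide tendsto_add tendsto_const lim inv0) simp_all
  have l2: "((\<lambda>\<tau>. (v \<tau> / \<beta> + \<gamma> * (u \<tau> * of_real (1 / \<tau>))) * (\<beta>t * ut \<tau>)) \<longlongrightarrow>
      ((1 / 2) / of_real \<beta> + \<gamma> * ((1 / 2) * 0)) * (of_real \<beta>t * (1 / 2))) at_top"
    using J.\<beta> by (intro tendsto_mult tendsto_divide tendsto_add tendsto_const lim inv0) simp_all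
  have "of_real \<beta> * (1 / 2) * ((1 / 2) / of_real \<beta>t + \<gamma>t * ((1 / 2) * 0)) = ((1 / 2) / of_real \<beta> + \<gamma> * ((1 / 2) * 0)) * (of_real \<beta>t * (1 / 2))"
    by (rule tendsto_unique[OF _ l1[unfolded rel] l2]) simp
  then have "complex_of_real (\<beta> * \<beta>) = complex_of_real (\<beta>t * \<beta>t)" using J.\<beta> T.\<beta> by (simp add: field_simps)
  then have "\<beta>\<^sup>2 = \<beta>t\<^sup>2" unfolding of_real_eq_iff by (simp add: power2_eq_square)
  then show \<beta>: "\<beta> = \<beta>t" using J.\<beta> T.\<beta> by (simp add: power2_eq_iff)
  have rel2: "Y1 \<mu> d * P1t \<mu> d - P1 \<mu> d * Y1t \<mu> d = \<beta> * (\<gamma> - \<gamma>t) * (Y1 \<mu> d * Y1t \<mu> d)" for \<mu>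
    using jump_relation[OF F0, of \<mu>] J.\<beta> by (simp add: algebra_simps flip: \<beta>)
  obtain K R where R: "R \<ge> 1" and K: "K \<ge> 0" and
    U: "\<And>(\<rho>::complex) x. norm \<rho> \<ge> R \<Longrightarrow> x \<in> {0..d} \<Longrightarrow> norm (Y1 (\<rho>\<^sup>2) x) \<le> K * exp (\<bar>Im \<rho>\<bar> * x)"
    "\<And>(\<rho>::complex) x. norm \<rho> \<ge> R \<Longrightarrow> x \<in> {0..d} \<Longrightarrow> norm (Y1t (\<rho>\<^sup>2) x) \<le> K * exp (\<bar>Im \<rho>\<bar> * x)"
    using common_upper_bounds by metis
  define I where "I \<tau> = integral {0..d} (\<lambda>x. norm (qt x - q x) * exp (- 2 * \<tau> * (d - x)))" for \<tau>
  have "((\<lambda>\<tau>. \<tau> ^ 0 * I \<tau>) \<longlongrightarrow> 0) at_top"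
    unfolding I_def using J.d
    by (intro weighted_integral_tendsto_0[OF w1 J.d(1)] near_endpoint_integrable[OF w1]) auto
  then have I0: "(I \<longlongrightarrow> 0) at_top" by simp
  have e0: "((\<lambda>\<tau>. exp (- (2 * d * \<tau>))) \<longlongrightarrow> 0) at_top"
    using power_exp_tendsto_0[of "2 * d" 0] J.d by simp
  have "((\<lambda>\<tau>. norm (ht - h) * exp (- (2 * d * \<tau>)) + K\<^sup>2 * I \<tau>) \<longlongrightarrow> norm (ht - h) * 0 + K\<^sup>2 * 0) at_top"
    by (intro tendsto_intros I0 e0)
  then have lim0: "((\<lambda>\<tau>. norm (ht - h) * exp (- (2 * d * \<tau>)) + K\<^sup>2 * I \<tau>) \<longlongrightarrow> 0) at_top" by simp
  have "((\<lambda>\<tau>. \<beta> * (\<gamma> - \<gamma>t) * (u \<tau> * ut \<tau>)) \<longlongrightarrow> 0) at_top"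
  proof (rule Lim_null_comparison[OF _ lim0])
    show "\<forall>\<^sub>F \<tau> in at_top. norm (\<beta> * (\<gamma> - \<gamma>t) * (u \<tau> * ut \<tau>)) \<le> norm (ht - h) * exp (- (2 * d * \<tau>)) + K\<^sup>2 * I \<tau>"
      using eventually_ge_at_top[of R]
    proof eventually_elim
      case (elim \<tau>)
      have \<tau>: "\<tau> > 0" using elim R by linarith
      define \<rho> where "\<rho> = \<i> * complex_of_real \<tau>"
      have n: "norm \<rho> = \<tau>" "\<bar>Im \<rho>\<bar> = \<tau>" using \<tau> by (simp_all add: \<rho>_def norm_mult)
      have ge: "norm \<rho> \<ge> R" using elim n by simp
      define e where "e = exp (- \<tau> * d)"
      have ee: "e * e = exp (- (2 * d * \<tau>))" "exp (2 * \<tau> * d) * (e * e) = 1" by (simp_all add: e_def flip: exp_add)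
      have "norm (Y1 (\<rho>\<^sup>2) d * P1t (\<rho>\<^sup>2) d - P1 (\<rho>\<^sup>2) d * Y1t (\<rho>\<^sup>2) d) \<le>
         norm (Y1 (\<rho>\<^sup>2) 0 * P1t (\<rho>\<^sup>2) 0 - P1 (\<rho>\<^sup>2) 0 * Y1t (\<rho>\<^sup>2) 0) + K\<^sup>2 * exp (2 * \<tau> * d) * I \<tau>"
        unfolding I_def
      proof (rule wronskian_bound[OF _ J.sol1 T.sol1 w1])
        show "norm (Y1 (\<rho>\<^sup>2) x) \<le> K * exp (\<tau> * x)" "norm (Y1t (\<rho>\<^sup>2) x) \<le> K * exp (\<tau> * x)" if "x \<in> {0..d}" for x
          using U[OF ge that] unfolding n by auto
      qed (use J.d in simp)
      then have "norm (\<beta> * (\<gamma> - \<gamma>t) * (Y1 (\<rho>\<^sup>2) d * Y1t (\<rho>\<^sup>2) d)) \<le> norm (ht - h) + K\<^sup>2 * exp (2 * \<tau> * d) * I \<tau>"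
        unfolding rel2 by (simp add: J.init1 T.init1)
      from mult_right_mono[OF this, of "e * e"]
      have "norm (\<beta> * (\<gamma> - \<gamma>t) * (Y1 (\<rho>\<^sup>2) d * Y1t (\<rho>\<^sup>2) d)) * (e * e) \<le> norm (ht - h) * (e * e) + K\<^sup>2 * I \<tau> * (exp (2 * \<tau> * d) * (e * e))"
        by (simp add: algebra_simps)
      also have "norm (\<beta> * (\<gamma> - \<gamma>t) * (Y1 (\<rho>\<^sup>2) d * Y1t (\<rho>\<^sup>2) d)) * (e * e) =
         norm (\<beta> * (\<gamma> - \<gamma>t) * (Y1 (\<rho>\<^sup>2) d * Y1t (\<rho>\<^sup>2) d) * of_real (e * e))"
        by (simp add: norm_mult e_def)
      also have "\<beta> * (\<gamma> - \<gamma>t) * (Y1 (\<rho>\<^sup>2) d * Y1t (\<rho>\<^sup>2) d) * of_real (e * e) = \<beta> * (\<gamma> - \<gamma>t) * (u \<tau> * ut \<tau>)"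
        by (simp add: u_def ut_def \<rho>_def e_def algebra_simps)
      finally show ?case unfolding ee(2) mult_1_right unfolding ee(1) .
    qed
  qed
  moreover have "((\<lambda>\<tau>. \<beta> * (\<gamma> - \<gamma>t) * (u \<tau> * ut \<tau>)) \<longlongrightarrow> \<beta> * (\<gamma> - \<gamma>t) * (1 / 2 * (1 / 2))) at_top"
    by (intro tendsto_mult tendsto_const lim)
  ultimately have "0 = \<beta> * (\<gamma> - \<gamma>t) * (1 / 2 * (1 / 2))"
    using tendsto_unique[OF trivial_limit_at_top_linorder] by blast
  then show "\<gamma> = \<gamma>t" using J.\<beta> by simp
qed

text \<open>Equal jump coefficients turn the jump relation into a vanishing Wronskian at
  \<open>d\<close>, the hypothesis of \<open>borg_marchenko\<close> on
  \<open>[0, d]\<close>.\<close>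

lemma potential_eq_left_of_jump:
  assumes F0: "\<And>\<mu>. F \<mu> = 0"
  shows "AE x in lebesgue. x \<in> {0..d} \<longrightarrow> q x = qt x" and "h = ht"
proof -
  have W: "Y1 \<mu> d * P1t \<mu> d = P1 \<mu> d * Y1t \<mu> d" for \<mu>
    using jump_relation[OF F0, of \<mu>] J.\<beta> by (simp add: algebra_simps flip: jump_coefficients_eq[OF F0])
  obtain K1 R1 where 1: "R1 \<ge> 1" "K1 \<ge> 0"
    "\<And>\<rho> r x. on_square r \<rho> \<Longrightarrow> r \<ge> R1 \<Longrightarrow> (cos (r * d))\<^sup>2 = 1 \<Longrightarrow> x \<in> {0..d} \<Longrightarrow>
       Y1 (\<rho>\<^sup>2) d \<noteq> 0 \<and> norm (Y1 (\<rho>\<^sup>2) x) \<le> K1 * exp (- (\<bar>Im \<rho>\<bar> * (d - x))) * norm (Y1 (\<rho>\<^sup>2) d)"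
    by (rule J.comparison_Y1) (rule that)
  obtain K2 R2 where 2: "R2 \<ge> 1" "K2 \<ge> 0"
    "\<And>\<rho> r x. on_square r \<rho> \<Longrightarrow> r \<ge> R2 \<Longrightarrow> (cos (r * d))\<^sup>2 = 1 \<Longrightarrow> x \<in> {0..d} \<Longrightarrow>
       Y1t (\<rho>\<^sup>2) d \<noteq> 0 \<and> norm (Y1t (\<rho>\<^sup>2) x) \<le> K2 * exp (- (\<bar>Im \<rho>\<bar> * (d - x))) * norm (Y1t (\<rho>\<^sup>2) d)"
    by (rule T.comparison_Y1) (rule that)
  have b0: "d > 0" using J.d by simp
  \<comment> \<open>The half sides are adapted to the base point \<open>d\<close>:
    \<open>r * d\<close> is a multiple of \<pi>.\<close>
  define \<kappa> where "\<kappa> = pi / d"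
  have \<kappa>: "\<kappa> > 0" using b0 by (simp add: \<kappa>_def)
  have "\<forall>\<^sub>F N in sequentially. (real N + 0) * \<kappa> \<ge> max R1 R2"
    using filterlim_arith_at_top[OF \<kappa> order_refl] unfolding filterlim_at_top by blast
  then obtain N0 where N0: "\<And>N. N \<ge> N0 \<Longrightarrow> (real N + 0) * \<kappa> \<ge> max R1 R2" unfolding eventually_sequentially by blast
  have c1: "(cos ((real N + 0) * \<kappa> * d))\<^sup>2 = 1" for N
    using b0 by (simp add: \<kappa>_def mult.commute[of _ pi] flip: power_mult)
  have le: "y \<noteq> 0 \<and> norm z \<le> max K1 K2 * e * norm y" if "y \<noteq> 0 \<and> norm z \<le> k * e * norm y" "k \<le> max K1 K2" "e \<ge> 0"
    for y z :: complex and k e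
  proof -
    have "k * e * norm y \<le> max K1 K2 * e * norm y" using that by (intro mult_right_mono) auto
    with that show ?thesis by linarith
  qed
  show ae: "AE x in lebesgue. x \<in> {0..d} \<longrightarrow> q x = qt x"
  proof (rule borg_marchenko[OF J.d(1) J.q1 T.q1 J.sol1 T.sol1 W order_refl \<kappa>, where K="max K1 K2" and ?N0.0=N0])
    fix N \<rho> x assume N: "N \<ge> N0" and sq: "on_square ((real N + 0) * \<kappa>) \<rho>" and x: "x \<in> {0..d}"
    show "Y1 (\<rho>\<^sup>2) d \<noteq> 0 \<and> norm (Y1 (\<rho>\<^sup>2) x) \<le> max K1 K2 * exp (- (\<bar>Im \<rho>\<bar> * (d - x))) * norm (Y1 (\<rho>\<^sup>2) d)"
      by (rule le[OF 1(3)[OF sq _ c1 x]]) (use N0[OF N] in auto)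
    show "Y1t (\<rho>\<^sup>2) d \<noteq> 0 \<and> norm (Y1t (\<rho>\<^sup>2) x) \<le> max K1 K2 * exp (- (\<bar>Im \<rho>\<bar> * (d - x))) * norm (Y1t (\<rho>\<^sup>2) d)"
      by (rule le[OF 2(3)[OF sq _ c1 x]]) (use N0[OF N] in auto)
  qed
  have ae': "AE x in lebesgue. x \<in> {0..d} \<longrightarrow> qt x - 0 = q x - 0"
    using ae by eventually_elim simp
  \<comment> \<open>With equal potentials the Wronskian is constant down to 0, where it equals
    \<open>ht - h\<close>.\<close>
  have "Y1 0 d * P1t 0 d - P1 0 d * Y1t 0 d = Y1 0 0 * P1t 0 0 - P1 0 0 * Y1t 0 0"
    by (rule wronskian_const[OF J.sol1 sol_spike[OF T.sol1 ae']]) (use b0 in auto)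
  then show "h = ht" using W[of 0] by (simp add: J.init1 T.init1)
qed

end

theorem corollary3:
  fixes q qt :: "real \<Rightarrow> complex" and h ht H \<gamma> \<gamma>t :: complex
    and \<beta> \<beta>t d :: real and m :: int
  assumes "0 < d" and "d < pi / 2"
    and "q absolutely_integrable_on {0..pi}" and "qt absolutely_integrable_on {0..pi}"
    and "\<beta> > 0" and "\<beta>t > 0"
    and "m \<ge> -1"
    and "C_near m q (pi / 2)" and "C_near m qt (pi / 2)"
    and "AE x in lebesgue. x \<in> {pi / 2..pi} \<longrightarrow> q x = qt x"
    and "spectra_coincide_except (nat ((m + 2) div 2))
           (Delta q h H \<beta> \<gamma> d) (Delta qt ht H \<beta>t \<gamma>t d) \<or>
         spectra_coincide_except (nat ((m + 1) div 2))
           (Delta_inf q h \<beta> \<gamma> d) (Delta_inf qt ht \<beta>t \<gamma>t d)"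
  shows "h = ht \<and> \<beta> = \<beta>t \<and> \<gamma> = \<gamma>t \<and>
         (AE x in lebesgue. x \<in> {0..pi} \<longrightarrow> q x = qt x)"
proof -
  have d: "0 < d" "d < pi" using assms(1,2) by (auto intro: less_trans[of d "pi / 2" pi])
  obtain Y1 P1 Y2 P2 where J: "jump_problem q h \<gamma> \<beta> d pi Y1 P1 Y2 P2"
    and phi: "\<And>\<mu>. phi q h \<beta> \<gamma> d pi \<mu> = Y2 \<mu> pi" "\<And>\<mu>. dphi q h \<beta> \<gamma> d pi \<mu> = P2 \<mu> pi"
    by (rule phi_jump_problem[OF d assms(3,5)]) (rule that)
  obtain Y1t P1t Y2t P2t where T: "jump_problem qt ht \<gamma>t \<beta>t d pi Y1t P1t Y2t P2t"
    and phit: "\<And>\<mu>. phi qt ht \<beta>t \<gamma>t d pi \<mu> = Y2t \<mu> pi" "\<And>\<mu>. dphi qt ht \<beta>t \<gamma>t d pi \<mu> = P2t \<mu> pi"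
    by (rule phi_jump_problem[OF d assms(4,6)]) (rule that)
  interpret J: jump_problem q h \<gamma> \<beta> d pi Y1 P1 Y2 P2 by (rule J)
  interpret T: jump_problem qt ht \<gamma>t \<beta>t d pi Y1t P1t Y2t P2t by (rule T)
  interpret jump_problem_pair q qt h ht \<gamma> \<gamma>t \<beta> \<beta>t d pi Y1 P1 Y2 P2 Y1t P1t Y2t P2t "pi / 2"
    by unfold_locales (use assms(2,10) in auto)
  \<comment> \<open>The order of decay of \<open>F\<close> on the imaginary axis; it is 0 under the
    convention \<open>m = -1\<close>.\<close>
  define M where "M = nat (m + 1)"
  have near: "\<exists>\<delta>>0. \<delta> \<le> pi / 2 - d \<and>
     (\<forall>\<tau>>0. \<tau> ^ M * integral {pi / 2 - \<delta>..pi / 2} (\<lambda>x. norm (qt x - q x) * exp (- 2 * \<tau> * (pi / 2 - x))) \<le> \<epsilon>)"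
    if \<epsilon>: "\<epsilon> > 0" for \<epsilon>
  proof (cases "m = -1")
    case True
    then show ?thesis using near_endpoint_integrable[OF w2 assms(2) \<epsilon>] by (simp add: M_def)
  next
    case False
    define n where "n = nat m"
    have n: "m = int n" "M = Suc n" using False assms(7) by (auto simp: n_def M_def)
    show ?thesis unfolding n(2)
    proof (rule near_endpoint_flat[OF w2 assms(2) \<epsilon>])
      fix \<epsilon>' :: real assume "\<epsilon>' > 0"
      then show "\<exists>\<delta>>0. AE x in lebesgue. x \<in> {pi / 2 - \<delta>..pi / 2} \<longrightarrow> norm (qt x - q x) \<le> \<epsilon>' * (pi / 2 - x) ^ n"
        by (intro C_near_diff_flat[OF assms(8,9)[unfolded n(1)] _ assms(10)]) auto
    qed
  qed
  \<comment> \<open>Half-integer squares suit the \<open>sin\<close> in the leading term of the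
    first problem, integer ones the \<open>cos\<close> in that of the second.\<close>
  have sin1: "(sin ((real N + 1 / 2) * 1 * pi))\<^sup>2 = 1" for N
  proof -
    have "(real N + 1 / 2) * 1 * pi = pi * real N + pi / 2" by (simp add: algebra_simps)
    then show ?thesis by (simp add: sin_add flip: power_mult)
  qed
  have cos1: "(cos ((real N + 0) * 1 * pi))\<^sup>2 = 1" for N
    by (simp add: mult.commute[of _ pi] flip: power_mult)
  have F0: "F \<mu> = 0" for \<mu>
    using assms(11)
  proof
    assume sp: "spectra_coincide_except (nat ((m + 2) div 2)) (Delta q h H \<beta> \<gamma> d) (Delta qt ht H \<beta>t \<gamma>t d)"
    obtain k R where k: "k > 0" "R \<ge> 1" and lower: "\<And>\<rho> r. on_square r \<rho> \<Longrightarrow> r \<ge> R \<Longrightarrow> (sin (r * pi))\<^sup>2 = 1 \<Longrightarrow>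
       k * (norm \<rho> * exp (\<bar>Im \<rho>\<bar> * pi)) \<le> norm (P2 (\<rho>\<^sup>2) pi + H * Y2 (\<rho>\<^sup>2) pi)"
      by (rule J.lower_bound_P2[where H=H]) (rule that)
    obtain kt Rt where kt: "kt > 0" "Rt \<ge> 1" and lowert: "\<And>\<rho> r. on_square r \<rho> \<Longrightarrow> r \<ge> Rt \<Longrightarrow> (sin (r * pi))\<^sup>2 = 1 \<Longrightarrow>
       kt * (norm \<rho> * exp (\<bar>Im \<rho>\<bar> * pi)) \<le> norm (P2t (\<rho>\<^sup>2) pi + H * Y2t (\<rho>\<^sup>2) pi)"
      by (rule T.lower_bound_P2[where H=H]) (rule that)
    define N0 where "N0 = nat \<lceil>max R Rt\<rceil>"
    have N0: "(real N + 1 / 2) * 1 \<ge> R" "(real N + 1 / 2) * 1 \<ge> Rt" if "N \<ge> N0" for N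
      using that real_nat_ceiling_ge[of "max R Rt"] by (simp_all add: N0_def)
    define r0 where "r0 = (real N0 + 1 / 2) * 1"
    have "r0 > 0" by (simp add: r0_def)
    then have sq: "on_square r0 (of_real r0)" by (simp add: on_square_def)
    have "kt * (norm (complex_of_real r0) * exp (\<bar>Im (complex_of_real r0)\<bar> * pi)) > 0"
      using kt \<open>r0 > 0\<close> by simp
    then have nz: "H * Y2t ((of_real r0)\<^sup>2) pi + 1 * P2t ((of_real r0)\<^sup>2) pi \<noteq> 0"
      using lowert[OF sq N0(2)[OF order_refl, folded r0_def] sin1[of N0, folded r0_def]] by (auto simp: add.commute)
    show ?thesis
    proof (rule F_eq_0[of H 1 "nat ((m + 2) div 2)" "1 / 2" 1 k N0 1, OF _ _ _ _ _ k(1) _ nz near])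
      show "spectra_coincide_except (nat ((m + 2) div 2)) (\<lambda>\<mu>. H * Y2 \<mu> pi + 1 * P2 \<mu> pi) (\<lambda>\<mu>. H * Y2t \<mu> pi + 1 * P2t \<mu> pi)"
        using sp by (simp add: Delta_def[abs_def] phi phit add.commute)
      show "k * (norm \<rho> ^ 1 * exp (\<bar>Im \<rho>\<bar> * pi)) \<le> norm (H * Y2 (\<rho>\<^sup>2) pi + 1 * P2 (\<rho>\<^sup>2) pi)"
        if "N \<ge> N0" "on_square ((real N + 1 / 2) * 1) \<rho>" for N \<rho>
        using lower[OF that(2) N0(1)[OF that(1)] sin1] by (simp add: add.commute)
      \<comment> \<open>The integer part is the largest \<open>k\<close> with
        \<open>2 * k \<le> m + 2\<close>; the power \<open>j = 1\<close> comes from the derivative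
        in the boundary condition.\<close>
      show "2 * nat ((m + 2) div 2) \<le> M + 1" using assms(7) unfolding M_def by linarith
    qed auto
  next
    assume sp: "spectra_coincide_except (nat ((m + 1) div 2)) (Delta_inf q h \<beta> \<gamma> d) (Delta_inf qt ht \<beta>t \<gamma>t d)"
    obtain k R where k: "k > 0" "R \<ge> 1" and lower: "\<And>\<rho> r. on_square r \<rho> \<Longrightarrow> r \<ge> R \<Longrightarrow> (cos (r * pi))\<^sup>2 = 1 \<Longrightarrow>
       k * exp (\<bar>Im \<rho>\<bar> * pi) \<le> norm (Y2 (\<rho>\<^sup>2) pi)"
      by (rule J.lower_bound_Y2[OF bc(3)]) (rule that)
    obtain kt Rt where kt: "kt > 0" "Rt \<ge> 1" and lowert: "\<And>\<rho> r. on_square r \<rho> \<Longrightarrow> r \<ge> Rt \<Longrightarrow> (cos (r * pi))\<^sup>2 = 1 \<Longrightarrow>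
       kt * exp (\<bar>Im \<rho>\<bar> * pi) \<le> norm (Y2t (\<rho>\<^sup>2) pi)"
      by (rule T.lower_bound_Y2[OF bc(3)]) (rule that)
    define N0 where "N0 = nat \<lceil>max R Rt\<rceil>"
    have N0: "(real N + 0) * 1 \<ge> R" "(real N + 0) * 1 \<ge> Rt" if "N \<ge> N0" for N
      using that real_nat_ceiling_ge[of "max R Rt"] by (simp_all add: N0_def)
    define r0 where "r0 = (real N0 + 0) * 1"
    have "r0 \<ge> 0" by (simp add: r0_def)
    then have sq: "on_square r0 (of_real r0)" by (simp add: on_square_def)
    have "kt * exp (\<bar>Im (complex_of_real r0)\<bar> * pi) > 0" using kt by simp
    then have nz: "- 1 * Y2t ((of_real r0)\<^sup>2) pi + 0 * P2t ((of_real r0)\<^sup>2) pi \<noteq> 0"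
      using lowert[OF sq N0(2)[OF order_refl, folded r0_def] cos1[of N0, folded r0_def]] by auto
    show ?thesis
    proof (rule F_eq_0[of "- 1" 0 "nat ((m + 1) div 2)" 0 1 k N0 0, OF _ _ _ _ _ k(1) _ nz near])
      show "spectra_coincide_except (nat ((m + 1) div 2)) (\<lambda>\<mu>. - 1 * Y2 \<mu> pi + 0 * P2 \<mu> pi) (\<lambda>\<mu>. - 1 * Y2t \<mu> pi + 0 * P2t \<mu> pi)"
        using sp by (simp add: Delta_inf_def[abs_def] phi phit)
      show "k * (norm \<rho> ^ 0 * exp (\<bar>Im \<rho>\<bar> * pi)) \<le> norm (- 1 * Y2 (\<rho>\<^sup>2) pi + 0 * P2 (\<rho>\<^sup>2) pi)"
        if "N \<ge> N0" "on_square ((real N + 0) * 1) \<rho>" for N \<rho>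
        using lower[OF that(2) N0(1)[OF that(1)] cos1] by simp
      \<comment> \<open>The boundary condition contains no derivative, so \<open>j = 0\<close> and
        the largest admissible \<open>k\<close> is the integer part of
        \<open>(m + 1) / 2\<close>.\<close>
      show "2 * nat ((m + 1) div 2) \<le> M + 0" using assms(7) unfolding M_def by linarith
    qed auto
  qed
  have "AE x in lebesgue. x \<in> {0..pi} \<longrightarrow> q x = qt x"
    using potential_eq_left_of_jump(1)[OF F0] potential_eq_right_of_jump[OF F0] assms(10)
  proof eventually_elim
    case (elim x)
    then show ?case by (cases "x \<le> d"; cases "x \<le> pi / 2") auto
  qed
  then show ?thesis using potential_eq_left_of_jump(2)[OF F0] jump_coefficients_eq[OF F0] by blast
qed

end
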